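(* There is a polynomial-time algorithm with oracle access to a decision oracle for LCE which, on input two linearly equivalent $[n,k,d]_q$ codes $\mathcal{C}_1,\mathcal{C}_2$ (given by generator matrices), outputs a permutation $\pi\in\mathcal{S}_n$ such that there exists $v\in(\mathbb{F}_q^{*})^n$ for which the linear isometry $\tau=(\pi,v)$ satisfies $\tau(\mathcal{C}_1)=\mathcal{C}_2$. The algorithm makes at most $n^2$ calls to the LCE oracle, and each call is on a pair of codes over $\mathbb{F}_q$ of dimension $k$ and length at most $n^2(n+1)/2$.
   Context: $\mathbb{F}_q$ is the finite field with $q$ elements. An $[n,k,d]_q$ code is a $k$-dimensional $\mathbb{F}_q$-subspace of $\mathbb{F}_q^n$ whose minimum nonzero Hamming weight is $d$; $n$ is its length and $k$ its dimension. A generator matrix of such a code is a matrix in $\mathbb{F}_q^{k\times n}$ whose rows span the code. $\mathcal{S}_n$ is the group of permutations of $\{1,\dots,n\}$. A linear isometry of $\mathbb{F}_q^n$ is a pair $\tau=(\sigma,v)\in\mathcal{S}_n\rtimes(\mathbb{F}_q^* )^n$ acting by $\tau(x)=y$ with $y_{\sigma(i)}=v_{\sigma(i)}x_i$ for all $i$. LCE (Linear Code Equivalence, decision problem): given two $[n,k,d]_q$ codes $\mathcal{C}_1,\mathcal{C}_2$ by generator matrices $G_1,G_2$, decide whether there is a linear isometry $\tau$ with $\mathcal{C}_2=\tau(\mathcal{C}_1)$; equivalently whether there are $S\in\mathrm{GL}_k(\mathbb{F}_q)$, an $n\times n$ permutation matrix $P$ and an $n\times n$ diagonal matrix $D$ with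 nonzero diagonal entries such that $G_2=SG_1PD$. Two codes for which the answer is positive are called linearly equivalent. Polynomial time means polynomial in the size of the input, each oracle call counting as one step. *)

theory Defs
  imports
    "Jordan_Normal_Form.Missing_VectorSpace"
    "Jordan_Normal_Form.Matrix"
    "HOL-Combinatorics.Permutations"
    "HOL-Computational_Algebra.Polynomial"
begin

section \<open>Linear codes and linear equivalence\<close>

text \<open>
  Every finite field with \<open>q\<close> elements is isomorphic to one whose elements are named
  \<open>0, \<dots>, q - 1\<close>, so that field elements can be written down in binary. Nothing is assumed about
  which element gets which name. Coordinates are numbered \<open>0, \<dots>, n - 1\<close>.
\<close>

definition finite_field :: "nat \<Rightarrow> nat ring \<Rightarrow> bool" where
  "finite_field q F \<longleftrightarrow> field F \<and> carrier F = {..<q}"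

definition coord_space :: "nat ring \<Rightarrow> nat \<Rightarrow> (nat, nat \<Rightarrow> nat) module" where
  "coord_space F n = LinearCombinations.ring.func_space F {..<n}"

definition linear_code :: "nat ring \<Rightarrow> nat \<Rightarrow> nat \<Rightarrow> (nat \<Rightarrow> nat) set \<Rightarrow> bool" where
  "linear_code F n k C \<longleftrightarrow>
     VectorSpace.subspace F C (coord_space F n) \<and>
     vectorspace.dim F ((coord_space F n)\<lparr>carrier := C\<rparr>) = k"

definition hamming_weight :: "nat ring \<Rightarrow> nat \<Rightarrow> (nat \<Rightarrow> nat) \<Rightarrow> nat" where
  "hamming_weight F n x = card {i. i < n \<and> x i \<noteq> \<zero>\<^bsub>F\<^esub>}"

definition min_distance :: "nat ring \<Rightarrow> nat \<Rightarrow> (nat \<Rightarrow> nat) set \<Rightarrow> nat \<Rightarrow> bool" where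
  "min_distance F n C d \<longleftrightarrow>
     (\<exists>x\<in>C - {\<zero>\<^bsub>coord_space F n\<^esub>}. hamming_weight F n x = d) \<and>
     (\<forall>x\<in>C - {\<zero>\<^bsub>coord_space F n\<^esub>}. d \<le> hamming_weight F n x)"

definition nkd_code :: "nat ring \<Rightarrow> nat \<Rightarrow> nat \<Rightarrow> nat \<Rightarrow> (nat \<Rightarrow> nat) set \<Rightarrow> bool" where
  "nkd_code F n k d C \<longleftrightarrow> linear_code F n k C \<and> min_distance F n C d"

definition row_fun :: "nat mat \<Rightarrow> nat \<Rightarrow> nat \<Rightarrow> nat" where
  "row_fun G i = (\<lambda>j\<in>{..<dim_col G}. G $$ (i, j))"

definition generator_matrix ::
  "nat ring \<Rightarrow> nat \<Rightarrow> nat \<Rightarrow> nat mat \<Rightarrow> (nat \<Rightarrow> nat) set \<Rightarrow> bool" where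
  "generator_matrix F n k G C \<longleftrightarrow>
     G \<in> carrier_mat k n \<and> elements_mat G \<subseteq> carrier F \<and>
     LinearCombinations.module.span F (coord_space F n) (row_fun G ` {..<k}) = C"

text \<open>
  The isometry \<open>(\<sigma>, v)\<close> maps \<open>x\<close> to the \<open>y\<close> with \<open>y (\<sigma> i) = v (\<sigma> i) \<otimes> x i\<close> for \<open>i < n\<close>.
\<close>

definition isometry ::
  "nat ring \<Rightarrow> nat \<Rightarrow> (nat \<Rightarrow> nat) \<Rightarrow> (nat \<Rightarrow> nat) \<Rightarrow> (nat \<Rightarrow> nat) \<Rightarrow> (nat \<Rightarrow> nat)" where
  "isometry F n \<sigma> v x = (\<lambda>j\<in>{..<n}. v j \<otimes>\<^bsub>F\<^esub> x (inv_into {..<n} \<sigma> j))"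

lemma isometry_apply:
  assumes "\<sigma> permutes {..<n}" and "i < n"
  shows "isometry F n \<sigma> v x (\<sigma> i) = v (\<sigma> i) \<otimes>\<^bsub>F\<^esub> x i"
proof -
  have "inj_on \<sigma> {..<n}"
    using assms(1) by (rule permutes_inj_on)
  moreover have "\<sigma> i < n"
    using permutes_in_image[OF assms(1), of i] assms(2) by simp
  ultimately show ?thesis
    using assms(2) by (simp add: isometry_def)
qed

definition scaling :: "nat ring \<Rightarrow> nat \<Rightarrow> (nat \<Rightarrow> nat) \<Rightarrow> bool" where
  "scaling F n v \<longleftrightarrow> (\<forall>i<n. v i \<in> carrier F - {\<zero>\<^bsub>F\<^esub>})"

definition linearly_equivalent ::
  "nat ring \<Rightarrow> nat \<Rightarrow> (nat \<Rightarrow> nat) set \<Rightarrow> (nat \<Rightarrow> nat) set \<Rightarrow> bool" where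
  "linearly_equivalent F n C1 C2 \<longleftrightarrow>
     (\<exists>\<sigma> v. \<sigma> permutes {..<n} \<and> scaling F n v \<and> isometry F n \<sigma> v ` C1 = C2)"


section \<open>Oracle computations\<close>

text \<open>
  The machine model is Jones's language WHILE: imperative programs over binary trees, here with an
  instruction that asks a decision oracle about a tree. Evaluating an expression is charged at
  least the size of every tree that is read or built, so sharing of subtrees is not for free and a
  run of cost \<open>t\<close> is simulated by a multitape oracle Turing machine in time polynomial in \<open>t\<close>, and
  conversely.
\<close>

datatype tree = Leaf | Node tree tree

fun tree_size :: "tree \<Rightarrow> nat" where
  "tree_size Leaf = 1"
| "tree_size (Node a b) = 1 + tree_size a + tree_size b"

fun hd_tree :: "tree \<Rightarrow> tree" where
  "hd_tree Leaf = Leaf"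
| "hd_tree (Node a b) = a"

fun tl_tree :: "tree \<Rightarrow> tree" where
  "tl_tree Leaf = Leaf"
| "tl_tree (Node a b) = b"

datatype expr = EVar nat | ENil | ECons expr expr | EHd expr | ETl expr

datatype prog =
    Assign nat expr
  | Ask nat expr
  | Seq prog prog
  | Cond expr prog prog
  | While expr prog

type_synonym store = "nat \<Rightarrow> tree"

fun expr_val :: "expr \<Rightarrow> store \<Rightarrow> tree" where
  "expr_val (EVar x) s = s x"
| "expr_val ENil s = Leaf"
| "expr_val (ECons a b) s = Node (expr_val a s) (expr_val b s)"
| "expr_val (EHd a) s = hd_tree (expr_val a s)"
| "expr_val (ETl a) s = tl_tree (expr_val a s)"

fun expr_cost :: "expr \<Rightarrow> store \<Rightarrow> nat" where
  "expr_cost (EVar x) s = tree_size (s x)"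
| "expr_cost ENil s = 1"
| "expr_cost (ECons a b) s = 1 + expr_cost a s + expr_cost b s"
| "expr_cost (EHd a) s = 1 + expr_cost a s"
| "expr_cost (ETl a) s = 1 + expr_cost a s"

lemma tree_size_le_expr_cost: "tree_size (expr_val e s) \<le> expr_cost e s"
proof (induction e)
  case (EHd e)
  then show ?case by (cases "expr_val e s") auto
next
  case (ETl e)
  then show ?case by (cases "expr_val e s") auto
qed auto

definition bool_tree :: "bool \<Rightarrow> tree" where
  "bool_tree b = (if b then Node Leaf Leaf else Leaf)"

text \<open>
  \<open>run ora P s t qs s'\<close>: with oracle \<open>ora\<close>, program \<open>P\<close> started in \<open>s\<close> halts in \<open>s'\<close> at cost \<open>t\<close>,
  after asking the oracle about the trees \<open>qs\<close>, in this order. An oracle call costs one step in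
  addition to the cost of computing the query.
\<close>

inductive run ::
  "(tree \<Rightarrow> bool) \<Rightarrow> prog \<Rightarrow> store \<Rightarrow> nat \<Rightarrow> tree list \<Rightarrow> store \<Rightarrow> bool"
  for ora :: "tree \<Rightarrow> bool" where
  run_Assign: "run ora (Assign x e) s (1 + expr_cost e s) [] (s(x := expr_val e s))"
| run_Ask: "run ora (Ask x e) s (1 + expr_cost e s) [expr_val e s]
     (s(x := bool_tree (ora (expr_val e s))))"
| run_Seq: "run ora P s t1 qs1 s1 \<Longrightarrow> run ora Q s1 t2 qs2 s2 \<Longrightarrow>
     run ora (Seq P Q) s (t1 + t2) (qs1 @ qs2) s2"
| run_Cond_true: "expr_val e s \<noteq> Leaf \<Longrightarrow> run ora P s t qs s1 \<Longrightarrow>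
     run ora (Cond e P Q) s (1 + expr_cost e s + t) qs s1"
| run_Cond_false: "expr_val e s = Leaf \<Longrightarrow> run ora Q s t qs s1 \<Longrightarrow>
     run ora (Cond e P Q) s (1 + expr_cost e s + t) qs s1"
| run_While_true: "expr_val e s \<noteq> Leaf \<Longrightarrow> run ora P s t1 qs1 s1 \<Longrightarrow>
     run ora (While e P) s1 t2 qs2 s2 \<Longrightarrow>
     run ora (While e P) s (1 + expr_cost e s + t1 + t2) (qs1 @ qs2) s2"
| run_While_false: "expr_val e s = Leaf \<Longrightarrow>
     run ora (While e P) s (1 + expr_cost e s) [] s"

inductive_cases run_AssignE: "run ora (Assign x e) s t qs s'"
inductive_cases run_AskE: "run ora (Ask x e) s t qs s'"
inductive_cases run_SeqE: "run ora (Seq P Q) s t qs s'"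
inductive_cases run_CondE: "run ora (Cond e P Q) s t qs s'"
inductive_cases run_WhileE: "run ora (While e P) s t qs s'"

lemma run_deterministic:
  assumes "run ora P s t qs s'" and "run ora P s u rs s''"
  shows "t = u \<and> qs = rs \<and> s' = s''"
  using assms
proof (induction arbitrary: u rs s'' rule: run.induct)
  case (run_Assign x e s)
  then show ?case by (rule run_AssignE) simp
next
  case (run_Ask x e s)
  then show ?case by (rule run_AskE) simp
next
  case (run_Seq P s t1 qs1 s1 Q t2 qs2 s2)
  from run_Seq.prems show ?case
  proof (rule run_SeqE)
    fix t1' qs1' s1' t2' qs2'
    assume *: "u = t1' + t2'" "rs = qs1' @ qs2'"
      and P: "run ora P s t1' qs1' s1'" and Q: "run ora Q s1' t2' qs2' s''"
    from run_Seq.IH(1)[OF P] have 1: "t1 = t1'" "qs1 = qs1'" "s1 = s1'" by simp_all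
    from run_Seq.IH(2)[OF Q[folded 1(3)]] 1 * show ?thesis by simp
  qed
next
  case (run_Cond_true e s P t qs s1 Q)
  from run_Cond_true.prems show ?case
  proof (rule run_CondE)
    fix t'
    assume *: "u = Suc (expr_cost e s + t')" and P: "run ora P s t' rs s''"
    from run_Cond_true.IH[OF P] * show ?thesis by simp
  next
    assume "expr_val e s = Leaf"
    with run_Cond_true.hyps(1) show ?thesis by contradiction
  qed
next
  case (run_Cond_false e s Q t qs s1 P)
  from run_Cond_false.prems show ?case
  proof (rule run_CondE)
    assume "expr_val e s \<noteq> Leaf"
    from this run_Cond_false.hyps(1) show ?thesis by contradiction
  next
    fix t'
    assume *: "u = Suc (expr_cost e s + t')" and Q: "run ora Q s t' rs s''"
    from run_Cond_false.IH[OF Q] * show ?thesis by simp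
  qed
next
  case (run_While_true e s P t1 qs1 s1 t2 qs2 s2)
  from run_While_true.prems show ?case
  proof (rule run_WhileE)
    fix t1' qs1' s1' t2' qs2'
    assume *: "u = Suc (expr_cost e s + t1' + t2')" "rs = qs1' @ qs2'"
      and P: "run ora P s t1' qs1' s1'" and Q: "run ora (While e P) s1' t2' qs2' s''"
    from run_While_true.IH(1)[OF P] have 1: "t1 = t1'" "qs1 = qs1'" "s1 = s1'" by simp_all
    from run_While_true.IH(2)[OF Q[folded 1(3)]] 1 * show ?thesis by simp
  next
    assume "expr_val e s = Leaf"
    with run_While_true.hyps(1) show ?thesis by contradiction
  qed
next
  case (run_While_false e s P)
  from run_While_false.prems show ?case
  proof (rule run_WhileE)
    assume "expr_val e s \<noteq> Leaf"
    from this run_While_false.hyps show ?thesis by contradiction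
  qed simp
qed

text \<open>Variable \<open>0\<close> holds the input before and the output after a run.\<close>

definition initial_store :: "tree \<Rightarrow> store" where
  "initial_store x = (\<lambda>_. Leaf)(0 := x)"


section \<open>Encodings and the LCE oracle\<close>

text \<open>Natural numbers are written in binary, least significant bit first.\<close>

fun nat_tree :: "nat \<Rightarrow> tree" where
  "nat_tree 0 = Leaf"
| "nat_tree (Suc n) = Node (bool_tree (odd (Suc n))) (nat_tree (Suc n div 2))"

fun list_tree :: "tree list \<Rightarrow> tree" where
  "list_tree [] = Leaf"
| "list_tree (x # xs) = Node x (list_tree xs)"

definition mat_tree :: "nat mat \<Rightarrow> tree" where
  "mat_tree G = list_tree (map (\<lambda>r. list_tree (map nat_tree r)) (mat_to_list G))"

definition instance_tree :: "nat \<Rightarrow> nat mat \<Rightarrow> nat mat \<Rightarrow> tree" where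
  "instance_tree q G1 G2 = list_tree [nat_tree q, mat_tree G1, mat_tree G2]"

definition perm_tree :: "nat \<Rightarrow> (nat \<Rightarrow> nat) \<Rightarrow> tree" where
  "perm_tree n \<pi> = list_tree (map (\<lambda>i. nat_tree (\<pi> i)) [0..<n])"

text \<open>
  An LCE oracle must be right on all pairs of codes of equal length and dimension, also of different
  minimum distance (where the answer is no); on trees that encode no such pair it may answer
  anything.
\<close>

definition LCE_oracle :: "nat \<Rightarrow> nat ring \<Rightarrow> (tree \<Rightarrow> bool) \<Rightarrow> bool" where
  "LCE_oracle q F ora \<longleftrightarrow>
     (\<forall>n k G1 G2 C1 C2.
        linear_code F n k C1 \<and> generator_matrix F n k G1 C1 \<and>
        linear_code F n k C2 \<and> generator_matrix F n k G2 C2 \<longrightarrow>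
        (ora (instance_tree q G1 G2) \<longleftrightarrow> linearly_equivalent F n C1 C2))"

definition LCE_query :: "nat \<Rightarrow> nat ring \<Rightarrow> nat \<Rightarrow> nat \<Rightarrow> tree \<Rightarrow> bool" where
  "LCE_query q F n k x \<longleftrightarrow>
     (\<exists>G1 G2 C1 C2.
        linear_code F n k C1 \<and> generator_matrix F n k G1 C1 \<and>
        linear_code F n k C2 \<and> generator_matrix F n k G2 C2 \<and>
        x = instance_tree q G1 G2)"

end

theory Submission
  imports Defs
begin

text \<open>
  Call two coordinates of a code proportional if one is a nonzero multiple of the other on all
  codewords. If the columns of two equivalent codes are repeated, the resulting codes are equivalent
  iff some equivalence of the original codes maps proportionality classes to classes of the same
  total multiplicity. The permutation is built coordinate by coordinate. To find the image of
  coordinate \<open>i\<close> (counted from \<open>0\<close>), column \<open>i\<close> of the first matrix and a candidate column \<open>j\<close> of the second get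
  \<open>(n - 1) * (i + 1)\<close> additional copies, on top of the copies made earlier, and the resulting pair is
  submitted to the oracle. Unless there is only one class, class sizes are at most \<open>n - 1\<close>, so that a
  multiplicity determines the size of the class and the sum of the labels \<open>t + 1\<close> in it. Two labels
  in one class could be confused with others; therefore only one coordinate of each class keeps its
  label. Whether \<open>i\<close> lies in a labelled class is seen from the answers for the images of the labelled
  coordinates: such a candidate is accepted iff its preimage is proportional to \<open>i\<close>. Hence
  at most \<open>n\<close> queries are made for each coordinate.
\<close>

section \<open>Polynomial-time oracle programs\<close>

text \<open>A positive answer only says that some equivalence fits the query; it need not be the one
  behind the earlier answers. So the labels must pin down the images chosen so far in every
  equivalence that passes. This works because the label \<open>i + 1\<close> exceeds every earlier
  label: a class that contains no more than one earlier label cannot imitate the new one, so the new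
  label is located first, cancels, and leaves the earlier labels readable. Hence the equivalence
  behind the latest answer respects all images and can replace its predecessor in the invariant.
  Keeping all \<open>n\<close> labels would give length
  \<open>n + (n - 1) * n * (n + 1) / 2\<close>, which is at most \<open>n^2 * (n + 1) / 2\<close>.
  The running time concerns one concrete program. It is obtained from a class of functions with
  query lists that is closed under composition, pairing, case distinction and folding over lists.
  Folding is the delicate operation, since the accumulator has to stay polynomially large.
  Multiplicities are kept in unary, so that repeating a column is a fold as well.\<close>

lemma poly_nat_mono: "x \<le> y \<Longrightarrow> poly p x \<le> poly p (y :: nat)"
  by (induction p) (auto intro: add_mono mult_mono)

lemma tree_size_pos [simp]: "0 < tree_size x" "Suc 0 \<le> tree_size x"
  by (cases x; simp)+

text \<open>Only written variables count. Reading is harmless: a program that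
  \<open>computes\<close> a function is correct whatever its other variables hold. So variables from
  \<open>fresh P\<close> on can save data across a run of \<open>P\<close>.\<close>

fun fresh :: "prog \<Rightarrow> nat" where
  "fresh (Assign x e) = Suc x"
| "fresh (Ask x e) = Suc x"
| "fresh (Seq P Q) = max (fresh P) (fresh Q)"
| "fresh (Cond e P Q) = max (fresh P) (fresh Q)"
| "fresh (While e P) = fresh P"

lemma run_frame: "run ora P s t qs s' \<Longrightarrow> fresh P \<le> v \<Longrightarrow> s' v = s v"
  by (induction rule: run.induct) auto

text \<open>Every assignment pays for the size of the value that it stores. Thus a polynomial time
  bound is also a bound on the output, which composition relies on.\<close>

lemma run_tree_size: "run ora P s t qs s' \<Longrightarrow> tree_size (s' v) \<le> tree_size (s v) + t"
proof (induction rule: run.induct)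
  case (run_Assign x e s)
  then show ?case using tree_size_le_expr_cost[of e s] by auto
next
  case (run_Ask x e s)
  \<comment> \<open>The answer has size at most \<open>3\<close>; the cost of the call is at least
    \<open>2\<close> and the overwritten value has size at least \<open>1\<close>.\<close>
  have "0 < expr_cost e s"
    using tree_size_le_expr_cost[of e s] tree_size_pos(1)[of "expr_val e s"] by linarith
  moreover have "0 < tree_size (s x)" by simp
  ultimately show ?case by (auto simp: bool_tree_def simp del: tree_size_pos)
qed auto

text \<open>Only variable \<open>0\<close> of the initial store is constrained, so a program can be run while its work
  variables still hold old values. The second component of a computation is its list of queries.\<close>

definition computes ::
  "('a \<Rightarrow> tree) \<Rightarrow> ('b \<Rightarrow> tree) \<Rightarrow> ((tree \<Rightarrow> bool) \<Rightarrow> 'a \<Rightarrow> 'b) \<Rightarrow>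
    ((tree \<Rightarrow> bool) \<Rightarrow> 'a \<Rightarrow> tree list) \<Rightarrow> bool" where
  "computes ea eb f q \<longleftrightarrow> (\<exists>P p. \<forall>ora x s. s 0 = ea x \<longrightarrow>
     (\<exists>t s'. run ora P s t (q ora x) s' \<and> s' 0 = eb (f ora x) \<and> t \<le> poly p (tree_size (ea x))))"

abbreviation ptime :: "('a \<Rightarrow> tree) \<Rightarrow> ('b \<Rightarrow> tree) \<Rightarrow> ('a \<Rightarrow> 'b) \<Rightarrow> bool" where
  "ptime ea eb f \<equiv> computes ea eb (\<lambda>_. f) (\<lambda>_ _. [])"

lemma computesE:
  assumes "computes ea eb f q"
  obtains P p where "0 < fresh P"
    "\<And>ora x (s :: store). s 0 = ea x \<Longrightarrow> \<exists>t s'. run ora P s t (q ora x) s' \<and> s' 0 = eb (f ora x) \<and>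
       t \<le> poly p (tree_size (ea x)) \<and> (\<forall>v\<ge>fresh P. s' v = s v)"
    "\<And>ora x. tree_size (eb (f ora x)) \<le> poly p (tree_size (ea x))"
proof -
  from assms obtain P p where *: "\<And>ora x (s :: store). s 0 = ea x \<Longrightarrow>
      \<exists>t s'. run ora P s t (q ora x) s' \<and> s' 0 = eb (f ora x) \<and> t \<le> poly p (tree_size (ea x))"
    unfolding computes_def by blast
  have "0 < fresh P'" for P' by (induction P') auto
  then show thesis
  \<comment> \<open>The summand \<open>[:0, 1:]\<close> accounts for the input in variable
    \<open>0\<close>: the output is no larger than the input plus the running time.\<close>
  proof (rule that[of P "p + [:0, 1:]"])
    fix ora x and s :: store assume "s 0 = ea x"
    from *[of s x ora, OF this] obtain t s' where r: "run ora P s t (q ora x) s'"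
      and "s' 0 = eb (f ora x)" "t \<le> poly p (tree_size (ea x))" by blast
    then show "\<exists>t s'. run ora P s t (q ora x) s' \<and> s' 0 = eb (f ora x) \<and>
       t \<le> poly (p + [:0, 1:]) (tree_size (ea x)) \<and> (\<forall>v\<ge>fresh P. s' v = s v)"
      using run_frame[OF r] by (intro exI[of _ t] exI[of _ s']) auto
  next
    fix ora x
    from *[of "\<lambda>_. ea x" x ora] obtain t s' where r: "run ora P (\<lambda>_. ea x) t (q ora x) s'"
      and "s' 0 = eb (f ora x)" "t \<le> poly p (tree_size (ea x))" by auto
    then show "tree_size (eb (f ora x)) \<le> poly (p + [:0, 1:]) (tree_size (ea x))"
      using run_tree_size[OF r, of 0] by simp
  qed
qed

lemma run_AssignI: "t = 1 + expr_cost e s \<Longrightarrow> s' = s(x := expr_val e s) \<Longrightarrow> run ora (Assign x e) s t [] s'"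
  by (simp add: run_Assign[simplified])

lemma ptime_recode:
  assumes "\<And>x. eb (f x) = ea x"
  shows "ptime ea eb f"
  unfolding computes_def
  by (rule exI[of _ "Assign 0 (EVar 0)"], rule exI[of _ "[:1, 1:]"])
    (use assms in \<open>auto intro!: exI run_AssignI\<close>)

lemma ptime_hd_tree:
  assumes "\<And>x. eb (f x) = hd_tree (ea x)"
  shows "ptime ea eb f"
  unfolding computes_def
  by (rule exI[of _ "Assign 0 (EHd (EVar 0))"], rule exI[of _ "[:2, 1:]"])
    (use assms in \<open>auto intro!: exI run_AssignI\<close>)

lemma ptime_tl_tree:
  assumes "\<And>x. eb (f x) = tl_tree (ea x)"
  shows "ptime ea eb f"
  unfolding computes_def
  by (rule exI[of _ "Assign 0 (ETl (EVar 0))"], rule exI[of _ "[:2, 1:]"])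
    (use assms in \<open>auto intro!: exI run_AssignI\<close>)

fun tree_expr :: "tree \<Rightarrow> expr" where
  "tree_expr Leaf = ENil"
| "tree_expr (Node a b) = ECons (tree_expr a) (tree_expr b)"

lemma tree_expr: "expr_val (tree_expr a) s = a" "expr_cost (tree_expr a) s = tree_size a"
  by (induction a) auto

lemma ptime_const: "ptime ea eb (\<lambda>_. y)"
  unfolding computes_def
  by (rule exI[of _ "Assign 0 (tree_expr (eb y))"], rule exI[of _ "[:1 + tree_size (eb y):]"])
    (auto intro!: exI run_AssignI simp: tree_expr)

lemma computes_ask: "computes ea bool_tree (\<lambda>ora x. ora (ea x)) (\<lambda>ora x. [ea x])"
  unfolding computes_def
proof (intro exI allI impI conjI)
  fix ora x and s :: store assume "s 0 = ea x"
  then show "run ora (Ask 0 (EVar 0)) s (1 + tree_size (ea x)) [ea x] (s(0 := bool_tree (ora (ea x))))"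
    using run_Ask[of ora 0 "EVar 0" s] by simp
  show "1 + tree_size (ea x) \<le> poly [:1, 1:] (tree_size (ea x))" by simp
qed simp

lemma computes_comp:
  assumes "computes ea eb f qf" "computes eb ec g qg"
  shows "computes ea ec (\<lambda>ora x. g ora (f ora x)) (\<lambda>ora x. qf ora x @ qg ora (f ora x))"
proof -
  obtain P p where P: "\<And>ora x (s :: store). s 0 = ea x \<Longrightarrow> \<exists>t s'. run ora P s t (qf ora x) s' \<and> s' 0 = eb (f ora x) \<and>
       t \<le> poly p (tree_size (ea x)) \<and> (\<forall>v\<ge>fresh P. s' v = s v)"
    "\<And>ora x. tree_size (eb (f ora x)) \<le> poly p (tree_size (ea x))" 
    using assms(1) by (rule computesE) blast
  obtain Q r where Q: "\<And>ora x (s :: store). s 0 = eb x \<Longrightarrow> \<exists>t s'. run ora Q s t (qg ora x) s' \<and> s' 0 = ec (g ora x) \<and>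
       t \<le> poly r (tree_size (eb x)) \<and> (\<forall>v\<ge>fresh Q. s' v = s v)"
    using assms(2) by (rule computesE) blast
  show ?thesis unfolding computes_def
  proof (rule exI[of _ "Seq P Q"], rule exI[of _ "p + pcompose r p"], intro allI impI)
    fix ora x and s :: store assume "s 0 = ea x"
    from P(1)[of s x ora, OF this] obtain t1 s1 where 1: "run ora P s t1 (qf ora x) s1"
      "s1 0 = eb (f ora x)" "t1 \<le> poly p (tree_size (ea x))" by blast
    from Q[of s1 "f ora x" ora, OF this(2)] obtain t2 s2 where 2: "run ora Q s1 t2 (qg ora (f ora x)) s2"
      "s2 0 = ec (g ora (f ora x))" "t2 \<le> poly r (tree_size (eb (f ora x)))" by blast
    have "t2 \<le> poly r (poly p (tree_size (ea x)))"
      using 2(3) poly_nat_mono[OF P(2)] by (rule order_trans)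
    with 1 2 show "\<exists>t s'. run ora (Seq P Q) s t (qf ora x @ qg ora (f ora x)) s' \<and>
        s' 0 = ec (g ora (f ora x)) \<and> t \<le> poly (p + pcompose r p) (tree_size (ea x))"
      by (intro exI[of _ "t1 + t2"] exI[of _ s2]) (auto simp: poly_pcompose intro: run_Seq)
  qed
qed

text \<open>The encoding \<open>ed\<close> is arbitrary as long as it yields this node, so that
  pairs (\<open>computes_pair\<close>) and nonempty lists (\<open>ptime_Cons\<close>) are both
  instances.\<close>

lemma computes_Node:
  assumes f: "computes ea eb f qf" and g: "computes ea ec g qg"
    and h: "\<And>ora x. ed (h ora x) = Node (eb (f ora x)) (ec (g ora x))"
  shows "computes ea ed h (\<lambda>ora x. qf ora x @ qg ora x)"
proof -
  obtain P p where P: "0 < fresh P" "\<And>ora x (s :: store). s 0 = ea x \<Longrightarrow> \<exists>t s'. run ora P s t (qf ora x) s' \<and> s' 0 = eb (f ora x) \<and>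
       t \<le> poly p (tree_size (ea x)) \<and> (\<forall>v\<ge>fresh P. s' v = s v)"
    "\<And>ora x. tree_size (eb (f ora x)) \<le> poly p (tree_size (ea x))"
    using f by (rule computesE) blast
  obtain Q r where Q: "0 < fresh Q" "\<And>ora x (s :: store). s 0 = ea x \<Longrightarrow> \<exists>t s'. run ora Q s t (qg ora x) s' \<and> s' 0 = ec (g ora x) \<and>
       t \<le> poly r (tree_size (ea x)) \<and> (\<forall>v\<ge>fresh Q. s' v = s v)"
    "\<And>ora x. tree_size (ec (g ora x)) \<le> poly r (tree_size (ea x))"
    using g by (rule computesE) blast
  \<comment> \<open>Variable \<open>N\<close> keeps the input for the second program and
    \<open>Suc N\<close> the result of the first; neither program writes to the variable while it is
    in use.\<close>
  define N where "N = max (fresh P) (fresh Q)"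
  have N: "fresh P \<le> N" "fresh Q \<le> N" "N > 0" using P(1) by (auto simp: N_def)
  define R where "R = Seq (Assign N (EVar 0)) (Seq P (Seq (Assign (Suc N) (EVar 0))
    (Seq (Assign 0 (EVar N)) (Seq Q (Assign 0 (ECons (EVar (Suc N)) (EVar 0)))))))"
  show ?thesis unfolding computes_def
  proof (rule exI[of _ R], rule exI[of _ "p + p + p + r + r + [:10, 2:]"], intro allI impI)
    fix ora x and s :: store assume s: "s 0 = ea x"
    let ?n = "tree_size (ea x)"
    let ?s1 = "s(N := ea x)"
    have "?s1 0 = ea x" using s N by simp
    from P(2)[of ?s1 x ora, OF this] obtain t1 s1 where 1: "run ora P ?s1 t1 (qf ora x) s1"
      "s1 0 = eb (f ora x)" "t1 \<le> poly p ?n" "\<And>v. v \<ge> fresh P \<Longrightarrow> s1 v = ?s1 v" by blast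
    let ?s2 = "s1(Suc N := eb (f ora x), 0 := ea x)"
    have "?s2 0 = ea x" by simp
    from Q(2)[of ?s2 x ora, OF this] obtain t2 s2 where 2: "run ora Q ?s2 t2 (qg ora x) s2"
      "s2 0 = ec (g ora x)" "t2 \<le> poly r ?n" "\<And>v. v \<ge> fresh Q \<Longrightarrow> s2 v = ?s2 v" by blast
    have N1: "s1 N = ea x" using 1(4)[of N] N by simp
    have N2: "s2 (Suc N) = eb (f ora x)" using 2(4)[of "Suc N"] N by simp
    let ?s3 = "s2(0 := ed (h ora x))"
    let ?t = "(1 + ?n) + (t1 + ((1 + tree_size (eb (f ora x))) + ((1 + ?n) + (t2 +
      (2 + tree_size (eb (f ora x)) + tree_size (ec (g ora x)))))))"
    have 3: "run ora (Assign N (EVar 0)) s (1 + ?n) [] ?s1"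
      by (rule run_AssignI) (simp_all add: s)
    have 4: "run ora (Assign (Suc N) (EVar 0)) s1 (1 + tree_size (eb (f ora x))) [] (s1(Suc N := eb (f ora x)))"
      by (rule run_AssignI) (simp_all add: 1(2))
    have 5: "run ora (Assign 0 (EVar N)) (s1(Suc N := eb (f ora x))) (1 + ?n) [] ?s2"
      by (rule run_AssignI) (simp_all add: N1)
    have 6: "run ora (Assign 0 (ECons (EVar (Suc N)) (EVar 0))) s2
        (2 + tree_size (eb (f ora x)) + tree_size (ec (g ora x))) [] ?s3"
      by (rule run_AssignI) (simp_all add: N2 2(2) h)
    have "run ora R s ?t ([] @ (qf ora x @ ([] @ ([] @ (qg ora x @ []))))) ?s3"
      unfolding R_def by (rule run_Seq 1(1) 2(1) 3 4 5 6)+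
    then have "run ora R s ?t (qf ora x @ qg ora x) ?s3" by simp
    moreover have "?t \<le> poly (p + p + p + r + r + [:10, 2:]) ?n"
      using 1(3) 2(3) P(3)[of ora x] Q(3)[of ora x] by simp
    ultimately show "\<exists>t s'. run ora R s t (qf ora x @ qg ora x) s' \<and> s' 0 = ed (h ora x) \<and>
        t \<le> poly (p + p + p + r + r + [:10, 2:]) ?n" by (metis fun_upd_same)
  qed
qed

lemma computes_Cond:
  assumes c: "computes ea bool_tree c qc" and f: "computes ea eb f qf" and g: "computes ea eb g qg"
  shows "computes ea eb (\<lambda>ora x. if c ora x then f ora x else g ora x)
    (\<lambda>ora x. qc ora x @ (if c ora x then qf ora x else qg ora x))"
proof -
  obtain B b where B: "0 < fresh B" "\<And>ora x (s :: store). s 0 = ea x \<Longrightarrow> \<exists>t s'. run ora B s t (qc ora x) s' \<and> s' 0 = bool_tree (c ora x) \<and>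
       t \<le> poly b (tree_size (ea x)) \<and> (\<forall>v\<ge>fresh B. s' v = s v)"
    using c by (rule computesE) blast
  obtain P p where P: "\<And>ora x (s :: store). s 0 = ea x \<Longrightarrow> \<exists>t s'. run ora P s t (qf ora x) s' \<and> s' 0 = eb (f ora x) \<and>
       t \<le> poly p (tree_size (ea x)) \<and> (\<forall>v\<ge>fresh P. s' v = s v)"
    using f by (rule computesE) blast
  obtain Q r where Q: "\<And>ora x (s :: store). s 0 = ea x \<Longrightarrow> \<exists>t s'. run ora Q s t (qg ora x) s' \<and> s' 0 = eb (g ora x) \<and>
       t \<le> poly r (tree_size (ea x)) \<and> (\<forall>v\<ge>fresh Q. s' v = s v)"
    using g by (rule computesE) blast
  define N where "N = fresh B"
  define R where "R = Seq (Assign N (EVar 0)) (Seq B (Cond (EVar 0)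
    (Seq (Assign 0 (EVar N)) P) (Seq (Assign 0 (EVar N)) Q)))"
  show ?thesis unfolding computes_def
  proof (rule exI[of _ R], rule exI[of _ "b + p + r + [:6, 2:]"], intro allI impI)
    fix ora x and s :: store assume s: "s 0 = ea x"
    let ?n = "tree_size (ea x)" and ?b = "bool_tree (c ora x)"
    let ?s1 = "s(N := ea x)"
    have "?s1 0 = ea x" using s B(1) by (simp add: N_def)
    from B(2)[of ?s1 x ora, OF this] obtain t1 s1 where 1: "run ora B ?s1 t1 (qc ora x) s1"
      "s1 0 = ?b" "t1 \<le> poly b ?n" "\<And>v. v \<ge> fresh B \<Longrightarrow> s1 v = ?s1 v" by blast
    have N1: "s1 N = ea x" using 1(4)[of N] by (simp add: N_def)
    let ?s2 = "s1(0 := ea x)"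
    have s2: "?s2 0 = ea x" by simp
    have 2: "run ora (Assign N (EVar 0)) s (1 + ?n) [] ?s1"
      by (rule run_AssignI) (simp_all add: s)
    have 3: "run ora (Assign 0 (EVar N)) s1 (1 + ?n) [] ?s2"
      by (rule run_AssignI) (simp_all add: N1)
    have b: "tree_size ?b \<le> 3" by (simp add: bool_tree_def)
    obtain t2 q2 s3 where 4: "run ora (Cond (EVar 0) (Seq (Assign 0 (EVar N)) P) (Seq (Assign 0 (EVar N)) Q))
        s1 t2 q2 s3" "s3 0 = eb (if c ora x then f ora x else g ora x)"
        "q2 = (if c ora x then qf ora x else qg ora x)"
        "t2 \<le> 5 + ?n + poly p ?n + poly r ?n"
    proof (cases "c ora x")
      case True
      from P[of ?s2 x ora, OF s2] obtain t3 s3 where 5: "run ora P ?s2 t3 (qf ora x) s3"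
        "s3 0 = eb (f ora x)" "t3 \<le> poly p ?n" by blast
      from run_Seq[OF 3 5(1)] have "run ora (Seq (Assign 0 (EVar N)) P) s1 (1 + ?n + t3) (qf ora x) s3" by simp
      from run_Cond_true[OF _ this, of "EVar 0"] show ?thesis
        using that[of "1 + tree_size ?b + (1 + ?n + t3)" "qf ora x" s3] True 5 1(2) b
        by (auto simp: bool_tree_def)
    next
      case False
      from Q[of ?s2 x ora, OF s2] obtain t3 s3 where 5: "run ora Q ?s2 t3 (qg ora x) s3"
        "s3 0 = eb (g ora x)" "t3 \<le> poly r ?n" by blast
      from run_Seq[OF 3 5(1)] have "run ora (Seq (Assign 0 (EVar N)) Q) s1 (1 + ?n + t3) (qg ora x) s3" by simp
      from run_Cond_false[OF _ this, of "EVar 0"] show ?thesis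
        using that[of "1 + tree_size ?b + (1 + ?n + t3)" "qg ora x" s3] False 5 1(2) b
        by (auto simp: bool_tree_def)
    qed
    have "run ora R s ((1 + ?n) + (t1 + t2)) ([] @ (qc ora x @ q2)) s3"
      unfolding R_def by (rule run_Seq 1(1) 2 4(1))+
    moreover have "(1 + ?n) + (t1 + t2) \<le> poly (b + p + r + [:6, 2:]) ?n"
      using 1(3) 4(4) by simp
    ultimately show "\<exists>t s'. run ora R s t (qc ora x @ (if c ora x then qf ora x else qg ora x)) s' \<and>
        s' 0 = eb (if c ora x then f ora x else g ora x) \<and> t \<le> poly (b + p + r + [:6, 2:]) ?n"
      unfolding 4(3)[symmetric] append_Nil using 4(2) by blast
  qed
qed

section \<open>Loops over lists\<close>

definition pair_tree :: "('a \<Rightarrow> tree) \<Rightarrow> ('b \<Rightarrow> tree) \<Rightarrow> 'a \<times> 'b \<Rightarrow> tree" where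
  "pair_tree ea eb = (\<lambda>(a, b). Node (ea a) (eb b))"

definition seq_tree :: "('a \<Rightarrow> tree) \<Rightarrow> 'a list \<Rightarrow> tree" where
  "seq_tree e xs = list_tree (map e xs)"

lemma pair_tree_simp [simp]: "pair_tree ea eb (a, b) = Node (ea a) (eb b)"
  by (simp add: pair_tree_def)

lemma seq_tree_simps [simp]:
  "seq_tree e [] = Leaf" "seq_tree e (x # xs) = Node (e x) (seq_tree e xs)"
  by (simp_all add: seq_tree_def)

lemma tree_size_seq_tree: "tree_size (seq_tree e xs) = 1 + (\<Sum>x\<leftarrow>xs. 1 + tree_size (e x))"
  by (induction xs) auto

lemma length_le_tree_size: "length xs \<le> tree_size (seq_tree e xs)"
  by (induction xs) auto

lemma tree_size_seq_tree_mem: "x \<in> set xs \<Longrightarrow> tree_size (e x) \<le> tree_size (seq_tree e xs)"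
  by (induction xs) auto

fun fold_queries :: "('s \<Rightarrow> 'a \<Rightarrow> 's) \<Rightarrow> ('s \<Rightarrow> 'a \<Rightarrow> 'q list) \<Rightarrow> 's \<Rightarrow> 'a list \<Rightarrow> 'q list" where
  "fold_queries f q s [] = []"
| "fold_queries f q s (a # l) = q s a @ fold_queries f q (f s a) l"

lemma fold_queries_Nil [simp]: "fold_queries f (\<lambda>_ _. []) s l = []"
  by (induction l arbitrary: s) auto

text \<open>Variable \<open>0\<close> holds the accumulator, \<open>N\<close> the context and
  \<open>Suc N\<close> the rest of the list. If \<open>S\<close> bounds their sizes, the argument of
  \<open>P\<close> has size at most \<open>3 * S + 2\<close>, and the guard and the two assignments
  of one round cost at most \<open>5 * S + 7\<close>.\<close>

lemma fold_loop:
  fixes c :: 'c and f :: "'c \<times> 's \<times> 'a \<Rightarrow> 's"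
  assumes P: "\<And>x (s :: store). s 0 = pair_tree ec (pair_tree es ea) x \<Longrightarrow>
      \<exists>t s'. run ora P s t (q x) s' \<and> s' 0 = es (f x) \<and>
        t \<le> poly p (tree_size (pair_tree ec (pair_tree es ea) x)) \<and> (\<forall>v\<ge>fresh P. s' v = s v)"
    and N: "0 < N" "fresh P \<le> N"
    and body: "body = Seq (Assign 0 (ECons (EVar N) (ECons (EVar 0) (EHd (EVar (Suc N))))))
      (Seq P (Assign (Suc N) (ETl (EVar (Suc N)))))"
  defines "g \<equiv> \<lambda>s a. f (c, s, a)"
  assumes S: "tree_size (ec c) \<le> S"
  shows "s 0 = es st \<Longrightarrow> s N = ec c \<Longrightarrow> s (Suc N) = seq_tree ea l \<Longrightarrow>
    tree_size (seq_tree ea l) \<le> S \<Longrightarrow>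
    (\<And>i. i \<le> length l \<Longrightarrow> tree_size (es (foldl g st (take i l))) \<le> S) \<Longrightarrow>
    \<exists>t s'. run ora (While (EVar (Suc N)) body) s t (fold_queries g (\<lambda>s a. q (c, s, a)) st l) s' \<and>
      s' 0 = es (foldl g st l) \<and> t \<le> (length l + 1) * (poly p (3 * S + 2) + 5 * S + 7)"
proof (induction l arbitrary: s st)
  case Nil
  have "run ora (While (EVar (Suc N)) body) s (1 + expr_cost (EVar (Suc N)) s) [] s"
    by (rule run_While_false) (simp add: Nil)
  then show ?case using Nil by (intro exI[of _ "Suc (Suc 0)"] exI[of _ s]) simp
next
  case (Cons a l)
  let ?K = "poly p (3 * S + 2) + 5 * S + 7"
  have st: "tree_size (es st) \<le> S" using Cons.prems(5)[of 0] by simp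
  have aS: "tree_size (ea a) \<le> S" "tree_size (seq_tree ea l) \<le> S" using Cons.prems(4) by auto
  let ?s1 = "s(0 := pair_tree ec (pair_tree es ea) (c, st, a))"
  have "?s1 0 = pair_tree ec (pair_tree es ea) (c, st, a)" by simp
  from P[of ?s1 "(c, st, a)", OF this] obtain t2 s2 where 2: "run ora P ?s1 t2 (q (c, st, a)) s2"
    "s2 0 = es (g st a)" "t2 \<le> poly p (tree_size (pair_tree ec (pair_tree es ea) (c, st, a)))"
    "\<And>v. v \<ge> fresh P \<Longrightarrow> s2 v = ?s1 v" unfolding g_def by blast
  have t2: "t2 \<le> poly p (3 * S + 2)"
    using 2(3) by (rule order_trans) (rule poly_nat_mono, use S st aS in simp)
  have N2: "s2 N = ec c" "s2 (Suc N) = seq_tree ea (a # l)"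
    using 2(4)[of N] 2(4)[of "Suc N"] N Cons.prems by auto
  let ?s3 = "s2(Suc N := seq_tree ea l)"
  have "\<exists>t s'. run ora (While (EVar (Suc N)) body) ?s3 t (fold_queries g (\<lambda>s a. q (c, s, a)) (g st a) l) s' \<and>
      s' 0 = es (foldl g (g st a) l) \<and> t \<le> (length l + 1) * ?K"
  proof (rule Cons.IH)
    show "tree_size (es (foldl g (g st a) (take i l))) \<le> S" if "i \<le> length l" for i
      using Cons.prems(5)[of "Suc i"] that by simp
  qed (use 2(2) N2 N aS in auto)
  then obtain t4 s4 where 4: "run ora (While (EVar (Suc N)) body) ?s3 t4 (fold_queries g (\<lambda>s a. q (c, s, a)) (g st a) l) s4"
    "s4 0 = es (foldl g (g st a) l)" "t4 \<le> (length l + 1) * ?K" by blast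
  let ?t1 = "1 + (3 + tree_size (ec c) + tree_size (es st) + tree_size (seq_tree ea (a # l)))"
  have 1: "run ora (Assign 0 (ECons (EVar N) (ECons (EVar 0) (EHd (EVar (Suc N)))))) s ?t1 [] ?s1"
    by (rule run_AssignI) (simp_all add: Cons.prems)
  let ?t3 = "2 + tree_size (seq_tree ea (a # l))"
  have 3: "run ora (Assign (Suc N) (ETl (EVar (Suc N)))) s2 ?t3 [] ?s3"
    by (rule run_AssignI) (simp_all add: N2)
  have "run ora body s (?t1 + (t2 + ?t3)) ([] @ (q (c, st, a) @ [])) ?s3"
    unfolding body by (rule run_Seq 1 2(1) 3)+
  then have 5: "run ora body s (?t1 + (t2 + ?t3)) (q (c, st, a)) ?s3" by simp
  have "run ora (While (EVar (Suc N)) body) s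
      (1 + expr_cost (EVar (Suc N)) s + (?t1 + (t2 + ?t3)) + t4)
      (q (c, st, a) @ fold_queries g (\<lambda>s a. q (c, s, a)) (g st a) l) s4"
    by (rule run_While_true[OF _ 5 4(1)]) (simp add: Cons.prems)
  moreover have "1 + expr_cost (EVar (Suc N)) s + (?t1 + (t2 + ?t3)) + t4 \<le> (length (a # l) + 1) * ?K"
  proof -
    have "1 + expr_cost (EVar (Suc N)) s + (?t1 + (t2 + ?t3)) \<le> ?K"
      using t2 S st Cons.prems(3,4) by simp
    then show ?thesis using 4(3) by simp
  qed
  ultimately show ?case
    unfolding fold_queries.simps foldl.simps using 4(2) by blast
qed

text \<open>A step in polynomial time may still double the accumulator, and iterating it would give
  exponential size. Therefore a polynomial bound on all intermediate accumulators is a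
  hypothesis.\<close>

lemma computes_fold:
  assumes f: "computes (pair_tree ec (pair_tree es ea)) es f q"
    and init: "ptime ex (pair_tree ec (pair_tree es (seq_tree ea))) (\<lambda>x. (gc x, gs x, gl x))"
    and bound: "\<And>ora x i. tree_size (es (foldl (\<lambda>s a. f ora (gc x, s, a)) (gs x) (take i (gl x))))
      \<le> poly b (tree_size (ex x))"
  shows "computes ex es (\<lambda>ora x. foldl (\<lambda>s a. f ora (gc x, s, a)) (gs x) (gl x))
    (\<lambda>ora x. fold_queries (\<lambda>s a. f ora (gc x, s, a)) (\<lambda>s a. q ora (gc x, s, a)) (gs x) (gl x))"
proof -
  obtain P p where P: "0 < fresh P" "\<And>ora x (s :: store). s 0 = pair_tree ec (pair_tree es ea) x \<Longrightarrow>
     \<exists>t s'. run ora P s t (q ora x) s' \<and> s' 0 = es (f ora x) \<and>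
       t \<le> poly p (tree_size (pair_tree ec (pair_tree es ea) x)) \<and> (\<forall>v\<ge>fresh P. s' v = s v)"
    using f by (rule computesE) blast
  obtain I r where I: "\<And>ora x (s :: store). s 0 = ex x \<Longrightarrow>
     \<exists>t s'. run ora I s t [] s' \<and> s' 0 = pair_tree ec (pair_tree es (seq_tree ea)) (gc x, gs x, gl x) \<and>
       t \<le> poly r (tree_size (ex x)) \<and> (\<forall>v\<ge>fresh I. s' v = s v)"
     "\<And>x. tree_size (pair_tree ec (pair_tree es (seq_tree ea)) (gc x, gs x, gl x)) \<le> poly r (tree_size (ex x))"
    using init by (rule computesE) blast
  define N where "N = fresh P"
  have N: "0 < N" "fresh P \<le> N" using P(1) by (auto simp: N_def)
  define body where "body = Seq (Assign 0 (ECons (EVar N) (ECons (EVar 0) (EHd (EVar (Suc N))))))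
      (Seq P (Assign (Suc N) (ETl (EVar (Suc N)))))"
  define R where "R = Seq I (Seq (Assign N (EHd (EVar 0))) (Seq (Assign (Suc N) (ETl (ETl (EVar 0))))
    (Seq (Assign 0 (EHd (ETl (EVar 0)))) (While (EVar (Suc N)) body))))"
  \<comment> \<open>Here \<open>r + b\<close> plays the role of \<open>S\<close> in
    \<open>fold_loop\<close>: \<open>r\<close> bounds the context and the list, hence also the
    number of rounds, and \<open>b\<close> the accumulators. The first summands pay for the
    preparation.\<close>
  define cost where "cost = 4 * r + [:9:] + (r + [:1:]) * (pcompose p (3 * (r + b) + [:2:]) + 5 * (r + b) + [:7:])"
  show ?thesis unfolding computes_def
  proof (rule exI[of _ R], rule exI[of _ cost], intro allI impI)
    fix ora x and s :: store assume s: "s 0 = ex x"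
    let ?n = "tree_size (ex x)" and ?g = "\<lambda>s a. f ora (gc x, s, a)"
    let ?i = "Node (ec (gc x)) (Node (es (gs x)) (seq_tree ea (gl x)))"
    define S where "S = poly r ?n + poly b ?n"
    have i: "tree_size ?i \<le> poly r ?n" using I(2)[of x] by simp
    from I(1)[of s x ora, OF s] obtain t1 s1 where 1: "run ora I s t1 [] s1"
      "s1 0 = ?i" "t1 \<le> poly r ?n" by auto
    have 2: "run ora (Assign N (EHd (EVar 0))) s1 (2 + tree_size ?i) [] (s1(N := ec (gc x)))"
      by (rule run_AssignI) (simp_all add: 1(2))
    have 3: "run ora (Assign (Suc N) (ETl (ETl (EVar 0)))) (s1(N := ec (gc x))) (3 + tree_size ?i) []
        (s1(N := ec (gc x), Suc N := seq_tree ea (gl x)))"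
      by (rule run_AssignI) (use N in \<open>simp_all add: 1(2)\<close>)
    let ?s4 = "s1(N := ec (gc x), Suc N := seq_tree ea (gl x), 0 := es (gs x))"
    have 4: "run ora (Assign 0 (EHd (ETl (EVar 0)))) (s1(N := ec (gc x), Suc N := seq_tree ea (gl x)))
        (3 + tree_size ?i) [] ?s4"
      by (rule run_AssignI) (use N in \<open>simp_all add: 1(2)\<close>)
    have "\<exists>t s'. run ora (While (EVar (Suc N)) body) ?s4 t
        (fold_queries ?g (\<lambda>s a. q ora (gc x, s, a)) (gs x) (gl x)) s' \<and>
        s' 0 = es (foldl ?g (gs x) (gl x)) \<and>
        t \<le> (length (gl x) + 1) * (poly p (3 * S + 2) + 5 * S + 7)"
    proof (rule fold_loop[where f = "f ora", OF P(2) N body_def])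
      show "tree_size (es (foldl ?g (gs x) (take i (gl x)))) \<le> S" for i
        using bound[of ora x i] by (simp add: S_def)
    qed (use N i in \<open>auto simp: S_def\<close>)
    then obtain t5 s5 where 5: "run ora (While (EVar (Suc N)) body) ?s4 t5
        (fold_queries ?g (\<lambda>s a. q ora (gc x, s, a)) (gs x) (gl x)) s5"
        "s5 0 = es (foldl ?g (gs x) (gl x))"
        "t5 \<le> (length (gl x) + 1) * (poly p (3 * S + 2) + 5 * S + 7)" by blast
    let ?t = "t1 + ((2 + tree_size ?i) + ((3 + tree_size ?i) + ((3 + tree_size ?i) + t5)))"
    have "run ora R s ?t ([] @ ([] @ ([] @ ([] @
        fold_queries ?g (\<lambda>s a. q ora (gc x, s, a)) (gs x) (gl x))))) s5"
      unfolding R_def by (rule run_Seq 1(1) 2 3 4 5(1))+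
    moreover have "?t \<le> poly cost ?n"
    proof -
      have "length (gl x) \<le> poly r ?n"
        using i length_le_tree_size[of "gl x" ea] by simp
      then have "t5 \<le> (poly r ?n + 1) * (poly p (3 * S + 2) + 5 * S + 7)"
        by (intro order_trans[OF 5(3)] mult_right_mono) auto
      then show ?thesis using 1(3) i
        by (simp add: cost_def poly_pcompose S_def algebra_simps)
    qed
    ultimately show "\<exists>t s'. run ora R s t (fold_queries ?g (\<lambda>s a. q ora (gc x, s, a)) (gs x) (gl x)) s' \<and>
        s' 0 = es (foldl ?g (gs x) (gl x)) \<and> t \<le> poly cost ?n"
      using 5(2) by auto
  qed
qed

section \<open>Polynomial-time functions on lists\<close>

lemma ptime_id: "ptime e e (\<lambda>x. x)"
  by (rule ptime_recode) simp

lemma ptime_comp: "ptime ea eb f \<Longrightarrow> ptime eb ec g \<Longrightarrow> ptime ea ec (\<lambda>x. g (f x))"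
  using computes_comp[of ea eb "\<lambda>_. f" "\<lambda>_ _. []" ec "\<lambda>_. g" "\<lambda>_ _. []"] by simp

lemma ptime_transfer:
  assumes "ptime ea eb f" "\<And>x. eb (f x) = ec (g x)"
  shows "ptime ea ec g"
  using assms by (simp add: computes_def)

lemma ptime_fst: "ptime ex (pair_tree ea eb) f \<Longrightarrow> ptime ex ea (\<lambda>x. fst (f x))"
  by (erule ptime_comp) (rule ptime_hd_tree, simp add: pair_tree_def split_def)

lemma ptime_snd: "ptime ex (pair_tree ea eb) f \<Longrightarrow> ptime ex eb (\<lambda>x. snd (f x))"
  by (erule ptime_comp) (rule ptime_tl_tree, simp add: pair_tree_def split_def)

lemma computes_pair: "computes ex ea f qf \<Longrightarrow> computes ex eb g qg \<Longrightarrow>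
    computes ex (pair_tree ea eb) (\<lambda>ora x. (f ora x, g ora x)) (\<lambda>ora x. qf ora x @ qg ora x)"
  by (erule computes_Node, assumption) simp

lemma ptime_pair: "ptime ex ea f \<Longrightarrow> ptime ex eb g \<Longrightarrow> ptime ex (pair_tree ea eb) (\<lambda>x. (f x, g x))"
  by (drule (1) computes_pair) simp

lemma ptime_Cons: "ptime ex ea f \<Longrightarrow> ptime ex (seq_tree ea) g \<Longrightarrow> ptime ex (seq_tree ea) (\<lambda>x. f x # g x)"
  by (drule (1) computes_Node[where ed = "seq_tree ea" and h = "\<lambda>_ x. f x # g x"]) simp_all

lemma ptime_tl: "ptime ex (seq_tree ea) f \<Longrightarrow> ptime ex (seq_tree ea) (\<lambda>x. tl (f x))"
proof (erule ptime_comp, rule ptime_tl_tree)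
  show "seq_tree ea (tl l) = tl_tree (seq_tree ea l)" for l by (cases l) auto
qed

text \<open>As \<open>hd_tree Leaf = Leaf\<close>, the head of an empty list is read as the element encoded by \<open>Leaf\<close>.\<close>

definition hd_default :: "'a \<Rightarrow> 'a list \<Rightarrow> 'a" where
  "hd_default d l = (case l of [] \<Rightarrow> d | a # _ \<Rightarrow> a)"

lemma hd_default_simps [simp]: "hd_default d [] = d" "hd_default d (a # l) = a"
  by (simp_all add: hd_default_def)

lemma ptime_hd_default:
  assumes "ea d = Leaf" "ptime ex (seq_tree ea) f"
  shows "ptime ex ea (\<lambda>x. hd_default d (f x))"
  using assms(2)
proof (rule ptime_comp, intro ptime_hd_tree)
  show "ea (hd_default d l) = hd_tree (seq_tree ea l)" for l using assms(1) by (cases l) auto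
qed

lemma ptime_if: "ptime ex bool_tree c \<Longrightarrow> ptime ex eb f \<Longrightarrow> ptime ex eb g \<Longrightarrow>
    ptime ex eb (\<lambda>x. if c x then f x else g x)"
  by (drule (2) computes_Cond) simp

text \<open>The invariant \<open>I\<close> is for steps whose growth can only be bounded on the
  states that occur, such as \<open>stage\<close>.\<close>

lemma foldl_tree_size_le:
  assumes "\<And>s a. a \<in> set l \<Longrightarrow> I s \<Longrightarrow> I (g s a) \<and> tree_size (es (g s a)) \<le> tree_size (es s) + B"
    and "I st"
  shows "tree_size (es (foldl g st (take i l))) \<le> tree_size (es st) + length l * B"
proof -
  have "I (foldl g st k) \<and> tree_size (es (foldl g st k)) \<le> tree_size (es st) + length k * B"
    if "set k \<subseteq> set l" for k
    using that
  proof (induction k rule: rev_induct)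
    case (snoc a k)
    then show ?case using assms(1)[of a "foldl g st k"] by simp
  qed (simp add: assms(2))
  from this[OF set_take_subset, THEN conjunct2] show ?thesis
    by (rule order_trans) (auto intro: mult_right_mono)
qed

text \<open>The growth per step is bounded in terms of the context and the list element, not of the
  accumulator, so it adds up to a polynomial.\<close>

lemma computes_fold_additive:
  assumes f: "computes (pair_tree ec (pair_tree es ea)) es f q"
    and c: "ptime ex ec gc" and s: "ptime ex es gs" and l: "ptime ex (seq_tree ea) gl"
    and bound: "\<And>ora c s a. tree_size (es (f ora (c, s, a)))
      \<le> tree_size (es s) + poly b (tree_size (ec c) + tree_size (ea a))"
  shows "computes ex es (\<lambda>ora x. foldl (\<lambda>s a. f ora (gc x, s, a)) (gs x) (gl x))
    (\<lambda>ora x. fold_queries (\<lambda>s a. f ora (gc x, s, a)) (\<lambda>s a. q ora (gc x, s, a)) (gs x) (gl x))"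
proof -
  have init: "ptime ex (pair_tree ec (pair_tree es (seq_tree ea))) (\<lambda>x. (gc x, gs x, gl x))"
    by (intro ptime_pair c s l)
  obtain p where p: "\<And>x. tree_size (pair_tree ec (pair_tree es (seq_tree ea)) (gc x, gs x, gl x))
      \<le> poly p (tree_size (ex x))"
    using init by (rule computesE) blast
  show ?thesis
  proof (rule computes_fold[OF f init, where b = "p + p * pcompose b p"])
    fix ora x i
    let ?n = "tree_size (ex x)"
    have p': "1 + tree_size (ec (gc x)) + tree_size (es (gs x)) + tree_size (seq_tree ea (gl x)) \<le> poly p ?n"
      using p[of x] by simp
    have "tree_size (es (foldl (\<lambda>s a. f ora (gc x, s, a)) (gs x) (take i (gl x)))) \<le>
        tree_size (es (gs x)) + length (gl x) * poly b (poly p ?n)"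
    proof (rule foldl_tree_size_le[where I = "\<lambda>_. True"])
      fix s a assume "a \<in> set (gl x)"
      then have "tree_size (ea a) \<le> tree_size (seq_tree ea (gl x))"
        by (rule tree_size_seq_tree_mem)
      then have "poly b (tree_size (ec (gc x)) + tree_size (ea a)) \<le> poly b (poly p ?n)"
        by (intro poly_nat_mono) (use p' in linarith)
      then show "True \<and> tree_size (es (f ora (gc x, s, a))) \<le> tree_size (es s) + poly b (poly p ?n)"
        using bound[of ora "gc x" s a] by (simp add: le_trans[OF _ add_left_mono])
    qed simp
    moreover have "length (gl x) * poly b (poly p ?n) \<le> poly p ?n * poly b (poly p ?n)"
      using p' length_le_tree_size[of "gl x" ea] by (intro mult_right_mono) linarith+
    ultimately show "tree_size (es (foldl (\<lambda>s a. f ora (gc x, s, a)) (gs x) (take i (gl x))))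
        \<le> poly (p + p * pcompose b p) ?n"
      unfolding poly_add poly_mult poly_pcompose using p' by linarith
  qed
qed

lemma ptime_fold_additive:
  assumes f: "ptime (pair_tree ec (pair_tree es ea)) es f"
    and c: "ptime ex ec gc" and s: "ptime ex es gs" and l: "ptime ex (seq_tree ea) gl"
    and bound: "\<And>c s a. tree_size (es (f (c, s, a)))
      \<le> tree_size (es s) + poly b (tree_size (ec c) + tree_size (ea a))"
  shows "ptime ex es (\<lambda>x. foldl (\<lambda>s a. f (gc x, s, a)) (gs x) (gl x))"
  using computes_fold_additive[OF f c s l bound] by simp

lemma ptime_foldl:
  assumes f: "ptime (pair_tree es ea) es f"
    and s: "ptime ex es gs" and l: "ptime ex (seq_tree ea) gl"
    and bound: "\<And>s a. tree_size (es (f (s, a))) \<le> tree_size (es s) + poly b (tree_size (ea a))"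
  shows "ptime ex es (\<lambda>x. foldl (\<lambda>s a. f (s, a)) (gs x) (gl x))"
proof -
  have "tree_size (es (f (snd (c, s, a)))) \<le> tree_size (es s) + poly b (tree_size Leaf + tree_size (ea a))"
    for c :: unit and s a
    using bound[of s a] poly_nat_mono[of "tree_size (ea a)" "tree_size Leaf + tree_size (ea a)" b] by simp
  from ptime_fold_additive[where ec = "\<lambda>_. Leaf" and f = "\<lambda>x. f (snd x)",
      OF ptime_comp[OF ptime_snd[OF ptime_id] f] ptime_const s l this]
  show ?thesis by simp
qed

lemma foldl_snoc_Cons: "foldl (\<lambda>s a. f a # s) l k = rev (map f k) @ l"
  by (induction k arbitrary: l) auto

lemma ptime_rev:
  assumes "ptime ex (seq_tree ea) l"
  shows "ptime ex (seq_tree ea) (\<lambda>x. rev (l x))"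
proof -
  have "ptime ex (seq_tree ea) (\<lambda>x. foldl (\<lambda>s a. (\<lambda>x. snd x # fst x) (s, a)) [] (l x))"
    by (rule ptime_foldl[where f = "\<lambda>x. snd x # fst x" and b = "[:1, 1:]"])
      (rule ptime_Cons ptime_snd ptime_fst ptime_id ptime_const assms | simp)+
  then show ?thesis by (simp add: foldl_snoc_Cons[where f = "\<lambda>a. a", simplified])
qed

lemma ptime_append:
  assumes "ptime ex (seq_tree ea) k" "ptime ex (seq_tree ea) l"
  shows "ptime ex (seq_tree ea) (\<lambda>x. k x @ l x)"
proof -
  have "ptime ex (seq_tree ea) (\<lambda>x. foldl (\<lambda>s a. (\<lambda>x. snd x # fst x) (s, a)) (l x) (rev (k x)))"
    by (rule ptime_foldl[where f = "\<lambda>x. snd x # fst x" and b = "[:1, 1:]"])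
      (rule ptime_Cons ptime_snd ptime_fst ptime_id assms ptime_rev | simp)+
  then show ?thesis by (simp add: foldl_snoc_Cons[where f = "\<lambda>a. a", simplified])
qed

lemma fold_queries_concat: "fold_queries f (\<lambda>_ a. q a) s l = concat (map q l)"
  by (induction l arbitrary: s) auto

lemma computes_map:
  assumes f: "computes (pair_tree ec ea) eb f q" and c: "ptime ex ec c" and l: "ptime ex (seq_tree ea) l"
  shows "computes ex (seq_tree eb) (\<lambda>ora x. map (\<lambda>a. f ora (c x, a)) (l x))
    (\<lambda>ora x. concat (map (\<lambda>a. q ora (c x, a)) (l x)))"
proof -
  obtain p where p: "\<And>ora x. tree_size (eb (f ora x)) \<le> poly p (tree_size (pair_tree ec ea x))"
    using f by (rule computesE) blast
  have 1: "ptime (pair_tree ec (pair_tree (seq_tree eb) ea)) (pair_tree ec ea) (\<lambda>x. (fst x, snd (snd x)))"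
    by (intro ptime_pair ptime_fst ptime_snd) (rule ptime_id)+
  have 2: "computes (pair_tree ec (pair_tree (seq_tree eb) ea)) (seq_tree eb)
      (\<lambda>ora x. f ora (fst x, snd (snd x)) # fst (snd x)) (\<lambda>ora x. q ora (fst x, snd (snd x)))"
    using computes_Node[where ed = "seq_tree eb", OF computes_comp[OF 1 f] ptime_fst[OF ptime_snd[OF ptime_id]]]
    by simp
  have "tree_size (seq_tree eb (f ora (fst (c, s, a), snd (snd (c, s, a))) # fst (snd (c, s, a)))) \<le>
      tree_size (seq_tree eb s) + poly ([:1:] + pcompose p [:1, 1:]) (tree_size (ec c) + tree_size (ea a))"
    for ora c s a
    using p[of ora "(c, a)"] by (simp add: poly_pcompose)
  from computes_fold_additive[where f = "\<lambda>ora x. f ora (fst x, snd (snd x)) # fst (snd x)" and gc = c and gs = "\<lambda>_. []" and gl = l, OF 2 c ptime_const l this]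
  have 3: "computes ex (seq_tree eb) (\<lambda>ora x. foldl (\<lambda>s a. f ora (c x, a) # s) [] (l x))
      (\<lambda>ora x. concat (map (\<lambda>a. q ora (c x, a)) (l x)))"
    by (simp only: fst_conv snd_conv fold_queries_concat)
  from computes_comp[OF 3 ptime_rev[OF ptime_id]] show ?thesis
    by (simp only: foldl_snoc_Cons append_Nil2 rev_rev_ident)
qed

lemma ptime_map:
  assumes "ptime (pair_tree ec ea) eb f" "ptime ex ec c" "ptime ex (seq_tree ea) l"
  shows "ptime ex (seq_tree eb) (\<lambda>x. map (\<lambda>a. f (c x, a)) (l x))"
  using computes_map[OF assms] by (simp add: concat_eq_Nil_conv[THEN iffD2])

lemma ptime_ex:
  assumes "ptime ex (seq_tree bool_tree) l"
  shows "ptime ex bool_tree (\<lambda>x. True \<in> set (l x))"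
proof -
  have "ptime ex bool_tree (\<lambda>x. foldl (\<lambda>s a. (\<lambda>x. if fst x then True else snd x) (s, a)) False (l x))"
  proof (rule ptime_foldl[where f = "\<lambda>x. if fst x then True else snd x" and b = "[:0, 1:]" and ea = bool_tree])
    show "ptime (pair_tree bool_tree bool_tree) bool_tree (\<lambda>x. if fst x then True else snd x)"
      by (intro ptime_if ptime_const ptime_fst ptime_snd) (rule ptime_id)+
  qed (auto intro: ptime_const assms)
  moreover have "foldl (\<lambda>s a. if fst (s, a) then True else snd (s, a)) b k \<longleftrightarrow> b \<or> True \<in> set k" for b k
    by (induction k arbitrary: b) auto
  ultimately show ?thesis by (simp only: simp_thms)
qed

text \<open>The total version of \<open>zip\<close> that a loop over \<open>xs\<close> produces when
  it takes heads and tails of \<open>ys\<close>: past the end of \<open>ys\<close> the machine reads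
  \<open>Leaf\<close>, that is, \<open>d\<close>.\<close>

primrec zip_default :: "'b \<Rightarrow> 'a list \<Rightarrow> 'b list \<Rightarrow> ('a \<times> 'b) list" where
  "zip_default d [] ys = []"
| "zip_default d (x # xs) ys = (x, hd_default d ys) # zip_default d xs (tl ys)"

lemma zip_default_eq_zip: "length xs \<le> length ys \<Longrightarrow> zip_default d xs ys = zip xs ys"
proof (induction xs arbitrary: ys)
  case (Cons x xs)
  then show ?case by (cases ys) auto
qed simp

lemma foldl_zip_default:
  "snd (foldl (\<lambda>s x. (tl (fst s), (x, hd_default d (fst s)) # snd s)) (ys, acc) xs) =
    rev (zip_default d xs ys) @ acc"
  by (induction xs arbitrary: ys acc) auto

lemma tree_size_tl: "tree_size (seq_tree e (tl l)) + tree_size (e (hd_default d l)) \<le>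
    tree_size (seq_tree e l) + tree_size (e d)"
  by (cases l) auto

lemma ptime_zip_default:
  assumes d: "eb d = Leaf" and "ptime ex (seq_tree ea) k" "ptime ex (seq_tree eb) l"
  shows "ptime ex (seq_tree (pair_tree ea eb)) (\<lambda>x. zip_default d (k x) (l x))"
proof -
  let ?f = "\<lambda>x. (tl (fst (fst x)), (snd x, hd_default d (fst (fst x))) # snd (fst x))"
  have "ptime ex (pair_tree (seq_tree eb) (seq_tree (pair_tree ea eb)))
      (\<lambda>x. foldl (\<lambda>s a. ?f (s, a)) (l x, []) (k x))"
  proof (rule ptime_foldl[where f = ?f and b = "[:3, 1:]"])
    show "ptime (pair_tree (pair_tree (seq_tree eb) (seq_tree (pair_tree ea eb))) ea)
        (pair_tree (seq_tree eb) (seq_tree (pair_tree ea eb))) ?f"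
      by (intro ptime_pair ptime_Cons ptime_tl ptime_hd_default d ptime_fst ptime_snd)
        (rule ptime_id)+
    show "tree_size (pair_tree (seq_tree eb) (seq_tree (pair_tree ea eb)) (?f (s, a))) \<le>
        tree_size (pair_tree (seq_tree eb) (seq_tree (pair_tree ea eb)) s) +
        poly [:3, 1:] (tree_size (ea a))" for s a
      using tree_size_tl[of eb "fst s" d] d by (cases s) simp
  qed (rule ptime_pair ptime_const assms)+
  from ptime_rev[OF ptime_snd[OF this]] show ?thesis
    by (simp add: foldl_zip_default)
qed

section \<open>Binary numbers\<close>

fun increment :: "bool list \<Rightarrow> bool list" where
  "increment [] = [True]"
| "increment (b # l) = (if b then False # increment l else True # l)"

fun bits :: "nat \<Rightarrow> bool list" where
  "bits 0 = []"
| "bits (Suc n) = odd (Suc n) # bits (Suc n div 2)"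

lemma bits_Suc: "bits (Suc n) = increment (bits n)"
proof (induction n rule: bits.induct)
  case (2 n)
  show ?case
  proof (cases "even n")
    case True
    then have "Suc (Suc n) div 2 = Suc (Suc n div 2)" by simp
    then show ?thesis using True 2 by (simp only: bits.simps increment.simps) simp
  next
    case False
    then have "Suc (Suc n) div 2 = Suc n div 2" by simp
    then show ?thesis using False by (simp only: bits.simps increment.simps) simp
  qed
qed (simp add: numeral_2_eq_2)

lemma nat_tree_bits: "nat_tree n = seq_tree bool_tree (bits n)"
  by (induction n rule: bits.induct) auto

lemma ptime_increment:
  assumes "ptime ex (seq_tree bool_tree) l"
  shows "ptime ex (seq_tree bool_tree) (\<lambda>x. increment (l x))"
proof -
  \<comment> \<open>The accumulator consists of the carry, initially \<open>True\<close>, and the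
    output bits in reverse order; \<open>?g\<close> adds the bit of a carry that is left
    over.\<close>
  let ?f = "\<lambda>x. if fst (fst x) then (snd x, (if snd x then False else True) # snd (fst x))
    else (False, snd x # snd (fst x))"
  let ?g = "\<lambda>x. rev (if fst x then True # snd x else snd x)"
  have 1: "ptime ex (pair_tree bool_tree (seq_tree bool_tree))
      (\<lambda>x. foldl (\<lambda>s a. ?f (s, a)) (True, []) (l x))"
  proof (rule ptime_foldl[where f = ?f and b = "[:10:]"])
    show "ptime (pair_tree (pair_tree bool_tree (seq_tree bool_tree)) bool_tree)
        (pair_tree bool_tree (seq_tree bool_tree)) ?f"
      by (intro ptime_if ptime_pair ptime_Cons ptime_const ptime_fst ptime_snd) (rule ptime_id)+
    show "tree_size (pair_tree bool_tree (seq_tree bool_tree) (?f (s, a))) \<le>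
      tree_size (pair_tree bool_tree (seq_tree bool_tree) s) + poly [:10:] (tree_size (bool_tree a))" for s a
      by (cases s) (auto simp: bool_tree_def)
  qed (rule ptime_const assms)+
  have 2: "ptime (pair_tree bool_tree (seq_tree bool_tree)) (seq_tree bool_tree) ?g"
    by (intro ptime_rev ptime_if ptime_Cons ptime_const ptime_fst ptime_snd) (rule ptime_id)+
  define g where "g = (\<lambda>s a. ?f (s, a))"
  have g: "g (True, acc) a = (a, (\<not> a) # acc)" "g (False, acc) a = (False, a # acc)" for acc a
    by (simp_all add: g_def)
  have h: "foldl g (False, acc) k = (False, rev k @ acc)" for acc k
    by (induction k arbitrary: acc) (simp_all add: g)
  have "?g (foldl g (True, acc) k) = rev acc @ increment k" for acc k
  proof (induction k arbitrary: acc)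
    case (Cons a k)
    show ?case
      using Cons.IH[of "False # acc"] by (cases a) (simp_all add: g h cong: if_cong split del: if_split)
  qed simp
  from this[of "[]"] ptime_comp[OF 1[folded g_def] 2] show ?thesis by simp
qed

lemma ptime_Suc:
  assumes "ptime ex nat_tree f"
  shows "ptime ex nat_tree (\<lambda>x. Suc (f x))"
proof (rule ptime_transfer)
  have "ptime nat_tree (seq_tree bool_tree) bits"
    by (rule ptime_recode) (simp add: nat_tree_bits)
  from ptime_increment[OF ptime_comp[OF assms this]]
  show "ptime ex (seq_tree bool_tree) (\<lambda>x. increment (bits (f x)))" .
qed (metis nat_tree_bits bits_Suc)

text \<open>The size is in fact logarithmic, but the numbers written by the program count list
  entries of the input, for which a linear bound is good enough.\<close>

lemma tree_size_nat_tree: "tree_size (nat_tree n) \<le> 4 * n + 1"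
proof (induction n rule: nat_tree.induct)
  case (2 n)
  have "tree_size (bool_tree (odd (Suc n))) \<le> 3" by (simp add: bool_tree_def)
  moreover have "tree_size (nat_tree (Suc n div 2)) \<le> 4 * n + 1"
    using 2 by (rule order_trans) simp
  moreover have "1 + a + b \<le> 4 * Suc n + 1" if "a \<le> 3" "b \<le> 4 * n + 1" for a b
    using that by simp
  ultimately show ?case by (simp only: nat_tree.simps tree_size.simps)
qed simp

lemma tree_size_seq_tree_le:
  assumes "\<And>x. x \<in> set l \<Longrightarrow> tree_size (e x) \<le> B"
  shows "tree_size (seq_tree e l) \<le> 1 + length l * (1 + B)"
  using assms by (induction l) (auto simp: algebra_simps, fastforce)

text \<open>Each step copies the counter from the accumulator into the output, so the growth depends
  on the accumulator. The sizes are bounded through the closed form \<open>*\<close> of the fold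
  instead.\<close>

lemma ptime_upt_length:
  assumes "ptime ex (seq_tree ea) l"
  shows "ptime ex (seq_tree nat_tree) (\<lambda>x. [0..<length (l x)])"
proof -
  obtain p where p: "\<And>x. tree_size (seq_tree ea (l x)) \<le> poly p (tree_size (ex x))"
    using assms by (rule computesE) blast
  let ?f = "\<lambda>x. (Suc (fst (fst (snd x))), fst (fst (snd x)) # snd (fst (snd x)))"
  have f: "ptime (pair_tree (\<lambda>_ :: unit. Leaf) (pair_tree (pair_tree nat_tree (seq_tree nat_tree)) ea))
      (pair_tree nat_tree (seq_tree nat_tree)) ?f"
    by (intro ptime_pair ptime_Suc ptime_Cons ptime_fst ptime_snd) (rule ptime_id)+
  have *: "foldl (\<lambda>s a. ?f ((), s, a)) (0, []) k = (length k, rev [0..<length k])" for k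
    by (induction k rule: rev_induct) auto
  have init: "ptime ex (pair_tree (\<lambda>_ :: unit. Leaf) (pair_tree (pair_tree nat_tree (seq_tree nat_tree)) (seq_tree ea)))
      (\<lambda>x. ((), (0, []), l x))"
    by (rule ptime_pair ptime_const assms)+
  have "ptime ex (pair_tree nat_tree (seq_tree nat_tree)) (\<lambda>x. foldl (\<lambda>s a. ?f ((), s, a)) (0, []) (l x))"
  proof -
    have "tree_size (pair_tree nat_tree (seq_tree nat_tree) (foldl (\<lambda>s a. ?f ((), s, a)) (0, []) (take i (l x))))
        \<le> poly ([:3:] + 4 * p + p * ([:2:] + 4 * p)) (tree_size (ex x))" for ora :: "tree \<Rightarrow> bool" and x i
    proof -
      let ?k = "length (take i (l x))" and ?n = "poly p (tree_size (ex x))"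
      have k: "?k \<le> ?n"
        using p[of x] length_le_tree_size[of "l x" ea] by simp
      have "tree_size (seq_tree nat_tree (rev [0..<?k])) \<le> 1 + length (rev [0..<?k]) * (1 + (4 * ?k + 1))"
      proof (rule tree_size_seq_tree_le)
        show "tree_size (nat_tree y) \<le> 4 * ?k + 1" if "y \<in> set (rev [0..<?k])" for y
        proof -
          from that have "y < ?k" by (simp only: set_rev set_upt atLeastLessThan_iff)
          with tree_size_nat_tree[of y] show ?thesis by linarith
        qed
      qed
      also have "\<dots> \<le> 1 + ?n * (1 + (4 * ?n + 1))"
        using k by (intro add_mono mult_mono) (auto simp del: length_take)
      finally have 1: "tree_size (seq_tree nat_tree (rev [0..<?k])) \<le> 1 + ?n * (1 + (4 * ?n + 1))" .
      have "tree_size (nat_tree ?k) \<le> 4 * ?n + 1"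
        using tree_size_nat_tree[of ?k] k by linarith
      with 1 show ?thesis unfolding * by (simp add: algebra_simps)
    qed
    from computes_fold[where f = "\<lambda>_. ?f", OF f init this] show ?thesis by simp
  qed
  from ptime_rev[OF ptime_snd[OF this]] show ?thesis unfolding * by simp
qed

section \<open>Matrices as lists of rows\<close>

abbreviation unary_tree :: "unit list \<Rightarrow> tree" where
  "unary_tree \<equiv> seq_tree (\<lambda>_. Leaf)"

abbreviation row_tree :: "nat list \<Rightarrow> tree" where
  "row_tree \<equiv> seq_tree nat_tree"

abbreviation rows_tree :: "nat list list \<Rightarrow> tree" where
  "rows_tree \<equiv> seq_tree row_tree"

text \<open>The last component is the end of the three-element list in \<open>instance_tree\<close>,
  which makes an instance a nested pair.\<close>

type_synonym lce_input = "nat \<times> nat list list \<times> nat list list \<times> unit"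

abbreviation input_tree :: "lce_input \<Rightarrow> tree" where
  "input_tree \<equiv> pair_tree nat_tree (pair_tree rows_tree (pair_tree rows_tree (\<lambda>_. Leaf)))"

lemma instance_tree_eq:
  "instance_tree q G1 G2 = input_tree (q, mat_to_list G1, mat_to_list G2, ())"
  by (simp add: instance_tree_def mat_tree_def seq_tree_def cong: map_cong)

text \<open>The number of copies is the length of \<open>u\<close>. In this unary form repetition is
  a \<open>map\<close>; the copies are put in front of each row, and \<open>c\<close> is the column
  from top to bottom.\<close>

definition append_copies :: "unit list \<Rightarrow> nat list \<Rightarrow> nat list list \<Rightarrow> nat list list" where
  "append_copies u c E = map (\<lambda>(x, r). map (\<lambda>_. x) u @ r) (zip_default [] c E)"

lemma ptime_append_copies:
  assumes "ptime ex unary_tree u" "ptime ex row_tree c" "ptime ex rows_tree E"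
  shows "ptime ex rows_tree (\<lambda>x. append_copies (u x) (c x) (E x))"
proof -
  have 1: "ptime (pair_tree unary_tree (pair_tree nat_tree row_tree)) row_tree
      (\<lambda>x. map (\<lambda>a. (\<lambda>y. fst y) (fst (snd x), a)) (fst x) @ snd (snd x))"
    by (intro ptime_append ptime_map[where f = fst and ec = nat_tree and ea = "\<lambda>_. Leaf"] ptime_fst ptime_snd)
      (rule ptime_id)+
  from ptime_map[OF 1 assms(1) ptime_zip_default[OF _ assms(2,3), of "[]"]]
  show ?thesis by (simp add: append_copies_def split_def)
qed

text \<open>Transposition. The number of columns is read off the first row, so
  \<open>columns_select_rows\<close> asks for at least one row. Going through the rows from the last
  one on compensates for the reversal by \<open>#\<close>.\<close>

definition columns :: "nat list list \<Rightarrow> nat list list" where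
  "columns M = foldl (\<lambda>cs r. map (\<lambda>(x, c). x # c) (zip_default [] r cs)) (map (\<lambda>_. []) (hd_default [] M)) (rev M)"

lemma ptime_columns:
  assumes "ptime ex rows_tree M"
  shows "ptime ex rows_tree (\<lambda>x. columns (M x))"
proof -
  let ?h = "\<lambda>y. fst (snd y) # snd (snd y)" and ?f = "\<lambda>s. map (\<lambda>a. fst a # snd a) (zip_default [] (snd s) (fst s))"
  have 1: "ptime (pair_tree (\<lambda>_ :: unit. Leaf) (pair_tree nat_tree row_tree)) row_tree ?h"
    by (intro ptime_Cons ptime_fst ptime_snd) (rule ptime_id)+
  have 2: "ptime (pair_tree rows_tree row_tree) rows_tree ?f"
    using ptime_map[where f = ?h and c = "\<lambda>_. ()", OF 1 ptime_const ptime_zip_default[of row_tree "[]", OF _ ptime_snd[OF ptime_id] ptime_fst[OF ptime_id]]]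
    by simp
  have 3: "ptime ex rows_tree (\<lambda>x. map (\<lambda>_. []) (hd_default [] (M x)))"
    using ptime_map[where f = "\<lambda>_. []" and ec = "\<lambda>_ :: unit. Leaf" and c = "\<lambda>_. ()" and eb = row_tree,
        OF ptime_const ptime_const ptime_hd_default[of row_tree "[]", OF _ assms]]
    by simp
  have "tree_size (rows_tree (?f (s, a))) \<le> tree_size (rows_tree s) + poly [:0, 2:] (tree_size (row_tree a))" for s a
  proof (induction a arbitrary: s)
    case (Cons x a)
    have "tree_size (rows_tree (?f (s, x # a))) = 2 + tree_size (nat_tree x) +
        tree_size (row_tree (hd_default [] s)) + tree_size (rows_tree (?f (tl s, a)))"
      by simp
    moreover have "poly [:0, 2:] (tree_size (row_tree (x # a))) =
        2 + 2 * tree_size (nat_tree x) + poly [:0, 2:] (tree_size (row_tree a))" by simp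
    moreover have "tree_size (row_tree []) = 1" by simp
    ultimately show ?case
      using Cons[of "tl s"] tree_size_tl[of row_tree s "[]"] tree_size_pos(1)[of "nat_tree x"] by linarith
  qed simp
  from ptime_foldl[where f = ?f, OF 2 3 ptime_rev[OF assms] this] show ?thesis
    by (simp only: columns_def split_def fst_conv snd_conv)
qed

lemma tree_size_unary: "tree_size (unary_tree u) = 1 + 2 * length u"
  by (induction u) auto

text \<open>The multiples \<open>Suc i * length N\<close> in unary, one per entry of
  \<open>C\<close>, by repeated addition of \<open>N\<close>; \<open>multiples_eq\<close> is the
  closed form.\<close>

definition multiples :: "unit list \<Rightarrow> 'a list \<Rightarrow> ('a \<times> unit list) list" where
  "multiples N C = rev (snd (foldl (\<lambda>s c. (N @ fst s, (c, N @ fst s) # snd s)) ([], []) C))"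

lemma ptime_multiples:
  fixes C :: "'x \<Rightarrow> 'a list"
  assumes N: "ptime ex unary_tree N" and C: "ptime ex (seq_tree ea) C"
  shows "ptime ex (seq_tree (pair_tree ea unary_tree)) (\<lambda>x. multiples (N x) (C x))"
proof -
  let ?f = "\<lambda>x :: unit list \<times> (unit list \<times> ('a \<times> unit list) list) \<times> 'a. (fst x @ fst (fst (snd x)), (snd (snd x), fst x @ fst (fst (snd x))) # snd (fst (snd x)))"
  let ?es = "pair_tree unary_tree (seq_tree (pair_tree ea unary_tree))"
  have f: "ptime (pair_tree unary_tree (pair_tree ?es ea)) ?es ?f"
    by (intro ptime_pair ptime_Cons ptime_append ptime_fst ptime_snd) (rule ptime_id)+
  have init: "ptime ex (pair_tree unary_tree (pair_tree ?es (seq_tree ea))) (\<lambda>x. (N x, ([], []), C x))"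
    by (rule ptime_pair ptime_const N C)+
  obtain p where p: "\<And>x. tree_size (pair_tree unary_tree (pair_tree ?es (seq_tree ea)) (N x, ([], []), C x)) \<le> poly p (tree_size (ex x))"
    using init by (rule computesE) blast
  \<comment> \<open>The running total is copied at every step, so additive growth fails; the total
    itself is linear in the number of steps, which gives this explicit bound.\<close>
  have size: "length (fst (foldl (\<lambda>s c. ?f (M, s, c)) ([], []) D)) = length D * length M \<and>
      tree_size (seq_tree (pair_tree ea unary_tree) (snd (foldl (\<lambda>s c. ?f (M, s, c)) ([], []) D)))
      \<le> tree_size (seq_tree ea D) + length D * (3 + 2 * (length D * length M))" for M D
  proof (induction D rule: rev_induct)
    case (snoc c D)
    have "tree_size (seq_tree ea (D @ [c])) = tree_size (seq_tree ea D) + 1 + tree_size (ea c)"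
      by (simp add: tree_size_seq_tree)
    moreover have "length D * (3 + 2 * (length D * length M)) \<le> length D * (3 + 2 * (length (D @ [c]) * length M))"
      by (intro mult_left_mono) auto
    ultimately show ?case using snoc by (simp add: tree_size_unary algebra_simps)
  qed simp
  have bound: "tree_size (?es (foldl (\<lambda>s c. ?f (N x, s, c)) ([], []) (take i (C x))))
      \<le> poly ([:3:] + 2 * (p * p) + p + p * ([:3:] + 2 * (p * p))) (tree_size (ex x))" for ora :: "tree \<Rightarrow> bool" and x i
  proof -
    let ?n = "poly p (tree_size (ex x))" and ?D = "take i (C x)"
    have n: "length (N x) \<le> ?n" "tree_size (seq_tree ea (C x)) \<le> ?n"
      using p[of x] by (auto simp: tree_size_unary)
    have "tree_size (seq_tree ea (C x)) + 1 = tree_size (seq_tree ea ?D) + tree_size (seq_tree ea (drop i (C x)))"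
      by (simp only: tree_size_seq_tree, subst append_take_drop_id[symmetric, of "C x" i], simp del: append_take_drop_id)
    then have d: "tree_size (seq_tree ea ?D) \<le> ?n"
      using n(2) tree_size_pos(1)[of "seq_tree ea (drop i (C x))"] by linarith
    then have l: "length ?D \<le> ?n"
      using length_le_tree_size[of ?D ea] by linarith
    have m: "length ?D * length (N x) \<le> ?n * ?n"
      using l n(1) by (rule mult_mono) auto
    have len: "length ?D * (3 + 2 * (length ?D * length (N x))) \<le> ?n * (3 + 2 * (?n * ?n))"
      using l m by (intro mult_le_mono) simp_all
    define z where "z = foldl (\<lambda>s c. ?f (N x, s, c)) ([], []) ?D"
    have "tree_size (?es z) = 2 + 2 * length (fst z) + tree_size (seq_tree (pair_tree ea unary_tree) (snd z))"
      by (cases z) (simp add: tree_size_unary)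
    also have "\<dots> \<le> 2 + 2 * (?n * ?n) + (?n + ?n * (3 + 2 * (?n * ?n)))"
      using size[of "N x" ?D, folded z_def] m d len by (intro add_mono) linarith+
    also have "\<dots> \<le> poly ([:3:] + 2 * (p * p) + p + p * ([:3:] + 2 * (p * p))) (tree_size (ex x))"
      by simp
    finally show ?thesis unfolding z_def .
  qed
  from computes_fold[where f = "\<lambda>_. ?f", OF f init bound]
  have "ptime ex ?es (\<lambda>x. foldl (\<lambda>s c. ?f (N x, s, c)) ([], []) (C x))" by simp
  from ptime_rev[OF ptime_snd[OF this]] show ?thesis by (simp add: multiples_def)
qed

section \<open>The search and its running time\<close>

text \<open>Removes the first entry marked \<open>True\<close>. The remaining entries come out
  reversed, which is harmless because the search uses them as a set without repetitions.\<close>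

definition pick :: "'a \<Rightarrow> (bool \<times> 'a) list \<Rightarrow> (bool \<times> 'a) \<times> 'a list" where
  "pick d l = foldl (\<lambda>s a. if fst a \<and> \<not> fst (fst s) then ((True, snd a), snd s)
     else (fst s, snd a # snd s)) ((False, d), []) l"

lemma ptime_pick:
  assumes "ptime ex (seq_tree (pair_tree bool_tree ea)) l"
  shows "ptime ex (pair_tree (pair_tree bool_tree ea) (seq_tree ea)) (\<lambda>x. pick d (l x))"
proof -
  let ?f = "\<lambda>x. if fst (snd x) then if fst (fst (fst x)) then (fst (fst x), snd (snd x) # snd (fst x))
      else ((True, snd (snd x)), snd (fst x)) else (fst (fst x), snd (snd x) # snd (fst x))"
  have f: "ptime (pair_tree (pair_tree (pair_tree bool_tree ea) (seq_tree ea)) (pair_tree bool_tree ea))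
      (pair_tree (pair_tree bool_tree ea) (seq_tree ea)) ?f"
    by (intro ptime_if ptime_pair ptime_Cons ptime_const ptime_fst ptime_snd) (rule ptime_id)+
  have "tree_size (pair_tree (pair_tree bool_tree ea) (seq_tree ea) (?f (s, a))) \<le>
      tree_size (pair_tree (pair_tree bool_tree ea) (seq_tree ea) s) +
      poly [:3, 1:] (tree_size (pair_tree bool_tree ea a))" for s a
    by (cases s; cases a) (auto simp: bool_tree_def)
  from ptime_foldl[where f = ?f, OF f ptime_const assms this]
  have "ptime ex (pair_tree (pair_tree bool_tree ea) (seq_tree ea))
      (\<lambda>x. foldl (\<lambda>s a. ?f (s, a)) ((False, d), []) (l x))" .
  moreover have "foldl (\<lambda>s a. ?f (s, a)) ((False, d), []) k = pick d k" for k
    unfolding pick_def by (rule arg_cong[where f = "\<lambda>g. foldl g _ _"]) (simp add: fun_eq_iff)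
  ultimately show ?thesis by (simp only:)
qed

lemma foldl_pick_True:
  "foldl (\<lambda>s a. if fst a \<and> \<not> fst (fst s) then ((True, snd a), snd s)
     else (fst s, snd a # snd s)) ((True, d), r) l = ((True, d), rev (map snd l) @ r)"
  by (induction l arbitrary: r) auto

lemma foldl_pick_False:
  "\<forall>a\<in>set l. \<not> fst a \<Longrightarrow> foldl (\<lambda>s a. if fst a \<and> \<not> fst (fst s) then ((True, snd a), snd s)
     else (fst s, snd a # snd s)) ((False, d), r) l = ((False, d), rev (map snd l) @ r)"
  by (induction l arbitrary: r) auto

lemma pick_cases:
  obtains "\<And>a. a \<in> set l \<Longrightarrow> \<not> fst a" "pick d l = ((False, d), rev (map snd l))"
  | xs a ys where "l = xs @ a # ys" "fst a" "pick d l = ((True, snd a), rev (map snd ys) @ rev (map snd xs))"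
proof (cases "\<exists>a\<in>set l. fst a")
  case True
  then obtain xs a ys where "l = xs @ a # ys" "fst a" "\<forall>x\<in>set xs. \<not> fst x"
    using split_list_first_prop[OF True] by blast
  then show thesis
    by (intro that(2)[of xs a ys]) (simp_all add: pick_def foldl_pick_True foldl_pick_False)
next
  case False
  then show thesis
    by (intro that(1)) (auto simp: pick_def foldl_pick_False)
qed

text \<open>A state \<open>(E1, E2, L, R, out)\<close> of the search holds the generator matrices with the repetitions made so
  far, the columns of the second matrix that carry a label, the unmatched columns of the second
  matrix with their positions, and the images of the coordinates treated so far, last one first.\<close>

type_synonym search_state =
  "nat list list \<times> nat list list \<times> nat list list \<times> (nat list \<times> nat) list \<times> nat list"

abbreviation state_tree :: "search_state \<Rightarrow> tree" where
  "state_tree \<equiv> pair_tree rows_tree (pair_tree rows_tree (pair_tree rows_tree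
     (pair_tree (seq_tree (pair_tree row_tree nat_tree)) row_tree)))"

abbreviation stage_tree :: "nat \<times> search_state \<times> nat list \<times> unit list \<Rightarrow> tree" where
  "stage_tree \<equiv> pair_tree nat_tree (pair_tree state_tree (pair_tree row_tree unary_tree))"

definition query :: "nat \<times> nat list list \<times> nat list list \<times> unit list \<Rightarrow> nat list \<Rightarrow> tree" where
  "query = (\<lambda>(q, A, E, u) d. input_tree (q, A, append_copies u d E, ()))"

definition stage_context ::
  "nat \<times> search_state \<times> nat list \<times> unit list \<Rightarrow> nat \<times> nat list list \<times> nat list list \<times> unit list" where
  "stage_context = (\<lambda>(q, (E1, E2, L, R, out), c, u). (q, append_copies u c E1, E2, u))"

text \<open>The default \<open>([], 0)\<close> makes the stage total. When the search runs on
  equivalent codes, \<open>test_exists\<close> guarantees an accepted candidate. The copies become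
  permanent only if no labelled column is accepted.\<close>

definition stage :: "(tree \<Rightarrow> bool) \<Rightarrow> nat \<times> search_state \<times> nat list \<times> unit list \<Rightarrow> search_state" where
  "stage ora = (\<lambda>(q, (E1, E2, L, R, out), c, u).
     let ask = (\<lambda>d. ora (query (q, append_copies u c E1, E2, u) d));
         ((_, d, j), R') = pick ([], 0) (map (\<lambda>(d, j). (ask d, d, j)) R)
     in if True \<in> set (map ask L) then (E1, E2, L, R', j # out)
        else (append_copies u c E1, append_copies u d E2, d # L, R', j # out))"

text \<open>All labelled and all unmatched columns are submitted, even after a positive answer. So
  the queries of a stage depend on its state alone and not on the oracle.\<close>

definition stage_queries :: "nat \<times> search_state \<times> nat list \<times> unit list \<Rightarrow> tree list" where
  "stage_queries = (\<lambda>(q, (E1, E2, L, R, out), c, u).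
     map (query (q, append_copies u c E1, E2, u)) (L @ map fst R))"

lemma computes_stage: "computes stage_tree state_tree stage (\<lambda>_. stage_queries)"
proof -
  let ?ctx = "pair_tree nat_tree (pair_tree rows_tree (pair_tree rows_tree unary_tree))"
  let ?item = "pair_tree row_tree nat_tree"
  have "ptime (pair_tree ?ctx row_tree) input_tree (\<lambda>y. (fst (fst y), fst (snd (fst y)),
      append_copies (snd (snd (snd (fst y)))) (snd y) (fst (snd (snd (fst y)))), ()))"
    by (intro ptime_pair ptime_append_copies ptime_const ptime_fst ptime_snd) (rule ptime_id)+
  from computes_comp[OF this computes_ask]
  have ask: "computes (pair_tree ?ctx row_tree) bool_tree (\<lambda>ora y. ora (query (fst y) (snd y)))
      (\<lambda>_ y. [query (fst y) (snd y)])"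
    by (simp add: query_def split_def)
  have ctx: "ptime stage_tree ?ctx stage_context"
    unfolding stage_context_def split_def
    by (intro ptime_pair ptime_append_copies ptime_fst ptime_snd) (rule ptime_id)+
  have L: "ptime stage_tree rows_tree (\<lambda>x. fst (snd (snd (fst (snd x)))))"
    by (intro ptime_fst ptime_snd) (rule ptime_id)
  have U: "ptime stage_tree (seq_tree ?item) (\<lambda>x. fst (snd (snd (snd (fst (snd x))))))"
    by (intro ptime_fst ptime_snd) (rule ptime_id)
  have labs: "computes stage_tree (seq_tree bool_tree)
      (\<lambda>ora x. map (\<lambda>d. ora (query (stage_context x) d)) (fst (snd (snd (fst (snd x))))))
      (\<lambda>_ x. map (query (stage_context x)) (fst (snd (snd (fst (snd x))))))"
    using computes_map[OF ask ctx L] by (simp only: fst_conv snd_conv concat_map_singleton)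
  have "ptime (pair_tree ?ctx ?item) (pair_tree ?ctx row_tree) (\<lambda>y. (fst y, fst (snd y)))"
    by (intro ptime_pair ptime_fst ptime_snd) (rule ptime_id)+
  from computes_pair[OF computes_comp[OF this ask] ptime_snd[OF ptime_id]]
  have ask': "computes (pair_tree ?ctx ?item) (pair_tree bool_tree ?item)
      (\<lambda>ora y. (ora (query (fst y) (fst (snd y))), snd y)) (\<lambda>_ y. [query (fst y) (fst (snd y))])"
    by simp
  have ans: "computes stage_tree (seq_tree (pair_tree bool_tree ?item))
      (\<lambda>ora x. map (\<lambda>a. (ora (query (stage_context x) (fst a)), a)) (fst (snd (snd (snd (fst (snd x)))))))
      (\<lambda>_ x. map (\<lambda>a. query (stage_context x) (fst a)) (fst (snd (snd (snd (fst (snd x)))))))"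
    using computes_map[OF ask' ctx U] by (simp only: fst_conv snd_conv concat_map_singleton)
  let ?W = "pair_tree stage_tree (pair_tree (seq_tree bool_tree) (seq_tree (pair_tree bool_tree ?item)))"
  let ?st = "\<lambda>x. fst (snd (fst x))" and ?c = "\<lambda>x. fst (snd (snd (fst x)))" and ?u = "\<lambda>x. snd (snd (snd (fst x)))"
  let ?p = "\<lambda>x. pick ([], 0) (snd (snd x))"
  have fin: "ptime ?W state_tree (\<lambda>x. if True \<in> set (fst (snd x))
      then (fst (?st x), fst (snd (?st x)), fst (snd (snd (?st x))), snd (?p x), snd (snd (fst (?p x))) # snd (snd (snd (snd (?st x)))))
      else (append_copies (?u x) (?c x) (fst (?st x)), append_copies (?u x) (fst (snd (fst (?p x)))) (fst (snd (?st x))),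
        fst (snd (fst (?p x))) # fst (snd (snd (?st x))), snd (?p x), snd (snd (fst (?p x))) # snd (snd (snd (snd (?st x))))))"
    by (rule ptime_if ptime_ex ptime_pair ptime_Cons ptime_append_copies ptime_pick ptime_fst ptime_snd ptime_id)+
  from computes_comp[OF computes_pair[OF ptime_id computes_pair[OF labs ans]] fin] show ?thesis
    unfolding stage_def stage_queries_def stage_context_def Let_def split_def
    by (simp only: fst_conv snd_conv append_Nil append_Nil2 map_append map_map comp_def prod.collapse)
qed

lemma append_copies_Cons:
  "append_copies u (x # c) E = (map (\<lambda>_. x) u @ hd_default [] E) # append_copies u c (tl E)"
  by (simp add: append_copies_def)

lemma tree_size_append_copies:
  "tree_size (rows_tree (append_copies u c E)) \<le>
    tree_size (rows_tree E) + tree_size (row_tree c) * (tree_size (unary_tree u) + 2)"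
proof (induction c arbitrary: E)
  case Nil
  then show ?case by (simp add: append_copies_def)
next
  case (Cons x c)
  let ?u = "tree_size (unary_tree u)" and ?x = "tree_size (nat_tree x)"
  have "tree_size (row_tree (map (\<lambda>_. x) u @ r)) = length u * (1 + ?x) + tree_size (row_tree r)" for r
    by (simp add: tree_size_seq_tree comp_def sum_list_triv)
  moreover have "length u * (1 + ?x) \<le> ?u * (1 + ?x)"
    using length_le_tree_size[of u] by (intro mult_right_mono) auto
  moreover have "tree_size (rows_tree (tl E)) + tree_size (row_tree (hd_default [] E)) \<le> tree_size (rows_tree E) + 1"
    using tree_size_tl[of row_tree E "[]"] by simp
  moreover have "(1 + ?x + tree_size (row_tree c)) * (?u + 2) =
      ?u * (1 + ?x) + 2 + 2 * ?x + tree_size (row_tree c) * (?u + 2)"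
    by (simp add: algebra_simps)
  ultimately show ?case
    using Cons[of "tl E"] by (simp add: append_copies_Cons)
qed

lemma tree_size_seq_tree_rev: "tree_size (seq_tree e (rev xs)) = tree_size (seq_tree e xs)"
  by (simp add: tree_size_seq_tree rev_map[symmetric] sum_list_rev)

lemma pick_map:
  assumes "pick d (map (\<lambda>a. (p a, a)) l) = ((b, a), l')"
  shows "a = d \<or> a \<in> set l" "set l' \<subseteq> set l" "tree_size (seq_tree e l') \<le> tree_size (seq_tree e l)"
proof -
  let ?l = "map (\<lambda>a. (p a, a)) l"
  have l: "map snd ?l = l" by (simp add: comp_def)
  consider "a = d" "l' = rev (map snd ?l)"
    | xs a' ys where "?l = xs @ a' # ys" "a = snd a'" "l' = rev (map snd ys) @ rev (map snd xs)"
    by (rule pick_cases[of ?l d]) (use assms in auto)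
  then have "(a = d \<or> a \<in> set l) \<and> set l' \<subseteq> set l \<and> tree_size (seq_tree e l') \<le> tree_size (seq_tree e l)"
  proof cases
    case 1
    then show ?thesis unfolding l by (simp add: tree_size_seq_tree_rev)
  next
    case (2 xs a' ys)
    then have "l = map snd xs @ a # map snd ys" using l by (metis map_append list.simps(9))
    moreover from this have "tree_size (seq_tree e l') \<le> tree_size (seq_tree e l)"
      using 2(3) by (simp add: tree_size_seq_tree rev_map[symmetric] sum_list_rev)
    ultimately show ?thesis using 2(3) by auto
  qed
  then show "a = d \<or> a \<in> set l" "set l' \<subseteq> set l" "tree_size (seq_tree e l') \<le> tree_size (seq_tree e l)" by auto
qed

text \<open>A stage copies a column that it takes from the state, so its growth has to be bounded
  through the state. Unmatched columns are only ever removed, hence a bound on their sizes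
  persists.\<close>

definition unmatched_bounded :: "nat \<Rightarrow> search_state \<Rightarrow> bool" where
  "unmatched_bounded K = (\<lambda>(E1, E2, L, R, out). \<forall>a\<in>set R. tree_size (pair_tree row_tree nat_tree a) \<le> K)"

lemma stage_tree_size:
  assumes K: "3 \<le> K" and s: "unmatched_bounded K s"
    and cu: "tree_size (pair_tree row_tree unary_tree (c, u)) \<le> K"
  shows "unmatched_bounded K (stage ora (q, s, c, u)) \<and>
    tree_size (state_tree (stage ora (q, s, c, u))) \<le> tree_size (state_tree s) + (2 * (K * (K + 2)) + 2 * (K + 1))"
proof -
  define B where "B = K * (K + 2)"
  obtain E1 E2 L R out where s_eq: "s = (E1, E2, L, R, out)" by (cases s) auto
  define ask where "ask d = ora (query (q, append_copies u c E1, E2, u) d)" for d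
  obtain b d j R' where p: "pick ([], 0) (map (\<lambda>a. (ask (fst a), a)) R) = ((b, d, j), R')"
    by (cases "pick ([], 0) (map (\<lambda>a. (ask (fst a), a)) R)") auto
  have st: "stage ora (q, s, c, u) = (if True \<in> set (map ask L) then (E1, E2, L, R', j # out)
      else (append_copies u c E1, append_copies u d E2, d # L, R', j # out))"
    using p by (simp add: s_eq stage_def ask_def Let_def split_def)
  note pm = pick_map[OF p]
  \<comment> \<open>The hypothesis \<open>3 \<le> K\<close> covers the default
    \<open>([], 0)\<close>, whose tree has size \<open>3\<close>.\<close>
  have "tree_size (pair_tree row_tree nat_tree (d, j)) \<le> K"
    using pm(1) s K by (auto simp: s_eq unmatched_bounded_def)
  then have dj: "tree_size (row_tree d) \<le> K" "tree_size (nat_tree j) \<le> K" by auto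
  have cu': "tree_size (row_tree c) \<le> K" "tree_size (unary_tree u) \<le> K" using cu by auto
  have grow: "tree_size (rows_tree (append_copies u d' E)) \<le> tree_size (rows_tree E) + B"
    if "tree_size (row_tree d') \<le> K" for d' E
  proof -
    have "tree_size (row_tree d') * (tree_size (unary_tree u) + 2) \<le> K * (K + 2)"
      using that cu' by (intro mult_mono) auto
    then show ?thesis using tree_size_append_copies[of u d' E] unfolding B_def by linarith
  qed
  have "unmatched_bounded K (stage ora (q, s, c, u))"
    using s pm(2) unfolding st by (auto simp: s_eq unmatched_bounded_def)
  moreover have "tree_size (state_tree (stage ora (q, s, c, u))) \<le> tree_size (state_tree s) + (2 * B + 2 * (K + 1))"
  proof (cases "True \<in> set (map ask L)")
    case True
    then show ?thesis using pm(3)[of "pair_tree row_tree nat_tree"] dj by (simp only: st if_True) (simp add: s_eq)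
  next
    case False
    then have "stage ora (q, s, c, u) = (append_copies u c E1, append_copies u d E2, d # L, R', j # out)"
      by (simp only: st if_False)
    then show ?thesis using pm(3)[of "pair_tree row_tree nat_tree"] dj grow[OF cu'(1), of E1] grow[OF dj(1), of E2] by (simp add: s_eq)
  qed
  ultimately show ?thesis by (simp add: B_def)
qed

definition initial_state :: "lce_input \<Rightarrow> search_state" where
  "initial_state = (\<lambda>(q, M1, M2, _). (M1, M2, [], zip_default 0 (columns M2) [0..<length (columns M2)], []))"

text \<open>The tail of the first row has \<open>n - 1\<close> entries and so provides this factor
  in unary.\<close>

definition schedule :: "nat list list \<Rightarrow> (nat list \<times> unit list) list" where
  "schedule M = multiples (map (\<lambda>_. ()) (tl (hd_default [] M))) (columns M)"

definition search :: "(tree \<Rightarrow> bool) \<Rightarrow> lce_input \<Rightarrow> search_state" where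
  "search ora x = foldl (\<lambda>s a. stage ora (fst x, s, a)) (initial_state x) (schedule (fst (snd x)))"

definition search_queries :: "(tree \<Rightarrow> bool) \<Rightarrow> lce_input \<Rightarrow> tree list" where
  "search_queries ora x = fold_queries (\<lambda>s a. stage ora (fst x, s, a)) (\<lambda>s a. stage_queries (fst x, s, a))
     (initial_state x) (schedule (fst (snd x)))"

lemma computes_search: "computes input_tree state_tree search search_queries"
proof -
  have M1: "ptime input_tree rows_tree (\<lambda>x. fst (snd x))" and M2: "ptime input_tree rows_tree (\<lambda>x. fst (snd (snd x)))"
    and q: "ptime input_tree nat_tree fst"
    by (rule ptime_fst ptime_snd ptime_id)+
  have s0: "ptime input_tree state_tree initial_state"
    unfolding initial_state_def split_def
    by (intro ptime_pair ptime_zip_default[where eb = nat_tree] ptime_columns ptime_upt_length[where ea = row_tree] ptime_const M1 M2) simp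
  have "ptime input_tree unary_tree (\<lambda>x. map (\<lambda>a. (\<lambda>_. ()) ((), a)) (tl (hd_default [] (fst (snd x)))))"
    by (rule ptime_map[where f = "\<lambda>_. ()" and c = "\<lambda>_. ()" and ec = "\<lambda>_. Leaf", OF ptime_const ptime_const ptime_tl[OF ptime_hd_default[OF _ M1]]]) simp
  from ptime_multiples[OF this ptime_columns[OF M1]]
  have sched: "ptime input_tree (seq_tree (pair_tree row_tree unary_tree)) (\<lambda>x. schedule (fst (snd x)))"
    by (simp add: schedule_def)
  have init: "ptime input_tree (pair_tree nat_tree (pair_tree state_tree (seq_tree (pair_tree row_tree unary_tree))))
      (\<lambda>x. (fst x, initial_state x, schedule (fst (snd x))))"
    by (intro ptime_pair q s0 sched)
  obtain p where p: "\<And>x. tree_size (pair_tree nat_tree (pair_tree state_tree (seq_tree (pair_tree row_tree unary_tree)))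
      (fst x, initial_state x, schedule (fst (snd x)))) \<le> poly p (tree_size (input_tree x))"
    using init by (rule computesE) blast
  have "tree_size (state_tree (foldl (\<lambda>s a. stage ora (fst x, s, a)) (initial_state x) (take i (schedule (fst (snd x))))))
      \<le> poly (p + p * (2 * (p * (p + [:2:])) + 2 * (p + [:1:]))) (tree_size (input_tree x))" for ora x i
  proof -
    let ?K = "poly p (tree_size (input_tree x))" and ?l = "schedule (fst (snd x))"
    have K: "1 + tree_size (state_tree (initial_state x)) + tree_size (seq_tree (pair_tree row_tree unary_tree) ?l) \<le> ?K"
      using p[of x] by simp
    have "tree_size (state_tree (foldl (\<lambda>s a. stage ora (fst x, s, a)) (initial_state x) (take i ?l)))
      \<le> tree_size (state_tree (initial_state x)) + length ?l * (2 * (?K * (?K + 2)) + 2 * (?K + 1))"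
    proof (rule foldl_tree_size_le[where I = "unmatched_bounded ?K"])
      fix s a assume a: "a \<in> set ?l" and s: "unmatched_bounded ?K s"
      have "tree_size (pair_tree row_tree unary_tree (fst a, snd a)) \<le> ?K"
        using tree_size_seq_tree_mem[OF a, of "pair_tree row_tree unary_tree"] K by simp
      moreover have "3 \<le> ?K"
        using K tree_size_pos(1)[of "state_tree (initial_state x)"]
          tree_size_pos(1)[of "seq_tree (pair_tree row_tree unary_tree) ?l"] by linarith
      ultimately show "unmatched_bounded ?K (stage ora (fst x, s, a)) \<and>
          tree_size (state_tree (stage ora (fst x, s, a))) \<le> tree_size (state_tree s) + (2 * (?K * (?K + 2)) + 2 * (?K + 1))"
        using stage_tree_size[OF _ s, of "fst a" "snd a" ora "fst x"] by simp
    next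
      obtain E1 E2 L R out where s: "initial_state x = (E1, E2, L, R, out)"
        by (cases "initial_state x") auto
      have "tree_size (pair_tree row_tree nat_tree a) \<le> ?K" if "a \<in> set R" for a
        using tree_size_seq_tree_mem[OF that, of "pair_tree row_tree nat_tree"] K by (simp add: s)
      then show "unmatched_bounded ?K (initial_state x)"
        by (simp add: unmatched_bounded_def s)
    qed
    also have "\<dots> \<le> ?K + ?K * (2 * (?K * (?K + 2)) + 2 * (?K + 1))"
      using K length_le_tree_size[of ?l "pair_tree row_tree unary_tree"]
      by (intro add_mono mult_right_mono) linarith+
    finally show ?thesis by simp
  qed
  from computes_fold[where f = stage and gc = fst, OF computes_stage init this]
  show ?thesis unfolding search_def search_queries_def .
qed

lemma search_program:
  "\<exists>P p. \<forall>ora x. \<exists>t s. run ora P (initial_store (input_tree x)) t (search_queries ora x) s \<and>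
     t \<le> poly p (tree_size (input_tree x)) \<and> s 0 = row_tree (rev (snd (snd (snd (snd (search ora x))))))"
proof -
  have "ptime state_tree row_tree (\<lambda>s. rev (snd (snd (snd (snd s)))))"
    by (rule ptime_rev ptime_snd ptime_id)+
  from computes_comp[OF computes_search this] obtain P p where
    P: "\<And>ora x s. s 0 = input_tree x \<Longrightarrow> \<exists>t s'. run ora P s t (search_queries ora x) s' \<and>
      s' 0 = row_tree (rev (snd (snd (snd (snd (search ora x)))))) \<and> t \<le> poly p (tree_size (input_tree x))"
    unfolding computes_def append_Nil2 by blast
  show ?thesis
  proof (rule exI[of _ P], rule exI[of _ p], intro allI)
    fix ora x
    have "initial_store (input_tree x) 0 = input_tree x" by (simp add: initial_store_def)
    from P[of "initial_store (input_tree x)" x ora, OF this] show "\<exists>t s. run ora P (initial_store (input_tree x)) t (search_queries ora x) s \<and>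
      t \<le> poly p (tree_size (input_tree x)) \<and> s 0 = row_tree (rev (snd (snd (snd (snd (search ora x))))))"
      by blast
  qed
qed

section \<open>Codes with repeated columns\<close>

text \<open>On code words this does what selecting the columns \<open>f 0, ..., f (m - 1)\<close>
  does on generator matrices; see \<open>generator_matrix_pull\<close>.\<close>

definition pull :: "nat \<Rightarrow> (nat \<Rightarrow> nat) \<Rightarrow> (nat \<Rightarrow> nat) \<Rightarrow> nat \<Rightarrow> nat" where
  "pull m f x = (\<lambda>j\<in>{..<m}. x (f j))"

locale code_field =
  fixes q :: nat and F :: "nat ring" (structure)
  assumes finite_field: "finite_field q F"
begin

sublocale field F
  using finite_field by (simp add: finite_field_def)

end

lemma (in code_field) coord_space_simps:
  "carrier (coord_space F n) = {..<n} \<rightarrow>\<^sub>E carrier F"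
  "add (coord_space F n) = (\<lambda>x y. \<lambda>j\<in>{..<n}. x j \<oplus> y j)"
  "module.smult (coord_space F n) = (\<lambda>c x. \<lambda>j\<in>{..<n}. c \<otimes> x j)"
  "zero (coord_space F n) = (\<lambda>j\<in>{..<n}. \<zero>)"
  by (simp_all add: coord_space_def func_space_def)

lemma (in code_field) coord_space_vectorspace: "vectorspace F (coord_space F n)"
  unfolding vectorspace_def coord_space_def
  using func_space_is_module field_axioms by blast

lemma (in code_field) finite_coord_space: "finite (carrier (coord_space F n))"
  using finite_field by (simp add: coord_space_simps finite_field_def finite_PiE)

lemma (in code_field) pull_mod_hom:
  assumes "f ` {..<m} \<subseteq> {..<n}"
  shows "mod_hom F (coord_space F n) (coord_space F m) (pull m f)"
proof -
  have f: "f j < n" if "j < m" for j using assms that by blast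
  have "Module.module F (coord_space F k)" for k
    using coord_space_vectorspace by (simp add: vectorspace_def)
  then show ?thesis
    unfolding mod_hom_def mod_hom_axioms_def LinearCombinations.module_hom_def
    by (auto simp: coord_space_simps pull_def f intro!: restrict_ext)
qed

text \<open>Both inclusions come from minimality of a span, once because the image of a submodule is
  a submodule and once because the preimage is.\<close>

lemma (in code_field) span_mod_hom_image:
  assumes h: "mod_hom F V W h" and S: "S \<subseteq> carrier V"
  shows "LinearCombinations.module.span F W (h ` S) = h ` LinearCombinations.module.span F V S"
proof -
  interpret h: mod_hom F V W h by (rule h)
  have hS: "h ` S \<subseteq> carrier W" using S by auto
  have subV: "submodule F (h.M.span S) V" using S by (rule h.M.span_is_submodule)
  have subW: "submodule F (h.N.span (h ` S)) W" using hS by (rule h.N.span_is_submodule)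
  have inV: "h.M.span S \<subseteq> carrier V" using subV by (rule submodule.subset)
  show ?thesis
  proof
    have "submodule F (h ` h.M.span S) W"
    proof (unfold_locales)
      show "h ` h.M.span S \<subseteq> carrier W" using inV by auto
      show "\<zero>\<^bsub>W\<^esub> \<in> h ` h.M.span S"
        using imageI[OF submodule.zero_closed[OF subV], of h] by simp
      fix v w assume "v \<in> h ` h.M.span S" "w \<in> h ` h.M.span S"
      then obtain x y where xy: "x \<in> h.M.span S" "y \<in> h.M.span S" "v = h x" "w = h y" by auto
      then have "v \<oplus>\<^bsub>W\<^esub> w = h (x \<oplus>\<^bsub>V\<^esub> y)" using inV by (subst h.f_add) auto
      then show "v \<oplus>\<^bsub>W\<^esub> w \<in> h ` h.M.span S"
        using submodule.m_closed[OF subV xy(1,2)] by simp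
    next
      fix c v assume c: "c \<in> carrier F" and "v \<in> h ` h.M.span S"
      then obtain x where x: "x \<in> h.M.span S" "v = h x" by auto
      then have "c \<odot>\<^bsub>W\<^esub> v = h (c \<odot>\<^bsub>V\<^esub> x)" using inV c by (subst h.f_smult) auto
      then show "c \<odot>\<^bsub>W\<^esub> v \<in> h ` h.M.span S"
        using submodule.smult_closed[OF subV c x(1)] by simp
    qed
    then show "h.N.span (h ` S) \<subseteq> h ` h.M.span S"
      using h.M.in_own_span[OF S] by (intro h.N.span_is_subset image_mono)
  next
    let ?P = "{x \<in> carrier V. h x \<in> h.N.span (h ` S)}"
    have "submodule F ?P V"
    proof (unfold_locales)
      show "\<zero>\<^bsub>V\<^esub> \<in> ?P"
        using submodule.zero_closed[OF subW] by simp
    qed (use submodule.m_closed[OF subW] submodule.smult_closed[OF subW] in auto)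
    then have "h.M.span S \<subseteq> ?P"
      using S h.N.in_own_span[OF hS] by (intro h.M.span_is_subset) auto
    then show "h ` h.M.span S \<subseteq> h.N.span (h ` S)" by auto
  qed
qed

lemma (in code_field) generator_matrix_pull:
  assumes f: "f ` {..<m} \<subseteq> {..<n}" and G: "generator_matrix F n k G C"
    and G': "G' \<in> carrier_mat k m" "\<And>i j. i < k \<Longrightarrow> j < m \<Longrightarrow> G' $$ (i, j) = G $$ (i, f j)"
  shows "generator_matrix F m k G' (pull m f ` C)"
proof -
  have Gk: "G \<in> carrier_mat k n" "elements_mat G \<subseteq> carrier F"
    "LinearCombinations.module.span F (coord_space F n) (row_fun G ` {..<k}) = C"
    using G by (auto simp: generator_matrix_def)
  have fj: "f j < n" if "j < m" for j using f that by blast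
  have el: "G $$ (i, j) \<in> carrier F" if "i < k" "j < n" for i j
    using Gk(1,2) that by (auto simp: elements_mat_def subset_eq)
  have "elements_mat G' \<subseteq> carrier F"
    using G' fj el by (auto simp: elements_mat_def)
  moreover have "row_fun G' i = pull m f (row_fun G i)" if "i < k" for i
    using G' Gk(1) fj that by (auto simp: row_fun_def pull_def)
  then have "row_fun G' ` {..<k} = pull m f ` (row_fun G ` {..<k})"
    unfolding image_image by (rule image_cong[OF refl]) simp
  moreover have "row_fun G ` {..<k} \<subseteq> carrier (coord_space F n)"
    using el Gk(1) by (auto simp: row_fun_def coord_space_simps split: if_splits)
  ultimately show ?thesis
    using span_mod_hom_image[OF pull_mod_hom[OF f]] Gk(3) G'(1) by (simp add: generator_matrix_def)
qed

lemma (in code_field) pull_inj_on: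
  assumes f: "f ` {..<m} = {..<n}"
  shows "inj_on (pull m f) (carrier (coord_space F n))"
proof (rule inj_onI)
  fix x y assume xy: "x \<in> carrier (coord_space F n)" "y \<in> carrier (coord_space F n)" "pull m f x = pull m f y"
  show "x = y"
  proof
    fix i
    show "x i = y i"
    proof (cases "i < n")
      case True
      then obtain j where "j < m" "f j = i" using f by (metis imageE lessThan_iff)
      then show ?thesis using fun_cong[OF xy(3), of j] by (simp add: pull_def)
    next
      case False
      then show ?thesis using xy by (auto simp: coord_space_simps PiE_def extensional_def)
    qed
  qed
qed

lemma (in code_field) linear_code_subset: "linear_code F n k C \<Longrightarrow> C \<subseteq> carrier (coord_space F n)"
  unfolding linear_code_def VectorSpace.subspace_def by (auto intro: subsetD[OF submodule.subset])

text \<open>Every original coordinate occurs among the repeated ones, so a word can be recovered and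
  the dimension is kept. This is how all queries come to have dimension \<open>k\<close>.\<close>

lemma (in code_field) linear_code_pull:
  assumes f: "f ` {..<m} = {..<n}" and C: "linear_code F n k C"
  shows "linear_code F m k (pull m f ` C)"
proof -
  interpret V: vectorspace F "coord_space F n" by (rule coord_space_vectorspace)
  interpret W: vectorspace F "coord_space F m" by (rule coord_space_vectorspace)
  interpret h: mod_hom F "coord_space F n" "coord_space F m" "pull m f"
    by (rule pull_mod_hom) (use f in simp)
  have C': "VectorSpace.subspace F C (coord_space F n)" "vectorspace.dim F ((coord_space F n)\<lparr>carrier := C\<rparr>) = k"
    using C by (auto simp: linear_code_def)
  have sub: "submodule F C (coord_space F n)" using C'(1) by (simp add: VectorSpace.subspace_def)
  have CV: "C \<subseteq> carrier (coord_space F n)" by (rule linear_code_subset[OF C])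
  have "V.span C = C"
    using V.span_is_subset[OF order_refl sub] V.in_own_span[OF CV] by blast
  then have "W.span (pull m f ` C) = pull m f ` C"
    using span_mod_hom_image[OF h.mod_hom_axioms CV] by simp
  moreover have "pull m f ` C \<subseteq> carrier (coord_space F m)" using CV by auto
  ultimately have subW: "VectorSpace.subspace F (pull m f ` C) (coord_space F m)"
    using W.span_is_submodule[of "pull m f ` C"] W.vectorspace_axioms by (simp add: VectorSpace.subspace_def)
  interpret C: vectorspace F "(coord_space F n)\<lparr>carrier := C\<rparr>" by (rule V.subspace_is_vs[OF C'(1)])
  interpret D: vectorspace F "(coord_space F m)\<lparr>carrier := pull m f ` C\<rparr>" by (rule W.subspace_is_vs[OF subW])
  interpret T: linear_map F "(coord_space F n)\<lparr>carrier := C\<rparr>" "(coord_space F m)\<lparr>carrier := pull m f ` C\<rparr>" "pull m f"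
  proof unfold_locales
    show "pull m f \<in> LinearCombinations.module_hom F ((coord_space F n)\<lparr>carrier := C\<rparr>) ((coord_space F m)\<lparr>carrier := pull m f ` C\<rparr>)"
      using CV by (auto simp: LinearCombinations.module_hom_def subset_iff)
  qed
  \<comment> \<open>As the field is finite, \<open>C\<close> is a finite set, and it spans
    itself.\<close>
  have "C.fin_dim"
    unfolding C.fin_dim_def
  proof (intro exI[of _ C] conjI)
    show "finite C" using finite_subset[OF CV finite_coord_space] .
    have "C \<subseteq> C.span C" using C.in_own_span[of C] by simp
    moreover have "C.span C \<subseteq> C" using C.span_is_submodule[of C] submodule.subset by fastforce
    ultimately show "C.span C = carrier ((coord_space F n)\<lparr>carrier := C\<rparr>)" by simp
  qed simp
  then have "C.dim = D.dim"
    by (rule T.dim_eq) (use inj_on_subset[OF pull_inj_on[OF f] CV] in auto)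
  then show ?thesis using subW C'(2) by (simp add: linear_code_def)
qed

section \<open>Proportionality classes and matchings\<close>

definition (in code_field) proportional :: "(nat \<Rightarrow> nat) set \<Rightarrow> nat \<Rightarrow> nat \<Rightarrow> bool" where
  "proportional C i i' \<longleftrightarrow> (\<exists>c\<in>carrier F - {\<zero>}. \<forall>x\<in>C. x i' = c \<otimes> x i)"

text \<open>No linearity of \<open>T\<close> is needed: an isometry between two codes with repeated columns amounts to a bijection
  of the original codes that relates every coordinate of one to some coordinate of the other.\<close>

definition (in code_field) matching ::
  "nat \<Rightarrow> (nat \<Rightarrow> nat) set \<Rightarrow> (nat \<Rightarrow> nat) set \<Rightarrow> (nat \<Rightarrow> nat \<Rightarrow> bool) \<Rightarrow> bool" where
  "matching n C1 C2 R \<longleftrightarrow> (\<exists>T. bij_betw T C1 C2 \<and>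
     R = (\<lambda>i j. i < n \<and> j < n \<and> (\<exists>c\<in>carrier F - {\<zero>}. \<forall>x\<in>C1. T x j = c \<otimes> x i)) \<and>
     (\<forall>i<n. \<exists>j. R i j) \<and> (\<forall>j<n. \<exists>i. R i j))"

lemma (in code_field) nonzero_mult:
  "a \<in> carrier F - {\<zero>} \<Longrightarrow> b \<in> carrier F - {\<zero>} \<Longrightarrow> a \<otimes> b \<in> carrier F - {\<zero>}"
  using integral by auto

lemma (in code_field) nonzero_inv: "a \<in> carrier F - {\<zero>} \<Longrightarrow> inv a \<in> carrier F - {\<zero>}"
  using field_Units Units_inv_Units by auto

lemma (in code_field) inv_mult_cancel:
  assumes "a \<in> carrier F - {\<zero>}" "y \<in> carrier F"
  shows "inv a \<otimes> (a \<otimes> y) = y"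
proof -
  have "inv a \<in> carrier F" "inv a \<otimes> a = \<one>"
    using nonzero_inv[OF assms(1)] assms(1) field_Units Units_l_inv by auto
  then show ?thesis using assms by (simp add: m_assoc[symmetric])
qed

text \<open>Two scalar equations for the same coordinate can be divided by each other. On the second
  side, every word of \<open>C2\<close> is a value of \<open>T\<close>, so relations between
  coordinates of \<open>T x\<close> hold on all of \<open>C2\<close>. It follows that the classes
  are the same for every matching, which later allows two matchings to be compared.\<close>

lemma (in code_field) matching_proportional:
  assumes M: "matching n C1 C2 R" and C: "C1 \<subseteq> carrier (coord_space F n)" "C2 \<subseteq> carrier (coord_space F n)"
    and R: "R i j"
  shows "R i' j \<longleftrightarrow> i' < n \<and> proportional C1 i i'" "R i j' \<longleftrightarrow> j' < n \<and> proportional C2 j j'"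
proof -
  obtain T where T: "bij_betw T C1 C2"
    and R_eq: "\<And>i j. R i j \<longleftrightarrow> i < n \<and> j < n \<and> (\<exists>c\<in>carrier F - {\<zero>}. \<forall>x\<in>C1. T x j = c \<otimes> x i)"
    using M unfolding matching_def by blast
  obtain c where ij: "i < n" "j < n" and c: "c \<in> carrier F - {\<zero>}" "\<And>x. x \<in> C1 \<Longrightarrow> T x j = c \<otimes> x i"
    using R unfolding R_eq by blast
  have c': "inv c \<in> carrier F - {\<zero>}" "inv c \<otimes> c = \<one>"
    using nonzero_inv[OF c(1)] c(1) field_Units Units_l_inv by auto
  have x: "x k \<in> carrier F" if "x \<in> C1" "k < n" for x k
    using that C(1) by (auto simp: coord_space_simps)
  have Tx: "T x k \<in> carrier F" if "x \<in> C1" "k < n" for x k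
    using that C(2) T by (auto simp: coord_space_simps bij_betw_def)
  have xi: "x i = inv c \<otimes> T x j" if "x \<in> C1" for x
    using c(2)[OF that] inv_mult_cancel[OF c(1) x[OF that ij(1)]] by simp
  show "R i' j \<longleftrightarrow> i' < n \<and> proportional C1 i i'"
  proof
    assume "R i' j"
    then obtain d where i': "i' < n" and d: "d \<in> carrier F - {\<zero>}" "\<And>x. x \<in> C1 \<Longrightarrow> T x j = d \<otimes> x i'"
      unfolding R_eq by blast
    have d': "inv d \<in> carrier F - {\<zero>}" "inv d \<otimes> d = \<one>"
      using nonzero_inv[OF d(1)] d(1) field_Units Units_l_inv by auto
    have "x i' = (inv d \<otimes> c) \<otimes> x i" if "x \<in> C1" for x
    proof -
      have "x i' = inv d \<otimes> T x j" using d(2)[OF that] inv_mult_cancel[OF d(1) x[OF that i']] by simp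
      then show ?thesis using c(2)[OF that] c(1) d'(1) x[OF that ij(1)] by (simp add: m_assoc)
    qed
    then show "i' < n \<and> proportional C1 i i'"
      unfolding proportional_def using i' nonzero_mult[OF d'(1) c(1)] by blast
  next
    assume i': "i' < n \<and> proportional C1 i i'"
    then obtain d where d: "d \<in> carrier F - {\<zero>}" "\<And>x. x \<in> C1 \<Longrightarrow> x i' = d \<otimes> x i"
      unfolding proportional_def by blast
    have d': "inv d \<in> carrier F - {\<zero>}" "inv d \<otimes> d = \<one>"
      using nonzero_inv[OF d(1)] d(1) field_Units Units_l_inv by auto
    have "T x j = (c \<otimes> inv d) \<otimes> x i'" if "x \<in> C1" for x
    proof -
      have "inv d \<otimes> x i' = x i" using d(2)[OF that] inv_mult_cancel[OF d(1) x[OF that ij(1)]] by simp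
      then show ?thesis using c(2)[OF that] c(1) d'(1) x[OF that, of i'] i' by (simp add: m_assoc)
    qed
    then show "R i' j" unfolding R_eq using i' ij nonzero_mult[OF c(1) d'(1)] by blast
  qed
  show "R i j' \<longleftrightarrow> j' < n \<and> proportional C2 j j'"
  proof
    assume "R i j'"
    then obtain d where j': "j' < n" and d: "d \<in> carrier F - {\<zero>}" "\<And>x. x \<in> C1 \<Longrightarrow> T x j' = d \<otimes> x i"
      unfolding R_eq by blast
    have "y j' = (d \<otimes> inv c) \<otimes> y j" if y: "y \<in> C2" for y
    proof -
      obtain x where x: "x \<in> C1" "y = T x" using T y by (auto simp: bij_betw_def)
      then show ?thesis using d(1) d(2)[OF x(1)] xi[OF x(1)] c'(1) Tx[OF x(1) ij(2)] by (simp add: m_assoc)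
    qed
    then show "j' < n \<and> proportional C2 j j'"
      unfolding proportional_def using j' nonzero_mult[OF d(1) c'(1)] by blast
  next
    assume j': "j' < n \<and> proportional C2 j j'"
    then obtain d where d: "d \<in> carrier F - {\<zero>}" "\<And>y. y \<in> C2 \<Longrightarrow> y j' = d \<otimes> y j"
      unfolding proportional_def by blast
    have "T x j' = (d \<otimes> c) \<otimes> x i" if "x \<in> C1" for x
    proof -
      have "T x \<in> C2" using T that by (auto simp: bij_betw_def)
      from d(2)[OF this] show ?thesis
        using d(1) c(1) c(2)[OF that] x[OF that ij(1)] by (simp add: m_assoc)
    qed
    then show "R i j'" unfolding R_eq using j' ij nonzero_mult[OF d(1) c(1)] by blast
  qed
qed

lemma (in code_field) matching_total:
  assumes "matching n C1 C2 R"
  shows "i < n \<Longrightarrow> \<exists>j. R i j" "j < n \<Longrightarrow> \<exists>i. R i j" "R i j \<Longrightarrow> i < n \<and> j < n"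
proof -
  obtain T where R: "R = (\<lambda>i j. i < n \<and> j < n \<and> (\<exists>c\<in>carrier F - {\<zero>}. \<forall>x\<in>C1. T x j = c \<otimes> x i))"
    using assms unfolding matching_def by blast
  show "R i j \<Longrightarrow> i < n \<and> j < n" unfolding R by blast
  show "i < n \<Longrightarrow> \<exists>j. R i j" "j < n \<Longrightarrow> \<exists>i. R i j" using assms unfolding matching_def by blast+
qed

text \<open>A matching is a union of products of a class of \<open>C1\<close> with a class of
  \<open>C2\<close>, and different products have disjoint sides.\<close>

lemma (in code_field) matching_difunctional:
  assumes M: "matching n C1 C2 R" and C: "C1 \<subseteq> carrier (coord_space F n)" "C2 \<subseteq> carrier (coord_space F n)"
    and "R i j" "R i' j'"
  shows "R i' j \<longleftrightarrow> R i j'"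
proof -
  have "R i j' \<longleftrightarrow> j' < n \<and> proportional C2 j j'" by (rule matching_proportional(2)[OF M C \<open>R i j\<close>])
  moreover have "R i' j \<Longrightarrow> R i' j' \<longleftrightarrow> j' < n \<and> proportional C2 j j'" by (rule matching_proportional(2)[OF M C])
  moreover have "R i j' \<Longrightarrow> R i' j' \<longleftrightarrow> i' < n \<and> proportional C1 i i'" by (rule matching_proportional(1)[OF M C])
  moreover have "R i' j \<longleftrightarrow> i' < n \<and> proportional C1 i i'" by (rule matching_proportional(1)[OF M C \<open>R i j\<close>])
  ultimately show ?thesis using \<open>R i' j'\<close> by blast
qed

text \<open>The entries of \<open>v\<close> are the factors in the definition of
  \<open>matching\<close>. Since only \<open>R\<close> constrains \<open>\<sigma>\<close>, images
  may be permuted freely within a class.\<close>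

lemma (in code_field) matching_isometry:
  assumes M: "matching n C1 C2 R" and \<sigma>: "\<sigma> permutes {..<m}" and R: "\<And>l. l < m \<Longrightarrow> R (f l) (g (\<sigma> l))"
  shows "\<exists>v. scaling F m v \<and> isometry F m \<sigma> v ` pull m f ` C1 = pull m g ` C2"
proof -
  obtain T where T: "bij_betw T C1 C2"
    and R_eq: "\<And>i j. R i j \<longleftrightarrow> i < n \<and> j < n \<and> (\<exists>c\<in>carrier F - {\<zero>}. \<forall>x\<in>C1. T x j = c \<otimes> x i)"
    using M unfolding matching_def by blast
  have inv: "inv_into {..<m} \<sigma> (\<sigma> l) = l" if "l < m" for l
    using that permutes_inj_on[OF \<sigma>] by simp
  have surj: "\<exists>l<m. \<sigma> l = j" if "j < m" for j
    using that permutes_image[OF \<sigma>] by (metis imageE lessThan_iff)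
  have "\<exists>c\<in>carrier F - {\<zero>}. \<forall>x\<in>C1. T x (g j) = c \<otimes> x (f (inv_into {..<m} \<sigma> j))" if "j < m" for j
    using surj[OF that] R inv unfolding R_eq by metis
  then obtain v where v: "\<And>j. j < m \<Longrightarrow> v j \<in> carrier F - {\<zero>}"
    "\<And>j x. j < m \<Longrightarrow> x \<in> C1 \<Longrightarrow> T x (g j) = v j \<otimes> x (f (inv_into {..<m} \<sigma> j))"
    by metis
  have "isometry F m \<sigma> v (pull m f x) = pull m g (T x)" if "x \<in> C1" for x
  proof
    fix j
    have "inv_into {..<m} \<sigma> j < m" if "j < m" using surj[OF that] inv by metis
    then show "isometry F m \<sigma> v (pull m f x) j = pull m g (T x) j"
      using v(2)[of j x] that by (simp add: isometry_def pull_def)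
  qed
  then have "isometry F m \<sigma> v ` pull m f ` C1 = pull m g ` T ` C1"
    unfolding image_image by (rule image_cong[OF refl])
  moreover have "T ` C1 = C2" using T by (simp add: bij_betw_def)
  ultimately show ?thesis using v(1) unfolding scaling_def by (intro exI[of _ v]) simp
qed

lemma (in code_field) pull_id: "x \<in> carrier (coord_space F n) \<Longrightarrow> pull n (\<lambda>j. j) x = x"
  by (auto simp: pull_def coord_space_simps PiE_def extensional_def)

lemma (in code_field) linearly_equivalent_imp_matching:
  assumes C: "C1 \<subseteq> carrier (coord_space F n)" "C2 \<subseteq> carrier (coord_space F n)"
    and f: "f ` {..<m} = {..<n}" and g: "g ` {..<m} = {..<n}"
    and \<sigma>: "\<sigma> permutes {..<m}" and v: "scaling F m v"
    and iso: "isometry F m \<sigma> v ` pull m f ` C1 = pull m g ` C2"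
  obtains R where "matching n C1 C2 R" "\<And>l. l < m \<Longrightarrow> R (f l) (g (\<sigma> l))"
proof -
  have inj: "inj_on (pull m f) C1" "inj_on (pull m g) C2"
    using inj_on_subset[OF pull_inj_on[OF f] C(1)] inj_on_subset[OF pull_inj_on[OF g] C(2)] by auto
  have \<sigma>m: "\<sigma> l < m" if "l < m" for l using that permutes_in_image[OF \<sigma>, of l] by simp
  have surj: "\<exists>l<m. \<sigma> l = j" if "j < m" for j
    using that permutes_image[OF \<sigma>] by (metis imageE lessThan_iff)
  have fl: "f l < n" if "l < m" for l using that f by blast
  let ?I = "\<lambda>x. isometry F m \<sigma> v (pull m f x)"
  have I: "?I x (\<sigma> l) = v (\<sigma> l) \<otimes> x (f l)" if "l < m" for x l
    using isometry_apply[OF \<sigma> that] that by (simp add: pull_def)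
  have I_inj: "inj_on ?I C1"
  proof (rule inj_onI)
    fix x y assume xy: "x \<in> C1" "y \<in> C1" "?I x = ?I y"
    have "x (f l) = y (f l)" if "l < m" for l
    proof -
      have "v (\<sigma> l) \<otimes> x (f l) = v (\<sigma> l) \<otimes> y (f l)"
        using fun_cong[OF xy(3), of "\<sigma> l"] that by (simp add: I)
      moreover have "v (\<sigma> l) \<in> carrier F - {\<zero>}" using v \<sigma>m[OF that] by (simp add: scaling_def)
      moreover have "x (f l) \<in> carrier F" "y (f l) \<in> carrier F"
        using xy(1,2) C(1) fl[OF that] by (auto simp: coord_space_simps)
      ultimately show ?thesis using m_lcancel by auto
    qed
    then have "pull m f x = pull m f y" by (auto simp: pull_def)
    then show "x = y" using inj(1) xy by (auto dest: inj_onD)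
  qed
  \<comment> \<open>The isometry acts on words with repeated coordinates. Pulling back is injective
    because \<open>g\<close> reaches every coordinate, so the isometry descends to the original
    codes.\<close>
  define T where "T = the_inv_into C2 (pull m g) \<circ> ?I"
  have "bij_betw ?I C1 (pull m g ` C2)"
    using I_inj iso by (simp add: bij_betw_def image_image)
  moreover have "bij_betw (the_inv_into C2 (pull m g)) (pull m g ` C2) C2"
    using inj(2) by (intro bij_betw_the_inv_into) (simp add: bij_betw_def)
  ultimately have T: "bij_betw T C1 C2" unfolding T_def by (rule bij_betw_trans)
  have "pull m g (T x) = ?I x" if "x \<in> C1" for x
    using that iso f_the_inv_into_f[OF inj(2)] by (auto simp: T_def)
  then have Tx: "T x (g (\<sigma> l)) = v (\<sigma> l) \<otimes> x (f l)" if "x \<in> C1" "l < m" for x l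
    using I[OF that(2), of x] that \<sigma>m by (metis lessThan_iff pull_def restrict_apply)
  define R where "R = (\<lambda>i j. i < n \<and> j < n \<and> (\<exists>c\<in>carrier F - {\<zero>}. \<forall>x\<in>C1. T x j = c \<otimes> x i))"
  have R: "R (f l) (g (\<sigma> l))" if "l < m" for l
  proof -
    have "g (\<sigma> l) < n" using g \<sigma>m[OF that] by blast
    moreover have "v (\<sigma> l) \<in> carrier F - {\<zero>}" using v \<sigma>m[OF that] by (simp add: scaling_def)
    ultimately show ?thesis unfolding R_def using fl[OF that] Tx that by blast
  qed
  have "matching n C1 C2 R" unfolding matching_def
  proof (intro exI[of _ T] conjI allI impI)
    fix i assume "i < n"
    then obtain l where "l < m" "f l = i" using f by (metis imageE lessThan_iff)
    then show "\<exists>j. R i j" using R by blast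
  next
    fix j assume "j < n"
    then obtain l' where "l' < m" "g l' = j" using g by (metis imageE lessThan_iff)
    then show "\<exists>i. R i j" using R surj by metis
  qed (use T in \<open>auto simp: R_def\<close>)
  with R that show thesis by blast
qed

text \<open>An isometry moves the positions of one class bijectively to those of the related class.
  Conversely, if related classes occur equally often, the positions can be permuted so that classes
  correspond, and \<open>matching_isometry\<close> supplies the scalars.\<close>

lemma (in code_field) linearly_equivalent_pull_iff:
  assumes C: "C1 \<subseteq> carrier (coord_space F n)" "C2 \<subseteq> carrier (coord_space F n)"
    and f: "f ` {..<m} = {..<n}" and g: "g ` {..<m} = {..<n}"
  shows "linearly_equivalent F m (pull m f ` C1) (pull m g ` C2) \<longleftrightarrow>
    (\<exists>R. matching n C1 C2 R \<and> (\<forall>i j. R i j \<longrightarrow> card {l. l < m \<and> R (f l) j} = card {l. l < m \<and> R i (g l)}))"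
proof
  assume "linearly_equivalent F m (pull m f ` C1) (pull m g ` C2)"
  then obtain \<sigma> v where \<sigma>: "\<sigma> permutes {..<m}" and v: "scaling F m v"
    and iso: "isometry F m \<sigma> v ` pull m f ` C1 = pull m g ` C2"
    unfolding linearly_equivalent_def by blast
  obtain R where M: "matching n C1 C2 R" and R: "\<And>l. l < m \<Longrightarrow> R (f l) (g (\<sigma> l))"
    by (rule linearly_equivalent_imp_matching[OF C f g \<sigma> v iso]) blast
  have \<sigma>m: "\<sigma> l < m" if "l < m" for l using that permutes_in_image[OF \<sigma>, of l] by simp
  have surj: "\<exists>l<m. \<sigma> l = j" if "j < m" for j
    using that permutes_image[OF \<sigma>] by (metis imageE lessThan_iff)
  have "card {l. l < m \<and> R (f l) j} = card {l. l < m \<and> R i (g l)}" if ij: "R i j" for i j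
  proof (rule bij_betw_same_card[of \<sigma>])
    have iff: "R (f l) j \<longleftrightarrow> R i (g (\<sigma> l))" if "l < m" for l
      by (rule matching_difunctional[OF M C ij R[OF that]])
    show "bij_betw \<sigma> {l. l < m \<and> R (f l) j} {l. l < m \<and> R i (g l)}"
      unfolding bij_betw_def
    proof
      show "inj_on \<sigma> {l. l < m \<and> R (f l) j}" using permutes_inj[OF \<sigma>] by (rule inj_on_subset) simp
      show "\<sigma> ` {l. l < m \<and> R (f l) j} = {l. l < m \<and> R i (g l)}"
        using iff \<sigma>m surj by (auto simp: image_iff) metis
    qed
  qed
  with M show "\<exists>R. matching n C1 C2 R \<and> (\<forall>i j. R i j \<longrightarrow> card {l. l < m \<and> R (f l) j} = card {l. l < m \<and> R i (g l)})"
    by blast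
next
  assume "\<exists>R. matching n C1 C2 R \<and> (\<forall>i j. R i j \<longrightarrow> card {l. l < m \<and> R (f l) j} = card {l. l < m \<and> R i (g l)})"
  then obtain R where M: "matching n C1 C2 R"
    and card: "\<And>i j. R i j \<Longrightarrow> card {l. l < m \<and> R (f l) j} = card {l. l < m \<and> R i (g l)}" by blast
  note dif = matching_difunctional[OF M C]
  have fl: "f l < n" if "l < m" for l using that f by blast
  have gl: "g l < n" if "l < m" for l using that g by blast
  \<comment> \<open>Both functions name the position \<open>l\<close> by a class of
    \<open>C2\<close>: \<open>\<phi>\<close> by the class related to coordinate \<open>f l\<close>
    of \<open>C1\<close>, \<open>\<psi>\<close> by the class of coordinate
    \<open>g l\<close>.\<close>
  define \<phi> where "\<phi> l = {j. R (f l) j}" for l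
  define \<psi> where "\<psi> l = {j. \<exists>i. R i j \<and> R i (g l)}" for l
  have \<phi>_iff: "\<phi> l = {j. R i j} \<longleftrightarrow> R (f l) j" if "l < m" "R i j" for l i j
  proof
    assume "\<phi> l = {j. R i j}"
    then show "R (f l) j" using that(2) by (auto simp: \<phi>_def)
  next
    assume "R (f l) j"
    then show "\<phi> l = {j. R i j}" using dif[OF that(2)] dif[of "f l" j] that(2) by (auto simp: \<phi>_def)
  qed
  have \<psi>_eq: "\<psi> l = {j. R i j}" if "R i (g l)" for l i
    using that dif[OF that] by (auto simp: \<psi>_def)
  have \<psi>_iff: "\<psi> l = {j. R i j} \<longleftrightarrow> R i (g l)" if l: "l < m" for l i
  proof
    assume *: "\<psi> l = {j. R i j}"
    obtain i' where "R i' (g l)" using matching_total(2)[OF M gl[OF l]] by blast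
    then have "g l \<in> \<psi> l" by (auto simp: \<psi>_def)
    then show "R i (g l)" using * by blast
  qed (rule \<psi>_eq)
  \<comment> \<open>Equal multiplicities say that each class is taken equally often by
    \<open>\<phi>\<close> and \<open>\<psi>\<close>, and equality of multisets of values provides
    the permutation.\<close>
  have "image_mset \<phi> (mset_set {..<m}) = image_mset \<psi> (mset_set {..<m})"
  proof (rule multiset_eqI)
    fix X
    have cnt: "count (image_mset h (mset_set {..<m})) X = card {l. l < m \<and> h l = X}" for h :: "nat \<Rightarrow> nat set"
    proof -
      have "h -` {X} \<inter> {..<m} = {l. l < m \<and> h l = X}" by auto
      then show ?thesis by (simp add: count_image_mset)
    qed
    show "count (image_mset \<phi> (mset_set {..<m})) X = count (image_mset \<psi> (mset_set {..<m})) X"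
    proof (cases "\<exists>i j. R i j \<and> X = {j. R i j}")
      case True
      then obtain i j where "R i j" "X = {j. R i j}" by blast
      then show ?thesis
        unfolding cnt using card[OF \<open>R i j\<close>] \<phi>_iff[OF _ \<open>R i j\<close>] \<psi>_iff[of _ i]
        by (simp cong: conj_cong)
    next
      case False
      have "\<phi> l \<noteq> X" if "l < m" for l
        using False matching_total(1)[OF M fl[OF that]] by (auto simp: \<phi>_def)
      moreover have "\<psi> l \<noteq> X" if l: "l < m" for l
      proof -
        obtain i where "R i (g l)" using matching_total(2)[OF M gl[OF l]] by blast
        then show ?thesis using False \<psi>_eq by blast
      qed
      ultimately show ?thesis unfolding cnt by (simp cong: conj_cong)
    qed
  qed
  from image_mset_eq_implies_permutes[OF finite_lessThan this] obtain \<sigma> where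
    \<sigma>: "\<sigma> permutes {..<m}" "\<forall>l\<in>{..<m}. \<phi> l = \<psi> (\<sigma> l)" by blast
  have "R (f l) (g (\<sigma> l))" if "l < m" for l
  proof -
    have "\<sigma> l < m" using that permutes_in_image[OF \<sigma>(1), of l] by simp
    moreover have "\<psi> (\<sigma> l) = {j. R (f l) j}" using bspec[OF \<sigma>(2), of l] that by (simp add: \<phi>_def)
    ultimately show ?thesis by (simp add: \<psi>_iff)
  qed
  from matching_isometry[where f = f and g = g, OF M \<sigma>(1) this]
  show "linearly_equivalent F m (pull m f ` C1) (pull m g ` C2)"
    unfolding linearly_equivalent_def using \<sigma>(1) by blast
qed

section \<open>Class multiplicities\<close>

text \<open>Division with remainder by \<open>N\<close>, with remainders from \<open>1\<close> to
  \<open>N\<close> in place of \<open>0\<close> to \<open>N - 1\<close>: class sizes are positive.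
  It is applied with \<open>N = n - 1\<close>.\<close>

lemma add_mult_unique:
  fixes N a b x y :: nat
  assumes "a + N * x = b + N * y" "1 \<le> a" "a \<le> N" "1 \<le> b" "b \<le> N"
  shows "a = b \<and> x = y"
proof -
  have "(a - 1) + N * x = (b - 1) + N * y" using assms by linarith
  moreover have "a - 1 < N" "b - 1 < N" using assms by linarith+
  ultimately have "a - 1 = b - 1 \<and> x = y"
    by (metis add.commute div_less div_mult_self2 gr_implies_not0 add_left_cancel add.left_neutral)
  then show ?thesis using assms by linarith
qed

text \<open>With at most one label in a class, the label sum is \<open>0\<close> or a single label,
  so the label can be read off the sum. A label \<open>Suc t\<close> is never \<open>0\<close>, so
  absence is recognizable.\<close>

lemma sum_Suc_unique:
  assumes "\<And>t t'. t \<in> L \<Longrightarrow> t' \<in> L \<Longrightarrow> Q t \<Longrightarrow> Q t' \<Longrightarrow> t = t'"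
  obtains "\<And>t. t \<in> L \<Longrightarrow> \<not> Q t" "(\<Sum>t | t \<in> L \<and> Q t. Suc t) = 0"
  | s where "s \<in> L" "Q s" "(\<Sum>t | t \<in> L \<and> Q t. Suc t) = Suc s"
proof (cases "\<exists>s\<in>L. Q s")
  case True
  then obtain s where "s \<in> L" "Q s" by blast
  moreover from this have "{t. t \<in> L \<and> Q t} = {s}" using assms by blast
  ultimately show thesis using that(2) by simp
next
  case False
  then have "{t. t \<in> L \<and> Q t} = {}" by blast
  then have "(\<Sum>t | t \<in> L \<and> Q t. Suc t) = 0" by (simp only: sum.empty)
  with False show thesis by (intro that(1)) auto
qed

text \<open>The combinatorial content of matchings: every \<open>R\<close> with \<open>M R\<close>
  pairs the classes of \<open>E1\<close> with those of \<open>E2\<close>, and \<open>E1\<close> and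
  \<open>E2\<close> do not depend on \<open>R\<close>.\<close>

locale class_matching =
  fixes n :: nat and M :: "(nat \<Rightarrow> nat \<Rightarrow> bool) \<Rightarrow> bool" and E1 E2 :: "nat \<Rightarrow> nat \<Rightarrow> bool"
  assumes total: "M R \<Longrightarrow> i < n \<Longrightarrow> \<exists>j. R i j" "M R \<Longrightarrow> j < n \<Longrightarrow> \<exists>i. R i j"
    and dom: "M R \<Longrightarrow> R i j \<Longrightarrow> i < n \<and> j < n"
    and left: "M R \<Longrightarrow> R i j \<Longrightarrow> R i' j \<longleftrightarrow> E1 i i'"
    and right: "M R \<Longrightarrow> R i j \<Longrightarrow> R i j' \<longleftrightarrow> E2 j j'"

lemma (in class_matching) difunctional: "M R \<Longrightarrow> R i j \<Longrightarrow> R i' j' \<Longrightarrow> R i' j \<longleftrightarrow> R i j'"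
  using left right by metis

text \<open>The condition of \<open>linearly_equivalent_pull_iff\<close> without repetitions: these
  are the matchings that come from equivalences of the original codes.\<close>

definition (in class_matching) balanced :: "(nat \<Rightarrow> nat \<Rightarrow> bool) \<Rightarrow> bool" where
  "balanced R \<longleftrightarrow> (\<forall>p q. R p q \<longrightarrow> card {p'. R p' q} = card {q'. R p q'})"

lemma (in class_matching) finite_class: "M R \<Longrightarrow> finite {p'. R p' q}" "M R \<Longrightarrow> finite {q'. R p q'}"
  using dom by (auto intro!: finite_subset[of _ "{..<n}"])

text \<open>\<open>L\<close> is a system of representatives for the classes of the coordinates below
  \<open>i\<close>. One matching has to fit all images together, as images that fit different
  matchings might not extend to a common one.\<close>

definition (in class_matching) partial_matching :: "nat \<Rightarrow> nat set \<Rightarrow> (nat \<Rightarrow> nat) \<Rightarrow> bool" where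
  "partial_matching i L \<pi> \<longleftrightarrow> L \<subseteq> {..<i} \<and> inj_on \<pi> {..<i} \<and>
     (\<forall>t<i. \<exists>s\<in>L. E1 s t) \<and> (\<forall>s\<in>L. \<forall>t\<in>L. E1 s t \<longrightarrow> s = t) \<and>
     (\<exists>R. M R \<and> balanced R \<and> (\<forall>t<i. R t (\<pi> t)))"

text \<open>The multiplicity condition for the query that tries \<open>j\<close> as image of
  \<open>i\<close>: each side is the number of columns of one class in the query, with the tentative
  label \<open>Suc i\<close> written separately. \<open>oracle_iff_test\<close> makes the
  connection.\<close>

definition (in class_matching) test_equation :: "(nat \<Rightarrow> nat \<Rightarrow> bool) \<Rightarrow> nat \<Rightarrow> nat set \<Rightarrow> (nat \<Rightarrow> nat) \<Rightarrow> nat \<Rightarrow> bool" where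
  "test_equation R i L \<pi> j \<longleftrightarrow> (\<forall>p q. R p q \<longrightarrow>
     card {p'. R p' q} + (n - 1) * ((\<Sum>t | t \<in> L \<and> R t q. Suc t) + (if R i q then Suc i else 0)) =
     card {q'. R p q'} + (n - 1) * ((\<Sum>t | t \<in> L \<and> R p (\<pi> t). Suc t) + (if R p j then Suc i else 0)))"

lemma (in class_matching) test_equationI:
  assumes R: "M R" "balanced R" and \<pi>: "\<And>t. t \<in> L \<Longrightarrow> R t (\<pi> t)" and ij: "R i j"
  shows "test_equation R i L \<pi> j"
  unfolding test_equation_def
proof (intro allI impI)
  fix p q assume pq: "R p q"
  have "{t. t \<in> L \<and> R t q} = {t. t \<in> L \<and> R p (\<pi> t)}"
    using difunctional[OF R(1) pq \<pi>] by blast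
  moreover have "R i q \<longleftrightarrow> R p j" by (rule difunctional[OF R(1) pq ij])
  moreover have "card {p'. R p' q} = card {q'. R p q'}" using R(2) pq by (simp add: balanced_def)
  ultimately show "card {p'. R p' q} + (n - 1) * ((\<Sum>t | t \<in> L \<and> R t q. Suc t) + (if R i q then Suc i else 0)) =
     card {q'. R p q'} + (n - 1) * ((\<Sum>t | t \<in> L \<and> R p (\<pi> t). Suc t) + (if R p j then Suc i else 0))"
    by simp
qed

text \<open>Class sizes lie between \<open>1\<close> and \<open>n - 1\<close> unless there is a single class, so a class weight
  determines both the size of the class and the sum of the labels in it.\<close>

lemma (in class_matching) test_equationD:
  assumes P: "partial_matching i L \<pi>" and R: "M R" and test: "test_equation R i L \<pi> j"
    and ij: "i < n" "j < n"
  shows "balanced R \<and> R i j \<and> (\<forall>t<i. R t (\<pi> t))"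
proof -
  obtain R0 where R0: "M R0" and R0\<pi>: "\<And>t. t < i \<Longrightarrow> R0 t (\<pi> t)"
    using P by (auto simp: partial_matching_def)
  have L: "t < i" if "t \<in> L" for t using P that by (auto simp: partial_matching_def)
  have L_unique: "s = t" if "s \<in> L" "t \<in> L" "E1 s t" for s t using P that by (simp add: partial_matching_def)
  have \<pi>n: "\<pi> t < n" if "t < i" for t using dom[OF R0 R0\<pi>[OF that]] by simp
  show ?thesis
  proof (cases "\<forall>p q. p < n \<longrightarrow> q < n \<longrightarrow> R p q")
    \<comment> \<open>With a single class \<open>R\<close> relates all pairs of coordinates, so the
      claims hold without any decoding.\<close>
    case True
    then have "R p q \<longleftrightarrow> p < n \<and> q < n" for p q using dom[OF R] by blast
    then show ?thesis using ij \<pi>n by (auto simp: balanced_def)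
  next
    case False
    then obtain p0 q0 where p0q0: "p0 < n" "q0 < n" "\<not> R p0 q0" by blast
    \<comment> \<open>Were some \<open>q\<close> related to all coordinates, it would be related to
      \<open>p0\<close> and to the partner \<open>p1\<close> of \<open>q0\<close>, and
      difunctionality would relate \<open>p0\<close> to \<open>q0\<close>. The partner
      \<open>q1\<close> serves the other side. So no class has all \<open>n\<close>
      elements.\<close>
    obtain p1 q1 where p1: "R p0 q1" and q1: "R p1 q0"
      using total[OF R] p0q0(1,2) by metis
    have sizeA: "1 \<le> card {p'. R p' q} \<and> card {p'. R p' q} \<le> n - 1" if pq: "R p q" for p q
    proof -
      have "{p'. R p' q} \<noteq> {..<n}"
      proof
        assume "{p'. R p' q} = {..<n}"
        moreover have "p1 < n" using dom[OF R q1] by simp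
        ultimately have "R p0 q" "R p1 q" using p0q0(1) by blast+
        then show False using difunctional[OF R, of p0 q p1 q0] q1 p0q0(3) by blast
      qed
      then have "{p'. R p' q} \<subset> {..<n}" using dom[OF R] by blast
      then have "card {p'. R p' q} < n" using psubset_card_mono[of "{..<n}"] by simp
      moreover have "card {p'. R p' q} > 0" using pq finite_class(1)[OF R] by (auto simp: card_gt_0_iff)
      ultimately show ?thesis by linarith
    qed
    have sizeB: "1 \<le> card {q'. R p q'} \<and> card {q'. R p q'} \<le> n - 1" if pq: "R p q" for p q
    proof -
      have "{q'. R p q'} \<noteq> {..<n}"
      proof
        assume "{q'. R p q'} = {..<n}"
        moreover have "q1 < n" using dom[OF R p1] by simp
        ultimately have "R p q0" "R p q1" using p0q0(2) by blast+
        then show False using difunctional[OF R, of p q0 p0 q1] p1 p0q0(3) by blast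
      qed
      then have "{q'. R p q'} \<subset> {..<n}" using dom[OF R] by blast
      then have "card {q'. R p q'} < n" using psubset_card_mono[of "{..<n}"] by simp
      moreover have "card {q'. R p q'} > 0" using pq finite_class(2)[OF R] by (auto simp: card_gt_0_iff)
      ultimately show ?thesis by linarith
    qed
    have dec: "card {p'. R p' q} = card {q'. R p q'} \<and>
        (\<Sum>t | t \<in> L \<and> R t q. Suc t) + (if R i q then Suc i else 0) =
        (\<Sum>t | t \<in> L \<and> R p (\<pi> t). Suc t) + (if R p j then Suc i else 0)" if pq: "R p q" for p q
      using test[unfolded test_equation_def, rule_format, OF pq] sizeA[OF pq] sizeB[OF pq]
      by (intro add_mult_unique) auto
    \<comment> \<open>\<open>R\<close> is not yet known to fit \<open>\<pi>\<close>, but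
      \<open>R0\<close> is. Lying in one class of the second code does not depend on the matching,
      so \<open>R0\<close> carries this back to \<open>s\<close> and \<open>t\<close>.\<close>
    have unique_right: "s = t" if "s \<in> L" "t \<in> L" "R p (\<pi> s)" "R p (\<pi> t)" for p s t
    proof -
      have "E2 (\<pi> s) (\<pi> t)" using right[OF R that(3)] that(4) by simp
      then have "R0 s (\<pi> t)" using right[OF R0 R0\<pi>[OF L[OF that(1)]]] by simp
      moreover have "R0 t (\<pi> t)" using R0\<pi>[OF L[OF that(2)]] .
      ultimately have "E1 s t" using left[OF R0] by blast
      then show ?thesis using L_unique that by blast
    qed
    have unique_left: "s = t" if "s \<in> L" "t \<in> L" "R s q" "R t q" for q s t
      using left[OF R that(3)] that L_unique by blast
    \<comment> \<open>Otherwise the label \<open>Suc i\<close> in the class of \<open>i\<close>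
      would have to be matched by at most one earlier label on the other side, and those are at most
      \<open>i\<close>.\<close>
    have Rij: "R i j"
    proof (rule ccontr)
      assume "\<not> R i j"
      moreover obtain q where q: "R i q" using total(1)[OF R ij(1)] by blast
      ultimately have "Suc i \<le> (\<Sum>t | t \<in> L \<and> R i (\<pi> t). Suc t)" using dec[OF q] by simp
      moreover have "(\<Sum>t | t \<in> L \<and> R i (\<pi> t). Suc t) \<le> i"
        by (rule sum_Suc_unique[of L "\<lambda>t. R i (\<pi> t)"]) (use unique_right L in \<open>auto simp: Suc_le_eq\<close>)
      ultimately show False by simp
    qed
    have \<pi>L: "R t (\<pi> t)" if t: "t \<in> L" for t
    proof -
      obtain q where q: "R t q" using total(1)[OF R] L[OF t] ij(1) by (meson order.strict_trans)
      \<comment> \<open>Once \<open>i\<close> is known to be related to \<open>j\<close>, the new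
        label occurs on both sides or on neither, and it cancels.\<close>
      have "R i q \<longleftrightarrow> R t j" by (rule difunctional[OF R q Rij])
      then have eq: "(\<Sum>s | s \<in> L \<and> R s q. Suc s) = (\<Sum>s | s \<in> L \<and> R t (\<pi> s). Suc s)"
        using dec[OF q] by simp
      have "{s. s \<in> L \<and> R s q} = {t}" using unique_left q t by blast
      then have "(\<Sum>s | s \<in> L \<and> R t (\<pi> s). Suc s) = Suc t" using eq by simp
      then show ?thesis
        by (rule_tac sum_Suc_unique[of L "\<lambda>s. R t (\<pi> s)"]) (use unique_right in auto)
    qed
    \<comment> \<open>An unlabelled \<open>t\<close> follows its representative \<open>s\<close>; by
      \<open>R0\<close>, the images of \<open>s\<close> and \<open>t\<close> lie in one
      class.\<close>
    have "R t (\<pi> t)" if t: "t < i" for t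
    proof -
      obtain s where s: "s \<in> L" "E1 s t" using P t by (auto simp: partial_matching_def)
      have "R0 t (\<pi> s)" using left[OF R0 R0\<pi>[OF L[OF s(1)]]] s(2) by simp
      then have "E2 (\<pi> s) (\<pi> t)" using right[OF R0] R0\<pi>[OF t] by blast
      moreover have "R t (\<pi> s)" using left[OF R \<pi>L[OF s(1)]] s(2) by simp
      ultimately show ?thesis using right[OF R] by blast
    qed
    then show ?thesis using Rij dec by (auto simp: balanced_def)
  qed
qed

text \<open>Used images in the class related to \<open>i\<close> belong to coordinates below
  \<open>i\<close> in the class of \<open>i\<close>. These leave out \<open>i\<close> itself, and
  the two classes have equal size.\<close>

lemma (in class_matching) exists_unused:
  assumes R: "M R" "balanced R" and \<pi>: "\<And>t. t < i \<Longrightarrow> R t (\<pi> t)" "inj_on \<pi> {..<i}" and i: "i < n"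
  shows "\<exists>j. R i j \<and> j \<notin> \<pi> ` {..<i}"
proof (rule ccontr)
  assume none: "\<nexists>j. R i j \<and> j \<notin> \<pi> ` {..<i}"
  obtain j0 where j0: "R i j0" using total(1)[OF R(1) i] by blast
  have "{j. R i j} \<subseteq> \<pi> ` {t. t < i \<and> R t j0}"
  proof
    fix j assume "j \<in> {j. R i j}"
    then obtain t where t: "t < i" "j = \<pi> t" "R i j" using none by blast
    then have "R t j0" using difunctional[OF R(1) j0 \<pi>(1)[OF t(1)]] by simp
    then show "j \<in> \<pi> ` {t. t < i \<and> R t j0}" using t by blast
  qed
  then have "card {j. R i j} \<le> card (\<pi> ` {t. t < i \<and> R t j0})" by (rule card_mono[rotated]) simp
  also have "\<dots> \<le> card {t. t < i \<and> R t j0}" by (rule card_image_le) simp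
  also have "\<dots> < card {t. R t j0}"
    using j0 by (intro psubset_card_mono finite_class(1)[OF R(1)]) auto
  also have "\<dots> = card {j. R i j}" using R(2) j0 by (simp add: balanced_def)
  finally show False by simp
qed

definition (in class_matching) test :: "nat \<Rightarrow> nat set \<Rightarrow> (nat \<Rightarrow> nat) \<Rightarrow> nat \<Rightarrow> bool" where
  "test i L \<pi> j \<longleftrightarrow> (\<exists>R. M R \<and> test_equation R i L \<pi> j)"

text \<open>Acceptance yields a matching that relates \<open>\<pi> t\<close> to both
  \<open>t\<close> and \<open>i\<close>, which puts them into one class. Conversely, the matching of
  the invariant passes the test.\<close>

lemma (in class_matching) test_used_iff:
  assumes P: "partial_matching i L \<pi>" and i: "i < n" and t: "t \<in> L"
  shows "test i L \<pi> (\<pi> t) \<longleftrightarrow> E1 t i"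
proof -
  obtain R0 where R0: "M R0" "balanced R0" and R0\<pi>: "\<And>t. t < i \<Longrightarrow> R0 t (\<pi> t)"
    using P by (auto simp: partial_matching_def)
  have L: "t < i" if "t \<in> L" for t using P that by (auto simp: partial_matching_def)
  have \<pi>t: "R0 t (\<pi> t)" by (rule R0\<pi>[OF L[OF t]])
  show ?thesis
  proof
    assume "test i L \<pi> (\<pi> t)"
    then obtain R where R: "M R" "test_equation R i L \<pi> (\<pi> t)" by (auto simp: test_def)
    from test_equationD[OF P R i] dom[OF R0(1) \<pi>t] L[OF t] left[OF R(1)] show "E1 t i" by blast
  next
    assume "E1 t i"
    then have "R0 i (\<pi> t)" using left[OF R0(1) \<pi>t] by simp
    then show "test i L \<pi> (\<pi> t)"
      unfolding test_def using test_equationI[OF R0 R0\<pi>[OF L]] R0(1) by blast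
  qed
qed

text \<open>The matching behind the positive answer becomes the new witness of the invariant: by
  \<open>test_equationD\<close> it fits all earlier images as well.\<close>

lemma (in class_matching) test_extend:
  assumes P: "partial_matching i L \<pi>" and ij: "i < n" "j < n" and test: "test i L \<pi> j"
    and j: "j \<notin> \<pi> ` {..<i}" and L': "L' = (if \<exists>t\<in>L. E1 t i then L else insert i L)"
  shows "partial_matching (Suc i) L' (\<pi>(i := j))"
proof -
  obtain R where R: "M R" "test_equation R i L \<pi> j" using test by (auto simp: test_def)
  note D = test_equationD[OF P R ij]
  have L: "L \<subseteq> {..<i}" and inj: "inj_on \<pi> {..<i}" and cover: "\<forall>t<i. \<exists>s\<in>L. E1 s t"
    and unique: "\<forall>s\<in>L. \<forall>t\<in>L. E1 s t \<longrightarrow> s = t" using P by (auto simp: partial_matching_def)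
  have E1_refl: "E1 i i" using left[OF R(1)] D by blast
  have E1_sym: "E1 t i" if "t < i" "E1 i t" for t
    using that left[OF R(1)] D by blast
  have "inj_on (\<pi>(i := j)) {..<Suc i}"
    using inj j by (auto simp: lessThan_Suc inj_on_def)
  moreover have "\<forall>t<Suc i. \<exists>s\<in>L'. E1 s t"
    using cover E1_refl by (auto simp: less_Suc_eq L')
  moreover have "\<forall>s\<in>L'. \<forall>t\<in>L'. E1 s t \<longrightarrow> s = t"
    using unique E1_sym L by (auto simp: L' subset_eq)
  moreover have "L' \<subseteq> {..<Suc i}" using L by (auto simp: L')
  moreover have "\<forall>t<Suc i. R t ((\<pi>(i := j)) t)" using D by (auto simp: less_Suc_eq)
  ultimately show ?thesis unfolding partial_matching_def using R(1) D by blast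
qed

lemma (in class_matching) test_exists:
  assumes P: "partial_matching i L \<pi>" and i: "i < n"
  shows "\<exists>j<n. j \<notin> \<pi> ` {..<i} \<and> test i L \<pi> j"
proof -
  obtain R0 where R0: "M R0" "balanced R0" and R0\<pi>: "\<And>t. t < i \<Longrightarrow> R0 t (\<pi> t)"
    using P by (auto simp: partial_matching_def)
  have inj: "inj_on \<pi> {..<i}" and L: "\<And>t. t \<in> L \<Longrightarrow> t < i" using P by (auto simp: partial_matching_def)
  obtain j where "R0 i j" "j \<notin> \<pi> ` {..<i}" using exists_unused[OF R0 R0\<pi> inj i] by blast
  then show ?thesis
    unfolding test_def using test_equationI[OF R0 R0\<pi>[OF L]] R0(1) dom[OF R0(1)] by blast
qed

section \<open>Correctness of the search\<close>

definition column :: "nat \<Rightarrow> nat mat \<Rightarrow> nat \<Rightarrow> nat list" where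
  "column k G j = map (\<lambda>r. G $$ (r, j)) [0..<k]"

definition select_rows :: "nat \<Rightarrow> nat mat \<Rightarrow> nat list \<Rightarrow> nat list list" where
  "select_rows k G f = map (\<lambda>r. map (\<lambda>j. G $$ (r, j)) f) [0..<k]"

text \<open>The indices in \<open>f\<close> may repeat; on codes this is \<open>pull\<close> along
  \<open>(!) f\<close>, as \<open>selected_codes\<close> shows.\<close>

definition select_columns :: "nat \<Rightarrow> nat mat \<Rightarrow> nat list \<Rightarrow> nat mat" where
  "select_columns k G f = mat k (length f) (\<lambda>(r, l). G $$ (r, f ! l))"

lemma mat_to_list_select_columns: "mat_to_list (select_columns k G f) = select_rows k G f"
  by (auto simp: mat_to_list_def select_columns_def select_rows_def intro!: nth_equalityI)

lemma mat_to_list_eq_select_rows: "G \<in> carrier_mat k n \<Longrightarrow> mat_to_list G = select_rows k G [0..<n]"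
  by (auto simp: mat_to_list_def select_rows_def)

lemma append_copies_select_rows:
  "append_copies u (column k G i) (select_rows k G f) = select_rows k G (replicate (length u) i @ f)"
  by (auto simp: append_copies_def column_def select_rows_def zip_default_eq_zip map_replicate_const intro!: nth_equalityI)

lemma zip_column_columns: "zip (map (\<lambda>j. h j) [0..<n]) (map (\<lambda>j. c j) [0..<n]) = map (\<lambda>j. (h j, c j)) [0..<n]"
  by (auto intro!: nth_equalityI)

lemma columns_select_rows:
  assumes "0 < k"
  shows "columns (select_rows k G [0..<n]) = map (column k G) [0..<n]"
proof -
  let ?row = "\<lambda>r. map (\<lambda>j. G $$ (r, j)) [0..<n]"
  have "foldl (\<lambda>cs r. map (\<lambda>(x, c). x # c) (zip_default [] r cs)) (map c [0..<n]) (map ?row rs)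
      = map (\<lambda>j. rev (map (\<lambda>r. G $$ (r, j)) rs) @ c j) [0..<n]" for rs c
  proof (induction rs arbitrary: c)
    case (Cons r rs)
    have "map (\<lambda>(x, c). x # c) (zip_default [] (?row r) (map c [0..<n])) = map (\<lambda>j. G $$ (r, j) # c j) [0..<n]"
      by (simp add: zip_default_eq_zip zip_column_columns)
    then show ?case using Cons[of "\<lambda>j. G $$ (r, j) # c j"] by simp
  qed simp
  from this[of "\<lambda>_. []" "rev [0..<k]"]
  have "foldl (\<lambda>cs r. map (\<lambda>(x, c). x # c) (zip_default [] r cs)) (map (\<lambda>_. []) [0..<n]) (map ?row (rev [0..<k]))
      = map (column k G) [0..<n]"
    by (simp add: column_def rev_map)
  moreover have "hd_default [] (select_rows k G [0..<n]) = ?row 0"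
    using assms by (simp add: select_rows_def upt_conv_Cons)
  ultimately show ?thesis
    by (simp add: columns_def select_rows_def rev_map comp_def)
qed

lemma multiples_eq: "multiples N C = map (\<lambda>i. (C ! i, replicate (Suc i * length N) ())) [0..<length C]"
proof -
  have unit: "u = replicate (length u) ()" for u :: "unit list"
    by (simp add: replicate_length_same)
  have "foldl (\<lambda>s c. (N @ fst s, (c, N @ fst s) # snd s)) ([], []) C =
      (replicate (length C * length N) (), rev (map (\<lambda>i. (C ! i, replicate (Suc i * length N) ())) [0..<length C]))" for C :: "'a list"
  proof (induction C rule: rev_induct)
    case (snoc c C)
    have "N @ replicate (length C * length N) () = replicate (Suc (length C) * length N) ()"
      by (subst unit[of N]) (simp add: replicate_add)
    then show ?case using snoc by (simp add: nth_append)
  qed simp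
  then show ?thesis by (simp add: multiples_def)
qed

lemma schedule_select_rows:
  assumes "0 < k"
  shows "schedule (select_rows k G [0..<n]) =
    map (\<lambda>i. (column k G i, replicate (Suc i * (n - 1)) ())) [0..<n]"
proof -
  have "hd_default [] (select_rows k G [0..<n]) = map (\<lambda>j. G $$ (0, j)) [0..<n]"
    using assms by (simp add: select_rows_def upt_conv_Cons)
  then show ?thesis
    by (simp add: schedule_def columns_select_rows[OF assms] multiples_eq)
qed

lemma initial_state_select_rows:
  assumes "0 < k"
  shows "initial_state (q, select_rows k G1 [0..<n], select_rows k G2 [0..<n], ()) =
    (select_rows k G1 [0..<n], select_rows k G2 [0..<n], [], map (\<lambda>j. (column k G2 j, j)) [0..<n], [])"
proof -
  have "zip (map (column k G2) [0..<n]) [0..<n] = map (\<lambda>j. (column k G2 j, j)) [0..<n]"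
    using zip_column_columns[of "column k G2" n "\<lambda>j. j"] by simp
  then show ?thesis
    by (simp add: initial_state_def columns_select_rows[OF assms] zip_default_eq_zip)
qed

lemma query_select_rows:
  "query (q, select_rows k G1 f, select_rows k G2 g, u) (column k G2 j) =
    instance_tree q (select_columns k G1 f) (select_columns k G2 (replicate (length u) j @ g))"
  by (simp add: query_def append_copies_select_rows instance_tree_eq mat_to_list_select_columns)

lemma pick_exists:
  assumes "distinct l" "a \<in> set l" "p a"
  obtains b l' where "pick d (map (\<lambda>a. (p a, a)) l) = ((True, b), l')" "b \<in> set l" "p b"
    "set l' = set l - {b}" "distinct l'"
proof -
  let ?l = "map (\<lambda>a. (p a, a)) l"
  have l: "map snd ?l = l" by (simp add: comp_def)
  show thesis
  proof (rule pick_cases[of ?l d])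
    assume "\<And>x. x \<in> set ?l \<Longrightarrow> \<not> fst x"
    then show thesis using assms(2,3) by force
  next
    fix xs a' ys
    assume *: "?l = xs @ a' # ys" "fst a'" "pick d ?l = ((True, snd a'), rev (map snd ys) @ rev (map snd xs))"
    have split: "l = map snd xs @ snd a' # map snd ys" using *(1) l by (metis map_append list.simps(9))
    have "a' \<in> set ?l" using *(1) by simp
    then have "p (snd a')" using *(2) by auto
    then show thesis using that[OF *(3)] assms(1) split by auto
  qed
qed

section \<open>The queries, their answers and the invariant of the search\<close>

locale lce_search = code_field +
  fixes n k :: nat and C1 C2 :: "(nat \<Rightarrow> nat) set" and G1 G2 :: "nat mat" and ora :: "tree \<Rightarrow> bool"
  assumes C1: "linear_code F n k C1" and G1: "generator_matrix F n k G1 C1"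
    and C2: "linear_code F n k C2" and G2: "generator_matrix F n k G2 C2"
    and pos: "0 < n" "0 < k" and ora: "LCE_oracle q F ora"

text \<open>The bound \<open>i' < n\<close> belongs to the classes because all code words agree on
  the arguments from \<open>n\<close> on, where they are \<open>undefined\<close>.\<close>

sublocale lce_search \<subseteq> class_matching n "matching n C1 C2"
  "\<lambda>i i'. i' < n \<and> proportional C1 i i'" "\<lambda>j j'. j' < n \<and> proportional C2 j j'"
proof
  note C = linear_code_subset[OF C1] linear_code_subset[OF C2]
  fix R assume M: "matching n C1 C2 R"
  show "i < n \<Longrightarrow> \<exists>j. R i j" "j < n \<Longrightarrow> \<exists>i. R i j" "R i j \<Longrightarrow> i < n \<and> j < n" for i j
    using matching_total[OF M] by blast+
  show "R i j \<Longrightarrow> R i' j \<longleftrightarrow> i' < n \<and> proportional C1 i i'" for i j i' by (rule matching_proportional(1)[OF M C])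
  show "R i j \<Longrightarrow> R i j' \<longleftrightarrow> j' < n \<and> proportional C2 j j'" for i j j' by (rule matching_proportional(2)[OF M C])
qed

lemma image_nth_lessThan: "(!) f ` {..<length f} = set f"
  by (auto simp: set_conv_nth)

lemma (in lce_search) selected_codes:
  assumes "set f = {..<n}" "set g = {..<n}" "length f = length g"
  shows "linear_code F (length f) k (pull (length f) ((!) f) ` C1)"
    "generator_matrix F (length f) k (select_columns k G1 f) (pull (length f) ((!) f) ` C1)"
    "linear_code F (length f) k (pull (length f) ((!) g) ` C2)"
    "generator_matrix F (length f) k (select_columns k G2 g) (pull (length f) ((!) g) ` C2)"
proof -
  have f: "(!) f ` {..<length f} = {..<n}" and g: "(!) g ` {..<length f} = {..<n}"
    using assms image_nth_lessThan[of f] image_nth_lessThan[of g] by auto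
  show "linear_code F (length f) k (pull (length f) ((!) f) ` C1)" by (rule linear_code_pull[OF f C1])
  show "linear_code F (length f) k (pull (length f) ((!) g) ` C2)" by (rule linear_code_pull[OF g C2])
  show "generator_matrix F (length f) k (select_columns k G1 f) (pull (length f) ((!) f) ` C1)"
    by (rule generator_matrix_pull[OF _ G1]) (use f in \<open>auto simp: select_columns_def\<close>)
  show "generator_matrix F (length f) k (select_columns k G2 g) (pull (length f) ((!) g) ` C2)"
    by (rule generator_matrix_pull[OF _ G2]) (use g assms in \<open>auto simp: select_columns_def\<close>)
qed

lemma (in lce_search) LCE_query_select:
  assumes "set f = {..<n}" "set g = {..<n}" "length f = length g"
  shows "LCE_query q F (length f) k (instance_tree q (select_columns k G1 f) (select_columns k G2 g))"
  unfolding LCE_query_def using selected_codes[OF assms] by blast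

lemma (in lce_search) oracle_select:
  assumes "set f = {..<n}" "set g = {..<n}" "length f = length g"
  shows "ora (instance_tree q (select_columns k G1 f) (select_columns k G2 g)) \<longleftrightarrow>
    (\<exists>R. matching n C1 C2 R \<and>
      (\<forall>i j. R i j \<longrightarrow> length (filter (\<lambda>t. R t j) f) = length (filter (R i) g)))"
proof -
  have f: "(!) f ` {..<length f} = {..<n}" and g: "(!) g ` {..<length f} = {..<n}"
    using assms image_nth_lessThan[of f] image_nth_lessThan[of g] by auto
  have "ora (instance_tree q (select_columns k G1 f) (select_columns k G2 g)) \<longleftrightarrow>
      linearly_equivalent F (length f) (pull (length f) ((!) f) ` C1) (pull (length f) ((!) g) ` C2)"
    using ora selected_codes[OF assms] unfolding LCE_oracle_def by blast
  then show ?thesis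
    unfolding linearly_equivalent_pull_iff[OF linear_code_subset[OF C1] linear_code_subset[OF C2] f g]
    by (simp add: length_filter_conv_card assms(3))
qed

text \<open>\<open>f\<close> lists every index below \<open>n\<close>, and \<open>\<pi> t\<close> for \<open>t \<in> L\<close> another \<open>(n - 1) * (t + 1)\<close> times.\<close>

definition (in lce_search) labelled :: "nat list \<Rightarrow> nat set \<Rightarrow> (nat \<Rightarrow> nat) \<Rightarrow> bool" where
  "labelled f L \<pi> \<longleftrightarrow> set f = {..<n} \<and>
     (\<forall>P. length (filter P f) = card {t. t < n \<and> P t} + (n - 1) * (\<Sum>t | t \<in> L \<and> P (\<pi> t). Suc t))"

lemma (in lce_search) labelled_insert:
  assumes f: "labelled f L \<pi>" and L: "L \<subseteq> {..<i}" and j: "j < n"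
  shows "labelled (replicate (Suc i * (n - 1)) j @ f) (insert i L) (\<pi>(i := j))"
  unfolding labelled_def
proof (intro conjI allI)
  show "set (replicate (Suc i * (n - 1)) j @ f) = {..<n}"
    using f j by (auto simp: labelled_def set_replicate_conv_if)
  fix P
  have fin: "finite {t. t \<in> L \<and> P (\<pi> t)}" using L by (auto intro: finite_subset[of _ "{..<i}"])
  have i: "i \<notin> L" using L by auto
  have "{t. t \<in> insert i L \<and> P ((\<pi>(i := j)) t)} =
      (if P j then insert i {t. t \<in> L \<and> P (\<pi> t)} else {t. t \<in> L \<and> P (\<pi> t)})"
    using i by auto
  then have "(\<Sum>t | t \<in> insert i L \<and> P ((\<pi>(i := j)) t). Suc t) =
      (\<Sum>t | t \<in> L \<and> P (\<pi> t). Suc t) + (if P j then Suc i else 0)"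
    using fin i by simp
  moreover have "length (filter P f) = card {t. t < n \<and> P t} + (n - 1) * (\<Sum>t | t \<in> L \<and> P (\<pi> t). Suc t)"
    using f by (simp add: labelled_def)
  ultimately show "length (filter P (replicate (Suc i * (n - 1)) j @ f)) =
      card {t. t < n \<and> P t} + (n - 1) * (\<Sum>t | t \<in> insert i L \<and> P ((\<pi>(i := j)) t). Suc t)"
    by (simp add: algebra_simps)
qed

lemma (in lce_search) labelled_length:
  assumes "labelled f L \<pi>"
  shows "length f = n + (n - 1) * (\<Sum>t\<in>L. Suc t)"
  using assms[unfolded labelled_def, THEN conjunct2, rule_format, of "\<lambda>_. True"] by simp

text \<open>Counting the columns of one class in the two index lists turns the multiplicity
  condition of \<open>oracle_select\<close> into \<open>test_equation\<close>.\<close>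

lemma (in lce_search) oracle_iff_test:
  assumes f: "labelled f L (\<lambda>t. t)" and g: "labelled g L \<pi>" and L: "L \<subseteq> {..<i}" and ij: "i < n" "j < n"
  shows "ora (instance_tree q (select_columns k G1 (replicate (Suc i * (n - 1)) i @ f))
     (select_columns k G2 (replicate (Suc i * (n - 1)) j @ g))) \<longleftrightarrow> test i L \<pi> j"
proof -
  let ?f = "replicate (Suc i * (n - 1)) i @ f" and ?g = "replicate (Suc i * (n - 1)) j @ g"
  have "(\<lambda>t. t)(i := i) = (\<lambda>t. t)" by auto
  then have f': "labelled ?f (insert i L) (\<lambda>t. t)" using labelled_insert[OF f L ij(1)] by (simp only:)
  have g': "labelled ?g (insert i L) (\<pi>(i := j))" by (rule labelled_insert[OF g L ij(2)])
  have "(\<forall>p q. R p q \<longrightarrow> length (filter (\<lambda>t. R t q) ?f) = length (filter (R p) ?g)) \<longleftrightarrow> test_equation R i L \<pi> j"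
    if R: "matching n C1 C2 R" for R
  proof -
    have c1: "{t. t < n \<and> R t q} = {t. R t q}" and c2: "{t. t < n \<and> R p t} = {t. R p t}" for p q
      using dom[OF R] by auto
    have 1: "length (filter (\<lambda>t. R t q) ?f) = card {p'. R p' q} +
        (n - 1) * ((\<Sum>t | t \<in> L \<and> R t q. Suc t) + (if R i q then Suc i else 0))" for q
      using f[unfolded labelled_def, THEN conjunct2, rule_format, of "\<lambda>t. R t q"]
      by (simp add: c1 algebra_simps)
    have 2: "length (filter (R p) ?g) = card {q'. R p q'} +
        (n - 1) * ((\<Sum>t | t \<in> L \<and> R p (\<pi> t). Suc t) + (if R p j then Suc i else 0))" for p
      using g[unfolded labelled_def, THEN conjunct2, rule_format, of "R p"]
      by (simp add: c2 algebra_simps)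
    show ?thesis unfolding test_equation_def 1 2 ..
  qed
  moreover have "ora (instance_tree q (select_columns k G1 ?f) (select_columns k G2 ?g)) \<longleftrightarrow>
      (\<exists>R. matching n C1 C2 R \<and> (\<forall>p q. R p q \<longrightarrow> length (filter (\<lambda>t. R t q) ?f) = length (filter (R p) ?g)))"
    by (rule oracle_select) (use f' g' labelled_length[OF f'] labelled_length[OF g'] in \<open>auto simp only: labelled_def\<close>)
  ultimately show ?thesis unfolding test_def by blast
qed

text \<open>The labels sum to at most \<open>n * (n + 1) / 2\<close>. After doubling, the
  \<open>n\<close> original columns contribute \<open>2 * n\<close>, and this is at most
  \<open>n * (n + 1)\<close> because \<open>n\<close> is positive.\<close>

lemma (in lce_search) labelled_length_le:
  assumes f: "labelled f L \<pi>" and L: "L \<subseteq> {..<n}"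
  shows "length f \<le> n ^ 2 * (n + 1) div 2"
proof -
  have "(\<Sum>t\<in>L. Suc t) \<le> (\<Sum>t<n. Suc t)" using L by (intro sum_mono2) auto
  moreover have "2 * (\<Sum>t<m. Suc t) = m * (m + 1)" for m by (induction m) auto
  ultimately have "2 * (\<Sum>t\<in>L. Suc t) \<le> n * (n + 1)" by (metis mult_le_mono2)
  then have "(n - 1) * (2 * (\<Sum>t\<in>L. Suc t)) \<le> (n - 1) * (n * (n + 1))" by (rule mult_le_mono2)
  then have "2 * length f \<le> 2 * n + (n - 1) * (n * (n + 1))"
    unfolding labelled_length[OF f] by (simp only: add_mult_distrib2 mult.left_commute)
  also have "\<dots> \<le> n ^ 2 * (n + 1)"
    using pos(1) by (cases n) (auto simp: power2_eq_square algebra_simps)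
  finally show ?thesis by linarith
qed

lemma (in lce_search) labelled_cong:
  "labelled f L \<pi> \<Longrightarrow> (\<And>t. t \<in> L \<Longrightarrow> \<pi> t = \<pi>' t) \<Longrightarrow> labelled f L \<pi>'"
  by (simp add: labelled_def cong: conj_cong)

text \<open>The set of \<open>labs\<close> matters for the answers and its length for the number of
  queries. In \<open>R\<close> the positions tell equal columns apart. The first index list is
  labelled by the coordinates themselves, the second by their images.\<close>

definition (in lce_search) stage_invariant :: "nat \<Rightarrow> search_state \<Rightarrow> bool" where
  "stage_invariant i s \<longleftrightarrow> (\<exists>f g L \<pi> labs R.
     s = (select_rows k G1 f, select_rows k G2 g, labs, R, rev (map \<pi> [0..<i])) \<and>
     partial_matching i L \<pi> \<and> \<pi> ` {..<i} \<subseteq> {..<n} \<and> labelled f L (\<lambda>t. t) \<and> labelled g L \<pi> \<and>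
     set labs = (\<lambda>t. column k G2 (\<pi> t)) ` L \<and> length labs = card L \<and>
     set R = (\<lambda>j. (column k G2 j, j)) ` ({..<n} - \<pi> ` {..<i}) \<and> distinct R)"

definition (in lce_search) valid_query :: "tree \<Rightarrow> bool" where
  "valid_query x \<longleftrightarrow> (\<exists>m\<le>n ^ 2 * (n + 1) div 2. LCE_query q F m k x)"

lemma (in lce_search) stage_step:
  assumes inv: "stage_invariant i s" and i: "i < n"
  defines "x \<equiv> (q, s, column k G1 i, replicate (Suc i * (n - 1)) ())"
  shows "stage_invariant (Suc i) (stage ora x)" "length (stage_queries x) \<le> n"
    "y \<in> set (stage_queries x) \<Longrightarrow> valid_query y"
proof -
  obtain f g L \<pi> labs R where s: "s = (select_rows k G1 f, select_rows k G2 g, labs, R, rev (map \<pi> [0..<i]))"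
    and P: "partial_matching i L \<pi>" and \<pi>n: "\<pi> ` {..<i} \<subseteq> {..<n}"
    and f: "labelled f L (\<lambda>t. t)" and g: "labelled g L \<pi>"
    and labs: "set labs = (\<lambda>t. column k G2 (\<pi> t)) ` L" "length labs = card L"
    and R: "set R = (\<lambda>j. (column k G2 j, j)) ` ({..<n} - \<pi> ` {..<i})" "distinct R"
    using inv unfolding stage_invariant_def by (elim exE conjE) (rule that)
  have L: "L \<subseteq> {..<i}" and inj: "inj_on \<pi> {..<i}" using P by (auto simp: partial_matching_def)
  define u where "u = replicate (Suc i * (n - 1)) ()"
  have lu: "length u = Suc i * (n - 1)" by (simp add: u_def)
  define Q where "Q = query (q, append_copies u (column k G1 i) (select_rows k G1 f), select_rows k G2 g, u)"
  have Q_eq: "Q (column k G2 j) = instance_tree q (select_columns k G1 (replicate (Suc i * (n - 1)) i @ f))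
      (select_columns k G2 (replicate (Suc i * (n - 1)) j @ g))" for j
    by (simp only: Q_def append_copies_select_rows query_select_rows lu)
  have test: "ora (Q (column k G2 j)) \<longleftrightarrow> test i L \<pi> j" if "j < n" for j
    unfolding Q_eq by (rule oracle_iff_test[OF f g L i that])
  have valid: "valid_query (Q (column k G2 j))" if j: "j < n" for j
  proof -
    let ?f = "replicate (Suc i * (n - 1)) i @ f" and ?g = "replicate (Suc i * (n - 1)) j @ g"
    \<comment> \<open>Even when the copies of this stage are dropped later, the submitted lists are
      labelled by \<open>insert i L\<close>, so the length bound applies to them.\<close>
    note f' = labelled_insert[OF f L i] and g' = labelled_insert[OF g L j]
    have "LCE_query q F (length ?f) k (Q (column k G2 j))"
      unfolding Q_eq by (rule LCE_query_select)
        (use f' g' labelled_length[OF f'] labelled_length[OF g'] in \<open>auto simp only: labelled_def\<close>)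
    moreover have "length ?f \<le> n ^ 2 * (n + 1) div 2"
      by (rule labelled_length_le[OF f']) (use L i in auto)
    ultimately show ?thesis unfolding valid_query_def by blast
  qed
  have queries: "stage_queries x = map Q (labs @ map fst R)"
    by (simp add: stage_queries_def x_def s Q_def u_def)
  \<comment> \<open>At most \<open>i\<close> labelled and exactly \<open>n - i\<close> unmatched
    columns are submitted, hence at most \<open>n\<close> in total.\<close>
  have "card L \<le> i" using card_mono[OF _ L] by simp
  moreover have "length R = n - i"
  proof -
    have "length R = card ({..<n} - \<pi> ` {..<i})"
      using distinct_card[OF R(2)] R(1) by (simp add: card_image inj_on_def)
    also have "\<dots> = n - i" using \<pi>n inj by (simp add: card_Diff_subset card_image)
    finally show ?thesis .
  qed
  ultimately show "length (stage_queries x) \<le> n" using labs(2) i by (simp add: queries)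
  have \<pi>L: "\<pi> t < n" if "t \<in> L" for t using that L \<pi>n by blast
  show "valid_query y" if y: "y \<in> set (stage_queries x)"
  proof -
    obtain d where d: "d \<in> set labs \<or> d \<in> fst ` set R" "y = Q d" using y unfolding queries by auto
    have "\<exists>j<n. d = column k G2 j" using d(1)
    proof
      assume "d \<in> set labs"
      then show ?thesis unfolding labs(1) using \<pi>L by blast
    next
      assume "d \<in> fst ` set R"
      then show ?thesis unfolding R(1) by auto
    qed
    then show ?thesis using valid d(2) by blast
  qed
  have labelled_hit: "True \<in> set (map (\<lambda>d. ora (Q d)) labs) \<longleftrightarrow> (\<exists>t\<in>L. i < n \<and> proportional C1 t i)"
  proof -
    have "True \<in> set (map (\<lambda>d. ora (Q d)) labs) \<longleftrightarrow> (\<exists>t\<in>L. ora (Q (column k G2 (\<pi> t))))"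
      using labs(1) by (auto simp: image_iff)
    also have "\<dots> \<longleftrightarrow> (\<exists>t\<in>L. i < n \<and> proportional C1 t i)"
      using test[OF \<pi>L] test_used_iff[OF P i] by blast
    finally show ?thesis .
  qed
  \<comment> \<open>An acceptable candidate exists among the unmatched columns, so
    \<open>pick\<close> does not return its default.\<close>
  obtain j0 where j0: "j0 < n" "j0 \<notin> \<pi> ` {..<i}" "test i L \<pi> j0" using test_exists[OF P i] by blast
  obtain b R' where pick: "pick ([], 0) (map (\<lambda>a. (ora (Q (fst a)), a)) R) = ((True, b), R')"
    and b: "b \<in> set R" "ora (Q (fst b))" and R': "set R' = set R - {b}" "distinct R'"
    by (rule pick_exists[of R "(column k G2 j0, j0)" "\<lambda>a. ora (Q (fst a))" "([], 0)"])
      (use R j0 test in auto)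
  obtain j where j: "b = (column k G2 j, j)" "j < n" "j \<notin> \<pi> ` {..<i}" using b(1) R(1) by auto
  have "test i L \<pi> j" using test[OF j(2)] b(2) j(1) by simp
  note extend = test_extend[OF P i j(2) this j(3) refl]
  let ?\<pi> = "\<pi>(i := j)"
  have out: "j # rev (map \<pi> [0..<i]) = rev (map ?\<pi> [0..<Suc i])" by simp
  have \<pi>n': "?\<pi> ` {..<Suc i} \<subseteq> {..<n}" using \<pi>n j(2) by (auto simp: lessThan_Suc)
  have "?\<pi> ` {..<Suc i} = insert j (\<pi> ` {..<i})" by (auto simp: lessThan_Suc)
  then have R'_eq: "set R' = (\<lambda>j. (column k G2 j, j)) ` ({..<n} - ?\<pi> ` {..<Suc i})"
    unfolding R'(1) R(1) j(1) by auto
  have stage_eq: "stage ora x = (if True \<in> set (map (\<lambda>d. ora (Q d)) labs)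
      then (select_rows k G1 f, select_rows k G2 g, labs, R', j # rev (map \<pi> [0..<i]))
      else (append_copies u (column k G1 i) (select_rows k G1 f), append_copies u (column k G2 j) (select_rows k G2 g),
        column k G2 j # labs, R', j # rev (map \<pi> [0..<i])))"
    using pick unfolding x_def s u_def[symmetric] stage_def
    by (simp add: Q_def[symmetric] j(1) split_def Let_def)
  have \<pi>_eq: "\<pi> t = ?\<pi> t" if "t \<in> L" for t using that L by auto
  show "stage_invariant (Suc i) (stage ora x)"
  proof (cases "\<exists>t\<in>L. i < n \<and> proportional C1 t i")
    case True
    then have st: "stage ora x = (select_rows k G1 f, select_rows k G2 g, labs, R', rev (map ?\<pi> [0..<Suc i]))"
      unfolding stage_eq labelled_hit out by (simp only: if_True)
    have 1: "labelled g L ?\<pi>" by (rule labelled_cong[OF g \<pi>_eq])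
    have 2: "set labs = (\<lambda>t. column k G2 (?\<pi> t)) ` L"
      unfolding labs(1) using \<pi>_eq by (intro image_cong) auto
    have 3: "partial_matching (Suc i) L ?\<pi>" using extend True by (simp only: if_True)
    show ?thesis unfolding stage_invariant_def st
      by (intro exI conjI, rule refl) (rule 3 \<pi>n' f 1 2 labs(2) R'_eq R'(2))+
  next
    case False
    then have st: "stage ora x = (select_rows k G1 (replicate (Suc i * (n - 1)) i @ f),
        select_rows k G2 (replicate (Suc i * (n - 1)) j @ g), column k G2 j # labs, R', rev (map ?\<pi> [0..<Suc i]))"
      unfolding stage_eq labelled_hit out append_copies_select_rows lu by (simp only: if_False)
    have "(\<lambda>t. t)(i := i) = (\<lambda>t. t)" by auto
    then have 1: "labelled (replicate (Suc i * (n - 1)) i @ f) (insert i L) (\<lambda>t. t)"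
      using labelled_insert[OF f L i] by (simp only:)
    have 2: "set (column k G2 j # labs) = (\<lambda>t. column k G2 (?\<pi> t)) ` insert i L"
      using labs(1) \<pi>_eq by auto
    have 3: "length (column k G2 j # labs) = card (insert i L)"
      using labs(2) L finite_subset[OF L] by (subst card_insert_disjoint) auto
    have 4: "partial_matching (Suc i) (insert i L) ?\<pi>" using extend False by (simp only: if_False)
    show ?thesis unfolding stage_invariant_def st
      by (intro exI conjI, rule refl) (rule 4 \<pi>n' 1 labelled_insert[OF g L j(2)] 2 3 R'_eq R'(2))+
  qed
qed

lemma (in lce_search) stages:
  assumes "stage_invariant i s" "i \<le> n"
  defines "l \<equiv> map (\<lambda>i. (column k G1 i, replicate (Suc i * (n - 1)) ())) [i..<n]"
  shows "stage_invariant n (foldl (\<lambda>s a. stage ora (q, s, a)) s l) \<and>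
    length (fold_queries (\<lambda>s a. stage ora (q, s, a)) (\<lambda>s a. stage_queries (q, s, a)) s l) \<le> (n - i) * n \<and>
    (\<forall>y\<in>set (fold_queries (\<lambda>s a. stage ora (q, s, a)) (\<lambda>s a. stage_queries (q, s, a)) s l). valid_query y)"
  unfolding l_def using assms(1,2)
proof (induction "n - i" arbitrary: i s)
  case 0
  then show ?case by simp
next
  case (Suc d)
  let ?x = "(column k G1 i, replicate (Suc i * (n - 1)) ())"
  let ?s = "stage ora (q, s, ?x)"
  have i: "i < n" using Suc.hyps(2) by simp
  note step = stage_step[OF Suc.prems(1) i]
  have IH: "stage_invariant n (foldl (\<lambda>s a. stage ora (q, s, a)) ?s (map (\<lambda>i. (column k G1 i, replicate (Suc i * (n - 1)) ())) [Suc i..<n])) \<and>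
    length (fold_queries (\<lambda>s a. stage ora (q, s, a)) (\<lambda>s a. stage_queries (q, s, a)) ?s (map (\<lambda>i. (column k G1 i, replicate (Suc i * (n - 1)) ())) [Suc i..<n])) \<le> (n - Suc i) * n \<and>
    (\<forall>y\<in>set (fold_queries (\<lambda>s a. stage ora (q, s, a)) (\<lambda>s a. stage_queries (q, s, a)) ?s (map (\<lambda>i. (column k G1 i, replicate (Suc i * (n - 1)) ())) [Suc i..<n])). valid_query y)"
    by (rule Suc.hyps(1)) (use Suc.hyps(2) step(1) i in auto)
  have "(n - i) * n = n + (n - Suc i) * n" using i by (simp add: Suc_diff_Suc[symmetric])
  then show ?case
    using IH step(2,3) unfolding upt_conv_Cons[OF i] list.map foldl.simps fold_queries.simps
    by (auto simp del: mult_Suc replicate.simps)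
qed

lemma (in lce_search) search_correct:
  assumes eq: "linearly_equivalent F n C1 C2"
  defines "x \<equiv> (q, mat_to_list G1, mat_to_list G2, ())"
  shows "\<exists>\<pi> v. snd (snd (snd (snd (search ora x)))) = rev (map \<pi> [0..<n]) \<and>
      \<pi> permutes {..<n} \<and> scaling F n v \<and> isometry F n \<pi> v ` C1 = C2"
    "length (search_queries ora x) \<le> n ^ 2" "\<forall>y\<in>set (search_queries ora x). valid_query y"
proof -
  note sub = linear_code_subset[OF C1] linear_code_subset[OF C2]
  have id: "pull n (\<lambda>j. j) ` C1 = C1" "pull n (\<lambda>j. j) ` C2 = C2"
    using pull_id sub by (force simp: image_iff subset_iff)+
  \<comment> \<open>With the identity as \<open>f\<close> and \<open>g\<close>, the criterion for
    repeated columns turns the given equivalence into the balanced matching with which the invariant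
    starts.\<close>
  have "linearly_equivalent F n (pull n (\<lambda>j. j) ` C1) (pull n (\<lambda>j. j) ` C2)" using eq id by simp
  from this[unfolded linearly_equivalent_pull_iff[OF sub image_ident image_ident]]
  obtain R where R: "matching n C1 C2 R"
    and card: "\<And>i j. R i j \<Longrightarrow> card {l. l < n \<and> R l j} = card {l. l < n \<and> R i l}" by blast
  have "{l. l < n \<and> R l j} = {l. R l j}" "{l. l < n \<and> R i l} = {l. R i l}" for i j
    using dom[OF R] by auto
  then have "balanced R" using card by (simp add: balanced_def)
  then have P0: "partial_matching 0 {} (\<lambda>t. t)" using R by (auto simp: partial_matching_def)
  have lab0: "labelled [0..<n] {} (\<lambda>t. t)"
    by (auto simp: labelled_def length_filter_conv_card cong: conj_cong)
  have "G1 \<in> carrier_mat k n" "G2 \<in> carrier_mat k n"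
    using G1 G2 by (auto simp: generator_matrix_def)
  then have x: "x = (q, select_rows k G1 [0..<n], select_rows k G2 [0..<n], ())"
    unfolding x_def by (simp add: mat_to_list_eq_select_rows)
  have init: "stage_invariant 0 (initial_state x)"
    unfolding stage_invariant_def x initial_state_select_rows[OF pos(2)]
    by (intro exI conjI, (rule refl | rule P0 | rule lab0 | simp)+)
      (auto simp: distinct_map inj_on_def)
  have search: "search ora x = foldl (\<lambda>s a. stage ora (q, s, a)) (initial_state x)
      (map (\<lambda>i. (column k G1 i, replicate (Suc i * (n - 1)) ())) [0..<n])"
    "search_queries ora x = fold_queries (\<lambda>s a. stage ora (q, s, a)) (\<lambda>s a. stage_queries (q, s, a)) (initial_state x)
      (map (\<lambda>i. (column k G1 i, replicate (Suc i * (n - 1)) ())) [0..<n])"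
    unfolding search_def search_queries_def x by (simp_all only: fst_conv snd_conv schedule_select_rows[OF pos(2)])
  note stages = stages[OF init le0, folded search]
  show "length (search_queries ora x) \<le> n ^ 2" "\<forall>y\<in>set (search_queries ora x). valid_query y"
    using stages by (auto simp: power2_eq_square)
  obtain f g L \<pi> labs R where s: "search ora x = (select_rows k G1 f, select_rows k G2 g, labs, R, rev (map \<pi> [0..<n]))"
    and P: "partial_matching n L \<pi>" and \<pi>n: "\<pi> ` {..<n} \<subseteq> {..<n}"
    using stages[THEN conjunct1] unfolding stage_invariant_def by (elim exE conjE) (rule that)
  have out: "snd (snd (snd (snd (search ora x)))) = rev (map \<pi> [0..<n])" by (simp add: s)
  obtain R' where R': "matching n C1 C2 R'" "\<And>t. t < n \<Longrightarrow> R' t (\<pi> t)" and inj: "inj_on \<pi> {..<n}"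
    using P by (auto simp: partial_matching_def)
  \<comment> \<open>The invariant controls \<open>\<pi>\<close> below \<open>n\<close> only. Fixing
    everything else gives a permutation with the same output list.\<close>
  define \<sigma> where "\<sigma> t = (if t \<in> {..<n} then \<pi> t else t)" for t
  have "bij_betw \<pi> {..<n} {..<n}"
    using inj \<pi>n endo_inj_surj[OF finite_lessThan \<pi>n inj] by (simp add: bij_betw_def)
  then have "bij_betw \<sigma> {..<n} {..<n}" by (subst bij_betw_cong[of _ _ \<pi>]) (auto simp: \<sigma>_def)
  then have \<sigma>: "\<sigma> permutes {..<n}" by (rule bij_imp_permutes) (simp add: \<sigma>_def)
  have "R' t (\<sigma> t)" if "t < n" for t using R'(2)[OF that] that by (simp add: \<sigma>_def)
  from matching_isometry[where f = "\<lambda>j. j" and g = "\<lambda>j. j", OF R'(1) \<sigma> this]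
  obtain v where "scaling F n v" "isometry F n \<sigma> v ` C1 = C2" unfolding id by blast
  moreover have "snd (snd (snd (snd (search ora x)))) = rev (map \<sigma> [0..<n])"
    unfolding out by (simp add: \<sigma>_def)
  ultimately show "\<exists>\<pi> v. snd (snd (snd (snd (search ora x)))) = rev (map \<pi> [0..<n]) \<and>
      \<pi> permutes {..<n} \<and> scaling F n v \<and> isometry F n \<pi> v ` C1 = C2"
    using \<sigma> by blast
qed

text \<open>A minimum distance presupposes a nonzero code word. Positive \<open>k\<close> lets
  \<open>columns\<close> find a first row, and positive \<open>n\<close> enters the length
  bound.\<close>

lemma (in code_field) min_distance_pos:
  assumes d: "min_distance F n C d" and C: "linear_code F n k C" and G: "generator_matrix F n k G C"
  shows "0 < n" "0 < k"
proof -
  interpret V: vectorspace F "coord_space F n" by (rule coord_space_vectorspace)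
  obtain x where x: "x \<in> C" "x \<noteq> \<zero>\<^bsub>coord_space F n\<^esub>" using d by (auto simp: min_distance_def)
  show "0 < n"
  proof (rule ccontr)
    assume "\<not> 0 < n"
    then show False using x linear_code_subset[OF C] by (auto simp: coord_space_simps restrict_def)
  qed
  show "0 < k"
  proof (rule ccontr)
    assume "\<not> 0 < k"
    then have "C = V.span {}" using G by (simp add: generator_matrix_def)
    then show False using x V.span_empty by simp
  qed
qed

theorem theorem2:
  shows "\<exists>(P :: prog) (p :: nat poly).
    \<forall>q F n k d C1 C2 G1 G2 ora.
      finite_field q F \<and>
      nkd_code F n k d C1 \<and> generator_matrix F n k G1 C1 \<and>
      nkd_code F n k d C2 \<and> generator_matrix F n k G2 C2 \<and>
      linearly_equivalent F n C1 C2 \<and>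
      LCE_oracle q F ora \<longrightarrow>
      (\<exists>t qs s \<pi>.
         run ora P (initial_store (instance_tree q G1 G2)) t qs s \<and>
         t \<le> poly p (tree_size (instance_tree q G1 G2)) \<and>
         s 0 = perm_tree n \<pi> \<and> \<pi> permutes {..<n} \<and>
         (\<exists>v. scaling F n v \<and> isometry F n \<pi> v ` C1 = C2) \<and>
         length qs \<le> n ^ 2 \<and>
         (\<forall>x\<in>set qs. \<exists>m \<le> n ^ 2 * (n + 1) div 2. LCE_query q F m k x))"
proof -
  obtain P p where P: "\<And>ora x. \<exists>t s. run ora P (initial_store (input_tree x)) t (search_queries ora x) s \<and>
     t \<le> poly p (tree_size (input_tree x)) \<and> s 0 = row_tree (rev (snd (snd (snd (snd (search ora x))))))"
    using search_program by blast
  show ?thesis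
  proof (rule exI[of _ P], rule exI[of _ p], intro allI impI, elim conjE)
    fix q F n k d C1 C2 G1 G2 ora
    assume F: "finite_field q F" and C1: "nkd_code F n k d C1" and G1: "generator_matrix F n k G1 C1"
      and C2: "nkd_code F n k d C2" and G2: "generator_matrix F n k G2 C2"
      and eq: "linearly_equivalent F n C1 C2" and ora: "LCE_oracle q F ora"
    interpret code_field q F using F by unfold_locales
    have codes: "linear_code F n k C1" "linear_code F n k C2" "min_distance F n C1 d"
      using C1 C2 by (auto simp: nkd_code_def)
    interpret lce_search q F n k C1 C2 G1 G2 ora
      by unfold_locales (use codes G1 G2 ora min_distance_pos[OF codes(3,1) G1] in auto)
    define x where "x = (q, mat_to_list G1, mat_to_list G2, ())"
    obtain t s where run: "run ora P (initial_store (input_tree x)) t (search_queries ora x) s"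
      "t \<le> poly p (tree_size (input_tree x))" "s 0 = row_tree (rev (snd (snd (snd (snd (search ora x))))))"
      using P by blast
    note correct = search_correct[OF eq, folded x_def]
    obtain \<pi> v where \<pi>: "snd (snd (snd (snd (search ora x)))) = rev (map \<pi> [0..<n])"
      "\<pi> permutes {..<n}" "scaling F n v" "isometry F n \<pi> v ` C1 = C2"
      using correct(1) by blast
    have "s 0 = perm_tree n \<pi>"
      by (simp add: run(3) \<pi>(1) perm_tree_def seq_tree_def comp_def)
    then show "\<exists>t qs s \<pi>.
         run ora P (initial_store (instance_tree q G1 G2)) t qs s \<and>
         t \<le> poly p (tree_size (instance_tree q G1 G2)) \<and>
         s 0 = perm_tree n \<pi> \<and> \<pi> permutes {..<n} \<and>
         (\<exists>v. scaling F n v \<and> isometry F n \<pi> v ` C1 = C2) \<and>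
         length qs \<le> n ^ 2 \<and>
         (\<forall>x\<in>set qs. \<exists>m \<le> n ^ 2 * (n + 1) div 2. LCE_query q F m k x)"
      unfolding instance_tree_eq x_def[symmetric]
      using run(1,2) \<pi>(2-4) correct(2,3)[unfolded valid_query_def] by blast
  qed
qed

end
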